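(* Let $\epsilon>0$ and $r\in\mathbb{N}$, $r\ge 1$. Then there exists $n\ge 0$ such that for every $N$, every composition $\lambda$ of $N$ and every indices $1\le i_1<i_2<\dots<i_r\le N$ with $i_{j+1}-i_j\ge n$ for all $1\le j<r$, $$d_{\pi}\Big(\mu\big(\tfrac{\sigma_\lambda(i_1)}{N},\dots,\tfrac{\sigma_\lambda(i_r)}{N}\big),\ \mu\big(\tfrac{\sigma_\lambda(i_1)}{N}\big)\otimes\dots\otimes\mu\big(\tfrac{\sigma_\lambda(i_r)}{N}\big)\Big)\le\epsilon,$$ where $d_\pi$ is the Lévy–Prokhorov metric on probability measures on $[0,1]^r$.
   Context: A composition $\lambda$ of $N$ is a finite sequence of positive integers $(\lambda_1,\dots,\lambda_k)$ with $\sum_j\lambda_j=N$; its descent set is $D_\lambda=\{\lambda_1,\lambda_1+\lambda_2,\dots,\lambda_1+\dots+\lambda_{k-1}\}\subseteq\{1,\dots,N-1\}$. A descent of a permutation $\sigma$ of $\{1,\dots,N\}$ is an $i\in\{1,\dots,N-1\}$ with $\sigma(i)>\sigma(i+1)$. $\sigma_\lambda$ denotes a uniformly random permutation of $\{1,\dots,N\}$ among those whose set of descents is exactly $D_\lambda$. For a random vector $V$, $\mu(V)$ denotes its law, and $\otimes$ denotes the product of laws. *)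

theory Defs
  imports "HOL-Probability.Probability" "HOL-Combinatorics.Permutations"
begin

definition is_composition :: "nat \<Rightarrow> nat list \<Rightarrow> bool" where
  "is_composition N lam \<longleftrightarrow> (\<forall>x\<in>set lam. 0 < x) \<and> sum_list lam = N"

definition comp_descents :: "nat list \<Rightarrow> nat set" where
  "comp_descents lam = {sum_list (take k lam) | k. 1 \<le> k \<and> k < length lam}"

definition perm_descents :: "nat \<Rightarrow> (nat \<Rightarrow> nat) \<Rightarrow> nat set" where
  "perm_descents N \<sigma> = {i. 1 \<le> i \<and> i < N \<and> \<sigma> (Suc i) < \<sigma> i}"

definition sigma_lambda :: "nat \<Rightarrow> nat list \<Rightarrow> (nat \<Rightarrow> nat) pmf" where
  "sigma_lambda N lam =
     pmf_of_set {\<sigma>. \<sigma> permutes {1..N} \<and> perm_descents N \<sigma> = comp_descents lam}"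

fun prod_pmf_list :: "'a pmf list \<Rightarrow> 'a list pmf" where
  "prod_pmf_list [] = return_pmf []"
| "prod_pmf_list (p # ps) =
     bind_pmf p (\<lambda>x. bind_pmf (prod_pmf_list ps) (\<lambda>xs. return_pmf (x # xs)))"

text \<open>Euclidean distance on points of R^r represented as real lists of length r.\<close>
definition eucl_list_dist :: "real list \<Rightarrow> real list \<Rightarrow> real" where
  "eucl_list_dist xs ys = sqrt (\<Sum>(x, y)\<leftarrow>zip xs ys. (x - y)\<^sup>2)"

definition eps_nbhd :: "('a \<Rightarrow> 'a \<Rightarrow> real) \<Rightarrow> real \<Rightarrow> 'a set \<Rightarrow> 'a set" where
  "eps_nbhd d e A = {x. \<exists>y\<in>A. d x y < e}"

definition levy_prokhorov :: "('a \<Rightarrow> 'a \<Rightarrow> real) \<Rightarrow> 'a pmf \<Rightarrow> 'a pmf \<Rightarrow> real" where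
  "levy_prokhorov d p q = Inf {e. 0 < e \<and>
      (\<forall>A. measure_pmf.prob p A \<le> measure_pmf.prob q (eps_nbhd d e A) + e \<and>
           measure_pmf.prob q A \<le> measure_pmf.prob p (eps_nbhd d e A) + e)}"

end

theory Submission
  imports Defs
begin

text \<open>Replace the permutation by independent uniform variables \<open>x 0, \<dots>, x L\<close> on \<open>[0, 1]\<close> conditioned
  on their ascents and descents: their ranks have the law of \<open>\<sigma>\<^sub>\<lambda>\<close>, the normalised ranks are uniformly
  close to the variables, and the variables form a Markov chain.

  A point lying in a long run is concentrated, because its density is squeezed between those of two
  nearby Beta distributions. So let \<open>j\<close> lie in a short run, and look at the range of the conditional
  expectation of a function of \<open>x j\<close> given \<open>x i\<close> as \<open>i\<close> moves away from \<open>j\<close> to the left. Let \<open>v\<close> be a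
  valley followed by a run of \<open>m\<close> ascents and preceded by at least \<open>q\<close> descents. On the scale \<open>1 / m\<close>, the
  likelihood of everything to the right of \<open>v\<close> is almost constant in \<open>x v\<close>, and \<open>x v\<close> has this order of
  magnitude whatever the earlier values are. Hence every turning point shrinks the range by a constant
  factor, and if \<open>q\<close> is much larger than \<open>m\<close> then the range becomes as small as \<open>2 m / (q + 1)\<close>. Walking
  from a short run to the left over a long distance one meets many turning points or a big ratio of
  consecutive run lengths. Peaks are handled by the reflection \<open>x \<mapsto> 1 - x\<close>.

  Peeling off the points one at a time from the right yields asymptotic factorisation for products of
  Lipschitz functions, and a partition of unity by such products controls the Levy-Prokhorov
  distance.\<close>

section \<open>Integration over a neighbouring value\<close>

text \<open>The gap may depend only on \<epsilon> and r, while the run lengths of \<lambda> are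
  unbounded; this is why two unrelated mechanisms are needed. Two marked points may share a long
  run, with no turning point between them to erase the dependence; but there the spread of a value
  is at most of order one over the square root of the run length, so it is almost deterministic. A
  threshold \<open>M\<close>, fixed by the accuracy and the Lipschitz constant, separates this case
  from that of a short run. In the latter the bound on the run lengths is allowed to grow by a
  factor \<open>\<Lambda>\<close> from one turning point to the next. If it is exceeded once, a
  single contraction by \<open>2 / \<Lambda>\<close> is enough; otherwise enough contractions by
  \<open>15 / 16\<close> fit into an explicitly bounded distance. Conditional expectations are never
  formed, because likelihoods may vanish at 0 and 1. Numerator \<open>f\<close> and denominator
  \<open>w\<close> are kept as two solutions of the same positive linear recursion, and a ratio is
  controlled by inequalities \<open>c * w x \<le> f x \<le> (c + \<eta>) * w x\<close>. Positivity
  alone preserves them; only the strict gain at a turning point needs analysis.\<close>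

definition up :: "(real \<Rightarrow> real) \<Rightarrow> real \<Rightarrow> real" where
  "up f x = integral {x..1} f"

definition dn :: "(real \<Rightarrow> real) \<Rightarrow> real \<Rightarrow> real" where
  "dn f x = integral {0..x} f"

text \<open>The Boolean says whether the step to the next position is an ascent; the value is then
  the integral of \<open>f\<close> over all admissible next values when the present one is
  \<open>x\<close>.\<close>

definition stp :: "bool \<Rightarrow> (real \<Rightarrow> real) \<Rightarrow> real \<Rightarrow> real" where
  "stp b = (if b then up else dn)"

abbreviation cts :: "(real \<Rightarrow> real) \<Rightarrow> bool" where
  "cts f \<equiv> continuous_on {0..1} f"

definition nonneg :: "(real \<Rightarrow> real) \<Rightarrow> bool" where
  "nonneg f \<longleftrightarrow> (\<forall>x\<in>{0..1}. 0 \<le> f x)"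

lemma cts_integrable:
  assumes "cts f" "0 \<le> a" "b \<le> 1"
  shows "f integrable_on {a..b}"
  by (rule integrable_continuous_interval, rule continuous_on_subset[OF assms(1)]) (use assms in auto)

lemma cts_stp: "cts f \<Longrightarrow> cts (stp b f)"
  by (cases b) (auto simp: stp_def up_def[abs_def] dn_def[abs_def] cts_integrable
      intro!: indefinite_integral_continuous_1 indefinite_integral_continuous_1')

lemma stp_mono:
  assumes "cts f" "cts g" "\<And>x. x \<in> {0..1} \<Longrightarrow> f x \<le> g x" "x \<in> {0..1}"
  shows "stp b f x \<le> stp b g x"
  using assms by (cases b) (auto simp: stp_def up_def dn_def intro!: integral_le cts_integrable)

lemma stp_cong:
  assumes "\<And>x. x \<in> {0..1} \<Longrightarrow> f x = g x" "x \<in> {0..1}"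
  shows "stp b f x = stp b g x"
  using assms by (cases b) (auto simp: stp_def up_def dn_def intro!: integral_cong)

lemma stp_lin:
  assumes "cts f" "cts g" "x \<in> {0..1}"
  shows "stp b (\<lambda>x. c * f x + d * g x) x = c * stp b f x + d * stp b g x"
proof -
  have *: "integral {p..q} (\<lambda>x. c * f x + d * g x) = c * integral {p..q} f + d * integral {p..q} g"
    if "0 \<le> p" "q \<le> 1" for p q
    using cts_integrable[OF assms(1) that] cts_integrable[OF assms(2) that]
    by (subst Henstock_Kurzweil_Integration.integral_add)
      (auto intro!: integrable_on_mult_right)
  show ?thesis using assms by (cases b) (auto simp: stp_def up_def dn_def *)
qed

lemma stp_cmult:
  assumes "cts f" "x \<in> {0..1}"
  shows "stp b (\<lambda>x. c * f x) x = c * stp b f x"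
  using stp_lin[OF assms(1) assms(1) assms(2), of b c 0] by simp

lemma stp_0 [simp]: "stp b (\<lambda>x. 0) x = 0"
  by (simp add: stp_def up_def dn_def)

lemma stp_nonneg: "cts f \<Longrightarrow> nonneg f \<Longrightarrow> nonneg (stp b f)"
  using stp_mono[of "\<lambda>_. 0" f] by (auto simp: nonneg_def)

lemma integral_reflect01:
  fixes f :: "real \<Rightarrow> real"
  shows "integral {a..b} (\<lambda>x. f (1 - x)) = integral {1-b..1-a} f"
proof -
  have "integral {a..b} (\<lambda>x. f (1 - x)) = integral {-b .. -a} (\<lambda>x. f (1 + x))"
    using Henstock_Kurzweil_Integration.integral_reflect_real[of b a "\<lambda>x. f (1 - x)"] by simp
  also have "\<dots> = integral {1-b..1-a} f"
    using integral_shift_Icc_real[of "-b" "-a" f 1] by (simp add: o_def)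
  finally show ?thesis .
qed

lemma stp_flip: "stp (\<not> b) (\<lambda>x. f (1 - x)) x = stp b f (1 - x)"
  by (cases b) (auto simp: stp_def up_def dn_def integral_reflect01)

lemma cts_flip: "cts f \<Longrightarrow> cts (\<lambda>x. f (1 - x))"
  by (rule continuous_on_compose2[of "{0..1}" f]) (auto intro!: continuous_intros)

lemma nonneg_flip: "nonneg f \<Longrightarrow> nonneg (\<lambda>x. f (1 - x))"
  by (auto simp: nonneg_def)

lemma up_antimono:
  assumes "cts f" "nonneg f" "0 \<le> x" "x \<le> y" "y \<le> 1"
  shows "up f y \<le> up f x"
  unfolding up_def using assms
  by (intro integral_subset_le cts_integrable) (auto simp: nonneg_def)

lemma dn_mono:
  assumes "cts f" "nonneg f" "0 \<le> x" "x \<le> y" "y \<le> 1"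
  shows "dn f x \<le> dn f y"
  unfolding dn_def using assms
  by (intro integral_subset_le cts_integrable) (auto simp: nonneg_def)

text \<open>Up to the substitution \<open>y = a + (1 - a) * x\<close>, these say that \<open>f x / (1 - x) ^ m\<close> is
  increasing, respectively decreasing.\<close>

definition rel_inc :: "nat \<Rightarrow> (real \<Rightarrow> real) \<Rightarrow> bool" where
  "rel_inc m f \<longleftrightarrow> (\<forall>a\<in>{0..1}. \<forall>x\<in>{0..1}. (1 - a) ^ m * f x \<le> f (a + (1 - a) * x))"

definition rel_dec :: "nat \<Rightarrow> (real \<Rightarrow> real) \<Rightarrow> bool" where
  "rel_dec m f \<longleftrightarrow> (\<forall>a\<in>{0..1}. \<forall>x\<in>{0..1}. f (a + (1 - a) * x) \<le> (1 - a) ^ m * f x)"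

lemma affine01: "a \<in> {0..1} \<Longrightarrow> x \<in> {0..1} \<Longrightarrow> a + (1 - a) * x \<in> {0..(1::real)}"
proof -
  assume a: "a \<in> {0..1}" "x \<in> {0..1}"
  then have "0 \<le> (1 - a) * x" "0 \<le> (1 - a) * (1 - x)" by simp_all
  with a show ?thesis by (auto simp: algebra_simps)
qed

lemma up_affine:
  assumes "cts f" "a \<in> {0..1}" "x \<in> {0..1}"
  shows "up f (a + (1 - a) * x) = (1 - a) * up (\<lambda>u. f (a + (1 - a) * u)) x"
proof (cases "a = 1")
  case True then show ?thesis by (simp add: up_def)
next
  case False
  with assms have a: "0 < 1 - a" by auto
  have "(f has_integral up f (a + (1 - a) * x)) {a + (1 - a) * x..1}"
    unfolding up_def using assms affine01[of a x] by (intro integrable_integral cts_integrable) auto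
  then have "(f has_integral up f (a + (1 - a) * x)) (cbox (a + (1 - a) * x) 1)" by simp
  from has_integral_affinity'[OF this a, of a]
  have "((\<lambda>u. f ((1 - a) * u + a)) has_integral up f (a + (1 - a) * x) / (1 - a))
      {((1 - a) * x) / (1 - a)..1}"
    using a by (simp add: divide_inverse_commute)
  then have "((\<lambda>u. f (a + (1 - a) * u)) has_integral up f (a + (1 - a) * x) / (1 - a)) {x..1}"
    using a by (simp add: add.commute)
  then show ?thesis using a unfolding up_def[of "\<lambda>u. f (a + (1 - a) * u)"]
    by (simp add: integral_unique)
qed

lemma cts_affine:
  assumes "cts f" "a \<in> {0..1}" shows "cts (\<lambda>u. f (a + (1 - a) * u))"
  by (rule continuous_on_compose2[OF assms(1)]) (use affine01[OF assms(2)] in \<open>auto intro!: continuous_intros\<close>)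

text \<open>The substitution in \<open>up_affine\<close> contributes one factor
  \<open>1 - a\<close>, so every ascent raises the exponent by one. A run of ascents thus imposes a
  power of \<open>1 - x\<close> whose exponent is its length.\<close>

lemma rel_inc_up:
  assumes "cts f" "rel_inc m f"
  shows "rel_inc (Suc m) (up f)"
  unfolding rel_inc_def
proof (intro ballI)
  fix a x :: real assume a: "a \<in> {0..1}" "x \<in> {0..1}"
  have "(1 - a) ^ m * up f x \<le> up (\<lambda>u. f (a + (1 - a) * u)) x"
    using stp_mono[of "\<lambda>u. (1 - a) ^ m * f u" "\<lambda>u. f (a + (1 - a) * u)" x True]
      stp_cmult[OF assms(1) a(2), of True "(1 - a) ^ m"] assms a
    by (simp add: stp_def rel_inc_def cts_affine continuous_on_mult)
  then have "(1 - a) * ((1 - a) ^ m * up f x) \<le> (1 - a) * up (\<lambda>u. f (a + (1 - a) * u)) x"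
    using a by (intro mult_left_mono) auto
  then show "(1 - a) ^ Suc m * up f x \<le> up f (a + (1 - a) * x)"
    using up_affine[OF assms(1) a] by simp
qed

lemma rel_dec_up:
  assumes "cts f" "rel_dec m f"
  shows "rel_dec (Suc m) (up f)"
  unfolding rel_dec_def
proof (intro ballI)
  fix a x :: real assume a: "a \<in> {0..1}" "x \<in> {0..1}"
  have "up (\<lambda>u. f (a + (1 - a) * u)) x \<le> (1 - a) ^ m * up f x"
    using stp_mono[of "\<lambda>u. f (a + (1 - a) * u)" "\<lambda>u. (1 - a) ^ m * f u" x True]
      stp_cmult[OF assms(1) a(2), of True "(1 - a) ^ m"] assms a
    by (simp add: stp_def rel_dec_def cts_affine continuous_on_mult)
  then have "(1 - a) * up (\<lambda>u. f (a + (1 - a) * u)) x \<le> (1 - a) * ((1 - a) ^ m * up f x)"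
    using a by (intro mult_left_mono) auto
  then show "up f (a + (1 - a) * x) \<le> (1 - a) ^ Suc m * up f x"
    using up_affine[OF assms(1) a] by simp
qed

lemma affine_ge: "a \<in> {0..1} \<Longrightarrow> x \<in> {0..1} \<Longrightarrow> (x::real) \<le> a + (1 - a) * x"
  using mult_nonneg_nonneg[of a "1 - x"] by (auto simp: algebra_simps)

lemma rel_inc_0:
  assumes "mono_on {0..1} f"
  shows "rel_inc 0 f"
  unfolding rel_inc_def
  by (intro ballI, simp, rule monotone_onD[OF assms]) (use affine01 affine_ge in auto)

lemma rel_dec_0:
  assumes "antimono_on {0..1} f"
  shows "rel_dec 0 f"
  unfolding rel_dec_def
  by (intro ballI, simp, rule monotone_onD[OF assms]) (use affine01 affine_ge in auto)

text \<open>The affine form is the one that survives \<open>up\<close>; choosing \<open>a\<close>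
  with \<open>a + (1 - a) * x = y\<close> converts it into monotonicity of the quotient by
  \<open>(1 - x) ^ m\<close>, cross-multiplied because \<open>1 - y\<close> may be 0. For
  \<open>x = 1\<close> also \<open>y = 1\<close>, and \<open>a = 0\<close> is a valid
  choice.\<close>

lemma rel_ratio:
  assumes "0 \<le> x" "x \<le> y" "y \<le> 1"
  shows "rel_inc m f \<Longrightarrow> (1 - y) ^ m * f x \<le> (1 - x) ^ m * f y"
    and "rel_dec m f \<Longrightarrow> (1 - x) ^ m * f y \<le> (1 - y) ^ m * f x"
proof -
  define a where "a = (if x = 1 then 0 else (y - x) / (1 - x))"
  have a: "a \<in> {0..1}" "a + (1 - a) * x = y" "(1 - a) * (1 - x) = 1 - y"
    using assms by (auto simp: a_def field_simps)
  have p: "(1 - y) ^ m = (1 - a) ^ m * (1 - x) ^ m"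
    by (simp flip: a(3) add: power_mult_distrib)
  show "(1 - y) ^ m * f x \<le> (1 - x) ^ m * f y" if "rel_inc m f"
  proof -
    have "(1 - a) ^ m * f x \<le> f y" using that a assms unfolding rel_inc_def by force
    then have "(1 - x) ^ m * ((1 - a) ^ m * f x) \<le> (1 - x) ^ m * f y"
      using assms by (intro mult_left_mono) auto
    then show ?thesis by (simp add: p mult_ac)
  qed
  show "(1 - x) ^ m * f y \<le> (1 - y) ^ m * f x" if "rel_dec m f"
  proof -
    have "f y \<le> (1 - a) ^ m * f x" using that a assms unfolding rel_dec_def by force
    then have "(1 - x) ^ m * f y \<le> (1 - x) ^ m * ((1 - a) ^ m * f x)"
      using assms by (intro mult_left_mono) auto
    then show ?thesis by (simp add: p mult_ac)
  qed
qed

section \<open>Mixing at turning points\<close>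

text \<open>The last function is left free. Hence the same notion covers the likelihoods themselves
  and the likelihoods weighted by a function of the value at the last position.\<close>

definition chain :: "(nat \<Rightarrow> bool) \<Rightarrow> (nat \<Rightarrow> real \<Rightarrow> real) \<Rightarrow> nat \<Rightarrow> bool" where
  "chain s w L \<longleftrightarrow> (\<forall>k\<le>L. cts (w k)) \<and> (\<forall>k<L. \<forall>x\<in>{0..1}. w k x = stp (s k) (w (Suc k)) x)"

lemma chainD:
  assumes "chain s w L"
  shows "k \<le> L \<Longrightarrow> cts (w k)" "k < L \<Longrightarrow> x \<in> {0..1} \<Longrightarrow> w k x = stp (s k) (w (Suc k)) x"
  using assms by (auto simp: chain_def)

lemma chain_le: "chain s w L \<Longrightarrow> L' \<le> L \<Longrightarrow> chain s w L'"
  by (auto simp: chain_def)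

lemma chain_flip: "chain s w L \<Longrightarrow> chain (\<lambda>k. \<not> s k) (\<lambda>k x. w k (1 - x)) L"
  by (auto simp: chain_def cts_flip stp_flip)

lemma chain_lin:
  assumes "chain s f L" "chain s w L"
  shows "chain s (\<lambda>k x. c * f k x + d * w k x) L"
  using assms by (auto simp: chain_def stp_lin intro!: continuous_intros)

lemma chain_nonneg:
  assumes "chain s f L" "k \<le> k'" "k' \<le> L" "nonneg (f k')"
  shows "nonneg (f k)"
  using assms(2)
proof (induction rule: inc_induct)
  case base then show ?case by fact
next
  case (step n)
  have "nonneg (stp (s n) (f (Suc n)))"
    by (rule stp_nonneg[OF chainD(1)[OF assms(1)] step.IH]) (use step assms in simp)
  with step assms chainD(2)[OF assms(1), of n] show ?case by (auto simp: nonneg_def)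
qed

text \<open>The ratio \<open>f / w\<close> has oscillation at most \<open>\<eta>\<close>, also where \<open>w\<close> vanishes.\<close>

definition osc :: "real \<Rightarrow> (real \<Rightarrow> real) \<Rightarrow> (real \<Rightarrow> real) \<Rightarrow> bool" where
  "osc \<eta> f w \<longleftrightarrow> (\<exists>c. \<forall>x\<in>{0..1}. c * w x \<le> f x \<and> f x \<le> (c + \<eta>) * w x)"

lemma osc_flip: "osc \<eta> f w \<Longrightarrow> osc \<eta> (\<lambda>x. f (1 - x)) (\<lambda>x. w (1 - x))"
  unfolding osc_def by (elim exE, rule exI) auto

lemma osc_mono:
  assumes "osc \<eta> f w" "\<eta> \<le> \<eta>'" "nonneg w"
  shows "osc \<eta>' f w"
proof -
  from assms obtain c where c: "\<And>x. x \<in> {0..1} \<Longrightarrow> c * w x \<le> f x \<and> f x \<le> (c + \<eta>) * w x"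
    unfolding osc_def by blast
  have "f x \<le> (c + \<eta>') * w x" if "x \<in> {0..1}" for x
  proof -
    have "(c + \<eta>) * w x \<le> (c + \<eta>') * w x"
      using assms that by (intro mult_right_mono) (auto simp: nonneg_def)
    with c[OF that] show ?thesis by linarith
  qed
  with c show ?thesis unfolding osc_def by blast
qed

text \<open>Both \<open>f - c * w\<close> and \<open>(c + \<eta>) * w - f\<close> are chains, and
  nonnegativity travels to the left because \<open>stp\<close> is a positive operator. So the
  oscillation never grows, and even the constant \<open>c\<close> is kept.\<close>

lemma osc_chain:
  assumes "chain s f j" "chain s w j" "k \<le> k'" "k' \<le> j" "osc \<eta> (f k') (w k')"
  shows "osc \<eta> (f k) (w k)"
proof -
  from assms(5) obtain c where c: "\<And>x. x \<in> {0..1} \<Longrightarrow> c * w k' x \<le> f k' x \<and> f k' x \<le> (c + \<eta>) * w k' x"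
    unfolding osc_def by blast
  have "nonneg (\<lambda>x. 1 * f k x + (-c) * w k x)"
    by (rule chain_nonneg[OF chain_lin[OF assms(1,2)] assms(3,4)]) (use c in \<open>auto simp: nonneg_def\<close>)
  moreover have "nonneg (\<lambda>x. (-1) * f k x + (c + \<eta>) * w k x)"
    by (rule chain_nonneg[OF chain_lin[OF assms(1,2)] assms(3,4)]) (use c in \<open>auto simp: nonneg_def\<close>)
  ultimately show ?thesis by (auto simp: osc_def nonneg_def intro!: exI[of _ c])
qed

lemma rel_cong:
  assumes "\<And>x. x \<in> {0..1} \<Longrightarrow> f x = g x"
  shows "rel_inc m f \<longleftrightarrow> rel_inc m g" "rel_dec m f \<longleftrightarrow> rel_dec m g"
  unfolding rel_inc_def rel_dec_def using assms affine01 by auto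

lemma chain_rel_inc:
  assumes w: "chain s w L" and p: "p \<le> L" and up: "\<And>k. a \<le> k \<Longrightarrow> k < p \<Longrightarrow> s k"
    and base: "mono_on {0..1} (w p)" and k: "a \<le> k" "k \<le> p"
  shows "rel_inc (p - k) (w k)"
  using k(2,1)
proof (induction rule: inc_induct)
  case base show ?case using rel_inc_0[OF assms(4)] by simp
next
  case (step n)
  have "rel_inc (Suc (p - Suc n)) (stp (s n) (w (Suc n)))"
    using rel_inc_up[OF chainD(1)[OF w] step.IH] step p up[of n] by (simp add: stp_def)
  then show ?case using step p chainD(2)[OF w, of n] rel_cong(1)[of "w n" "stp (s n) (w (Suc n))"]
    by (simp add: Suc_diff_Suc)
qed

lemma chain_rel_dec:
  assumes w: "chain s w L" and p: "p \<le> L" and up: "\<And>k. a \<le> k \<Longrightarrow> k < p \<Longrightarrow> s k"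
    and base: "antimono_on {0..1} (w p)" and k: "a \<le> k" "k \<le> p"
  shows "rel_dec (p - k) (w k)"
  using k(2,1)
proof (induction rule: inc_induct)
  case base show ?case using rel_dec_0[OF assms(4)] by simp
next
  case (step n)
  have "rel_dec (Suc (p - Suc n)) (stp (s n) (w (Suc n)))"
    using rel_dec_up[OF chainD(1)[OF w] step.IH] step p up[of n] by (simp add: stp_def)
  then show ?case using step p chainD(2)[OF w, of n] rel_cong(2)[of "w n" "stp (s n) (w (Suc n))"]
    by (simp add: Suc_diff_Suc)
qed

lemma chain_antimono:
  assumes "chain s w L" "k < L" "s k" "nonneg (w (Suc k))"
  shows "antimono_on {0..1} (w k)"
  using assms chainD[OF assms(1)] up_antimono[of "w (Suc k)"]
  by (auto simp: stp_def intro!: monotone_onI)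

lemma chain_mono:
  assumes "chain s w L" "k < L" "\<not> s k" "nonneg (w (Suc k))"
  shows "mono_on {0..1} (w k)"
  using assms chainD[OF assms(1)] dn_mono[of "w (Suc k)"]
  by (auto simp: stp_def intro!: monotone_onI)

text \<open>\<open>full_chain s w L\<close>: up to normalisation, \<open>w k\<close> is the likelihood of the pattern to the right
  of position \<open>k\<close> given the value there.\<close>

definition full_chain :: "(nat \<Rightarrow> bool) \<Rightarrow> (nat \<Rightarrow> real \<Rightarrow> real) \<Rightarrow> nat \<Rightarrow> bool" where
  "full_chain s w L \<longleftrightarrow> chain s w L \<and> (\<forall>x\<in>{0..1}. w L x = 1)"

lemma full_chain_nonneg: "full_chain s w L \<Longrightarrow> k \<le> L \<Longrightarrow> nonneg (w k)"
  using chain_nonneg[of s w L k L] by (auto simp: full_chain_def nonneg_def)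

lemma full_chain_flip:
  "full_chain s w L \<Longrightarrow> full_chain (\<lambda>k. \<not> s k) (\<lambda>k x. w k (1 - x)) L"
  by (auto simp: full_chain_def chain_flip)

text \<open>The number \<open>m\<close> counts steps, so the run occupies the positions
  \<open>v\<close> to \<open>v + m\<close>. Maximality is asked on the right only; that
  \<open>v\<close> is a turning point is stated separately where it matters.\<close>

definition run_after :: "(nat \<Rightarrow> bool) \<Rightarrow> nat \<Rightarrow> nat \<Rightarrow> nat \<Rightarrow> bool" where
  "run_after s L v m \<longleftrightarrow> 1 \<le> m \<and> v + m \<le> L \<and> (\<forall>k. v \<le> k \<and> k < v + m \<longrightarrow> s k = s v) \<and>
     (v + m = L \<or> s (v + m) \<noteq> s v)"

lemma run_after_flip: "run_after (\<lambda>k. \<not> s k) L v m = run_after s L v m"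
  by (auto simp: run_after_def)

text \<open>Where a run of ascents stops, there is either the end of the pattern, with constant
  likelihood, or a descent, and then the likelihood is an integral with growing upper limit.\<close>

lemma full_chain_end_mono:
  assumes w: "full_chain s w L" and "p \<le> L" "p = L \<or> \<not> s p"
  shows "mono_on {0..1} (w p)"
proof (cases "p = L")
  case True then show ?thesis using w by (auto simp: full_chain_def intro!: mono_onI)
next
  case False
  then show ?thesis using assms full_chain_nonneg[OF w, of "Suc p"]
    by (intro chain_mono[of s w L]) (auto simp: full_chain_def)
qed

text \<open>The induction along the run has two starting points. At \<open>v + m\<close> the
  likelihood is increasing, which yields the exponent \<open>m\<close>; one step earlier it is an
  integral over larger values, hence decreasing, which yields \<open>m - 1\<close>. The shape of
  \<open>w v\<close> is therefore known up to a factor \<open>1 - a\<close>.\<close>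

lemma run_bounds:
  assumes w: "full_chain s w L" and r: "run_after s L v m" and "s v" and a: "a \<in> {0..1}"
  shows "(1 - a) ^ m * w v 0 \<le> w v a" "w v a \<le> (1 - a) ^ (m - 1) * w v 0"
proof -
  have ch: "chain s w L" using w by (simp add: full_chain_def)
  have 1: "rel_inc (v + m - v) (w v)"
    using r assms(3) by (intro chain_rel_inc[OF ch, where a = v] full_chain_end_mono[OF w])
      (auto simp: run_after_def)
  show "(1 - a) ^ m * w v 0 \<le> w v a" using 1 a by (force simp: rel_inc_def)
  have 2: "rel_dec (v + m - 1 - v) (w v)"
    using r assms(3) by (intro chain_rel_dec[OF ch, where a = v] chain_antimono[OF ch] full_chain_nonneg[OF w])
      (auto simp: run_after_def)
  show "w v a \<le> (1 - a) ^ (m - 1) * w v 0" using 2 a by (force simp: rel_dec_def)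
qed

section \<open>Contraction at a single turning point\<close>

lemma dn_const: "0 \<le> y \<Longrightarrow> dn (\<lambda>_. c) y = c * y"
  by (simp add: dn_def)

lemma dn_power: 
  assumes "0 \<le> y" 
  shows "dn (\<lambda>x. x ^ d / fact d) y = y ^ Suc d / fact (Suc d)"
proof -
  have "((\<lambda>x. x ^ Suc d / fact (Suc d)) has_real_derivative x ^ d / fact d) (at x within {0..y})" for x :: real
    using DERIV_cdivide[OF DERIV_pow[of "Suc d" x "{0..y}"], of "fact (Suc d)"]
    by (simp del: of_nat_Suc)
  then have "((\<lambda>x. x ^ d / fact d) has_integral (y ^ Suc d / fact (Suc d) - 0 ^ Suc d / fact (Suc d))) {0..y}"
    by (intro fundamental_theorem_of_calculus assms)
      (simp add: has_real_derivative_iff_has_vector_derivative[symmetric])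
  then have "((\<lambda>x. x ^ d / fact d) has_integral (y ^ Suc d / fact (Suc d))) {0..y}"
    by simp
  then show ?thesis unfolding dn_def by (rule integral_unique)
qed

lemma dn_one_minus_power:
  assumes "0 \<le> y" "1 \<le> m"
  shows "dn (\<lambda>x. (1 - x) ^ (m - 1)) y = (1 - (1 - y) ^ m) / m"
proof -
  have "((\<lambda>x. (1 - x) ^ (m - 1)) has_integral (- ((1 - y) ^ m) / m - (- ((1 - 0) ^ m) / m))) {0..y}"
    by (rule fundamental_theorem_of_calculus)
      (use assms in \<open>auto simp: has_real_derivative_iff_has_vector_derivative[symmetric] 
         intro!: derivative_eq_intros simp: field_simps\<close>)
  then show ?thesis by (simp add: dn_def integral_unique diff_divide_distrib)
qed

lemma bernoulli: "a \<in> {0..1} \<Longrightarrow> 1 - real m * a \<le> (1 - a) ^ m"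
  using Bernoulli_inequality[of "-a" m] by auto

text \<open>Here \<open>g\<close> stands for whichever of \<open>f v\<close> and
  \<open>w v - f v\<close> has at least half of the value of \<open>w v\<close> at 0. Since
  \<open>w - g\<close> is largest at 0, \<open>g\<close> keeps a quarter of \<open>w 0\<close> on an
  interval of length comparable with \<open>1 / m\<close>, and the upper power bound prevents
  \<open>w\<close> from having much more mass than such an interval carries. The factor 16 is 4 for
  the height times 4 for the length.\<close>

lemma valley_half:
  assumes c: "cts g" "cts w" and g: "nonneg g" and m: "1 \<le> m"
    and wg: "\<And>a. a \<in> {0..1} \<Longrightarrow> w a - g a \<le> w 0 - g 0" and g0: "w 0 / 2 \<le> g 0" and w0: "0 \<le> w 0"
    and lo: "\<And>a. a \<in> {0..1} \<Longrightarrow> (1 - a) ^ m * w 0 \<le> w a"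
    and hi: "\<And>a. a \<in> {0..1} \<Longrightarrow> w a \<le> (1 - a) ^ (m - 1) * w 0"
    and y: "y \<in> {0..1}"
  shows "dn w y / 16 \<le> dn g y"
proof -
  \<comment> \<open>Up to \<open>1 / (4 * m)\<close> Bernoulli's inequality leaves
    \<open>w a\<close> at three quarters of \<open>w 0\<close> or more, while
    \<open>w a - g a\<close> is at most one half of \<open>w 0\<close>.\<close>
  define t where "t = min y (1 / (4 * real m))"
  have t: "0 \<le> t" "t \<le> y" "t \<le> 1" using y m by (auto simp: t_def)
  have low: "w 0 / 4 \<le> g a" if a: "a \<in> {0..t}" for a
  proof -
    have a': "a \<in> {0..1}" "real m * a \<le> 1 / 4"
      using a t m by (auto, auto simp: t_def field_simps)
    have "(1 - real m * a) * w 0 \<le> (1 - a) ^ m * w 0" by (intro mult_right_mono bernoulli a' w0)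
    moreover have "3 / 4 * w 0 \<le> (1 - real m * a) * w 0" using a' w0 by (intro mult_right_mono) auto
    ultimately show ?thesis using wg[OF a'(1)] lo[OF a'(1)] g0 by linarith
  qed
  have "w 0 / 4 * t = dn (\<lambda>_. w 0 / 4) t" using t by (simp add: dn_const)
  also have "\<dots> \<le> dn g t" unfolding dn_def
    using low t by (intro integral_le cts_integrable c) auto
  also have "\<dots> \<le> dn g y" using y t by (intro dn_mono c g) auto
  finally have 1: "w 0 / 4 * t \<le> dn g y" .
  have "dn w y \<le> stp False (\<lambda>x. w 0 * (1 - x) ^ (m - 1)) y"
    using stp_mono[of w "\<lambda>x. w 0 * (1 - x) ^ (m - 1)" y False] hi y c
    by (simp add: stp_def mult.commute continuous_intros)
  also have "\<dots> = w 0 * ((1 - (1 - y) ^ m) / m)"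
    using y m dn_one_minus_power[of y m] by (subst stp_cmult) (auto simp: stp_def intro!: continuous_intros)
  also have "\<dots> \<le> w 0 * (4 * t)"
  proof (intro mult_left_mono w0)
    have "0 \<le> real m * y" "0 \<le> (1 - y) ^ m" using y by auto
    then have "1 - (1 - y) ^ m \<le> real m * (4 * y)" "1 - (1 - y) ^ m \<le> 1"
      using bernoulli[OF y, of m] by auto
    then show "(1 - (1 - y) ^ m) / m \<le> 4 * t"
      using m unfolding t_def by (auto simp: min_def pos_divide_le_eq mult_ac)
  qed
  finally show ?thesis using 1 by simp
qed

text \<open>Under \<open>q\<close> descents the linear term gains an additional divisor
  \<open>Suc q\<close> over the constant one. This is where the small ratio \<open>m / Suc q\<close>
  of consecutive run lengths originates.\<close>

lemma chain_dn_le: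
  assumes f: "chain s f v" and q: "q \<le> v" and dn: "\<And>k. v - q \<le> k \<Longrightarrow> k < v \<Longrightarrow> \<not> s k"
    and le: "\<And>x. x \<in> {0..1} \<Longrightarrow> f v x \<le> c + d * x" and x: "x \<in> {0..1}"
  shows "f (v - q) x \<le> c * (x ^ q / fact q) + d * (x ^ Suc q / fact (Suc q))"
  using q dn x
proof (induction q arbitrary: x)
  case 0 then show ?case using le[of x] by simp
next
  case (Suc q)
  have "f (v - Suc q) x = stp False (f (v - q)) x"
    using Suc.prems chainD(2)[OF f, of "v - Suc q" x] by (auto simp: Suc_diff_Suc)
  also have "\<dots> \<le> stp False (\<lambda>x. c * (x ^ q / fact q) + d * (x ^ Suc q / fact (Suc q))) x"
    using Suc.prems Suc.IH by (intro stp_mono chainD(1)[OF f]) (auto intro!: continuous_intros simp del: fact_Suc)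
  also have "\<dots> = c * (x ^ Suc q / fact (Suc q)) + d * (x ^ Suc (Suc q) / fact (Suc (Suc q)))"
    using Suc.prems dn_power[of x q] dn_power[of x "Suc q"]
    by (subst stp_lin) (auto intro!: continuous_intros simp: stp_def simp del: fact_Suc power_Suc)
  finally show ?case .
qed

text \<open>\<open>w k\<close> and \<open>f k / w k\<close> play the roles of the likelihood of the pattern to the right of
  \<open>k\<close> and of the conditional expectation, given the value at \<open>k\<close>, of a function of the value
  at \<open>j\<close>. Near \<open>0\<close> both \<open>f v\<close> and \<open>w v - f v\<close> are almost maximal.\<close>

lemma valley_contract:
  assumes w: "full_chain s w L" and f: "chain s f j" and j: "j \<le> L"
    and v: "0 < v" "v < j" "s v" "\<not> s (v - 1)" and r: "run_after s L v m"
    and bounds: "\<And>x. x \<in> {0..1} \<Longrightarrow> 0 \<le> f (Suc v) x \<and> f (Suc v) x \<le> w (Suc v) x"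
  shows "osc (15 / 16) (f (v - 1)) (w (v - 1))"
    and "\<And>q. q \<le> v \<Longrightarrow> (\<And>k. v - q \<le> k \<Longrightarrow> k < v \<Longrightarrow> \<not> s k) \<Longrightarrow> 2 * m \<le> Suc q \<Longrightarrow>
           osc (2 * real m / real (Suc q)) (f (v - q)) (w (v - q))"
proof -
  have wj: "chain s w j" using w j chain_le by (auto simp: full_chain_def)
  have d: "chain s (\<lambda>k x. (-1) * f k x + 1 * w k x) j" by (rule chain_lin[OF f wj])
  have m: "1 \<le> m" using r by (simp add: run_after_def)
  have nn: "nonneg (f v)" "nonneg (\<lambda>x. (-1) * f v x + 1 * w v x)" "nonneg (w v)"
    using chain_nonneg[OF f, of v "Suc v"] chain_nonneg[OF d, of v "Suc v"] bounds v
      full_chain_nonneg[OF w, of v] j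
    by (auto simp: nonneg_def)
  have am: "antimono_on {0..1} (f v)" "antimono_on {0..1} (\<lambda>x. (-1) * f v x + 1 * w v x)"
    by (rule chain_antimono[OF f v(2,3)] chain_antimono[OF d v(2,3)];
        use bounds in \<open>auto simp: nonneg_def\<close>)+
  have f0: "f v a \<le> f v 0" and d0: "w v a - f v a \<le> w v 0 - f v 0" if "a \<in> {0..1}" for a
    using monotone_onD[OF am(1), of 0 a] monotone_onD[OF am(2), of 0 a] that by auto
  have w0: "0 \<le> w v 0" and fw0: "0 \<le> f v 0" "f v 0 \<le> w v 0" using nn by (auto simp: nonneg_def)
  note b = run_bounds[OF w r v(3)]
  have cts: "cts (f v)" "cts (w v)" using chainD(1)[OF f] chainD(1)[OF wj] v by auto
  have prev: "g (v - 1) y = dn (g v) y" if "chain s g j" "y \<in> {0..1}" for g y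
    using chainD(2)[OF that(1), of "v - 1" y] that v by (simp add: stp_def)
  have lin: "dn (\<lambda>x. w v x - f v x) y = dn (w v) y - dn (f v) y" if "y \<in> {0..1}" for y
    using stp_lin[OF cts that, of False "-1" 1] by (simp add: stp_def add.commute)
  show "osc (15 / 16) (f (v - 1)) (w (v - 1))"
  \<comment> \<open>If \<open>f v\<close> has the larger share at 0, the lower bound of the ratio
    rises from 0 to \<open>1 / 16\<close>; otherwise the upper bound falls from 1 to
    \<open>15 / 16\<close>.\<close>
  proof (cases "w v 0 / 2 \<le> f v 0")
    case True
    have "dn (w v) y / 16 \<le> dn (f v) y \<and> dn (f v) y \<le> dn (w v) y" if "y \<in> {0..1}" for y
      using valley_half[of "f v" "w v" m y] stp_mono[of "f v" "w v" y False] d0 b True that nn m w0 cts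
      by (auto simp: stp_def nonneg_def)
    then show ?thesis unfolding osc_def using prev[OF f] prev[OF wj]
      by (intro exI[of _ "1 / 16"]) auto
  next
    case False
    have "dn (w v) y / 16 \<le> dn (w v) y - dn (f v) y \<and> 0 \<le> dn (f v) y" if y: "y \<in> {0..1}" for y
      using valley_half[of "\<lambda>x. w v x - f v x" "w v" m y] lin[OF y] stp_mono[of "\<lambda>_. 0" "f v" y False]
        f0 b False that nn m w0 cts
      by (auto simp: stp_def nonneg_def dn_const continuous_on_diff)
    then show ?thesis unfolding osc_def using prev[OF f] prev[OF wj]
      by (intro exI[of _ 0]) fastforce
  qed
  fix q assume q: "q \<le> v" "\<And>k. v - q \<le> k \<Longrightarrow> k < v \<Longrightarrow> \<not> s k" and mq: "2 * m \<le> Suc q"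
  show "osc (2 * real m / real (Suc q)) (f (v - q)) (w (v - q))"
  proof -
    define \<beta> where "\<beta> = real m / Suc q"
    have \<beta>: "0 \<le> \<beta>" "\<beta> \<le> 1 / 2" using mq by (auto simp: \<beta>_def field_simps)
    \<comment> \<open>This is \<open>1 / (1 - \<beta>) \<le> 1 + 2 * \<beta>\<close> on the interval
      from 0 to \<open>1 / 2\<close>, freed of the quotient.\<close>
    have rho: "1 \<le> (1 + 2 * \<beta>) * (1 - \<beta>)"
      using \<beta> mult_nonneg_nonneg[of \<beta> "1 - 2 * \<beta>"] by (simp add: algebra_simps)
    have main: "f (v - q) x \<le> f v 0 * (x ^ q / fact q)"
       "w (v - q) x - f (v - q) x \<le> (w v 0 - f v 0) * (x ^ q / fact q)"
       "w v 0 * (x ^ q / fact q) \<le> (1 + 2 * \<beta>) * w (v - q) x" if x: "x \<in> {0..1}" for x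
    proof -
      define P where "P = x ^ q / fact q"
      have P: "0 \<le> P" using x by (simp add: P_def)
      have PS: "x ^ Suc q / fact (Suc q) = P * (x / Suc q)" by (simp add: P_def mult_ac)
      show "f (v - q) x \<le> f v 0 * (x ^ q / fact q)"
        using chain_dn_le[OF chain_le[OF f] q, of "f v 0" 0 x] f0 x v by simp
      show "w (v - q) x - f (v - q) x \<le> (w v 0 - f v 0) * (x ^ q / fact q)"
        using chain_dn_le[OF chain_le[OF d] q, of "w v 0 - f v 0" 0 x] d0 x v by simp
      \<comment> \<open>Bernoulli's inequality replaces the power in the lower bound of
        \<open>w v\<close> by its tangent at 0, so that \<open>- w v\<close> has an affine upper
        bound fit for \<open>chain_dn_le\<close>.\<close>
      have w1: "- w v y \<le> - w v 0 + (w v 0 * m) * y" if "y \<in> {0..1}" for y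
        using b(1)[OF that] mult_right_mono[OF bernoulli[OF that, of m] w0] by (simp add: algebra_simps)
      have "- w (v - q) x \<le> - w v 0 * P + w v 0 * m * (P * (x / Suc q))"
        unfolding PS[symmetric] P_def
        using chain_dn_le[OF chain_le[OF chain_lin[OF wj wj, of "-1" 0]] q, of "- w v 0" "w v 0 * m" x] w1 x v
        by (simp add: mult_ac)
      also have "w v 0 * m * (P * (x / Suc q)) = (w v 0 * P * \<beta>) * x" by (simp add: \<beta>_def)
      also have "\<dots> \<le> w v 0 * P * \<beta>" using x w0 P \<beta> by (intro mult_left_le) auto
      finally have 1: "w v 0 * P * (1 - \<beta>) \<le> w (v - q) x" by (simp add: algebra_simps)
      have "w v 0 * P * 1 \<le> w v 0 * P * ((1 + 2 * \<beta>) * (1 - \<beta>))"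
        using w0 P rho by (intro mult_left_mono) auto
      also have "\<dots> = (1 + 2 * \<beta>) * (w v 0 * P * (1 - \<beta>))" by simp
      also have "\<dots> \<le> (1 + 2 * \<beta>) * w (v - q) x" using 1 \<beta> by (intro mult_left_mono) auto
      finally show "w v 0 * (x ^ q / fact q) \<le> (1 + 2 * \<beta>) * w (v - q) x" by (simp add: P_def)
    qed
    \<comment> \<open>The ratio at the bottom of the valley, to which the ratios at
      \<open>v - q\<close> will be close. If \<open>w v 0\<close> vanishes then so does
      \<open>f v 0\<close>, and the default value is consistent.\<close>
    define \<theta> where "\<theta> = (if w v 0 = 0 then 0 else f v 0 / w v 0)"
    have \<theta>: "f v 0 = \<theta> * w v 0" "0 \<le> \<theta>" "\<theta> \<le> 1"
      using w0 fw0 by (auto simp: \<theta>_def field_simps)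
    \<comment> \<open>The ratio is at most \<open>\<theta> * (1 + 2 * \<beta>)\<close> and its
      complement at most \<open>(1 - \<theta>) * (1 + 2 * \<beta>)\<close>. The resulting upper and
      lower bounds differ by \<open>2 * \<beta>\<close>, whatever \<open>\<theta>\<close>
      is.\<close>
    have "(1 - (1 - \<theta>) * (1 + 2 * \<beta>)) * w (v - q) x \<le> f (v - q) x \<and>
       f (v - q) x \<le> (1 - (1 - \<theta>) * (1 + 2 * \<beta>) + 2 * \<beta>) * w (v - q) x" if x: "x \<in> {0..1}" for x
    proof -
      have "(1 - \<theta>) * (w v 0 * (x ^ q / fact q)) \<le> (1 - \<theta>) * ((1 + 2 * \<beta>) * w (v - q) x)"
        "\<theta> * (w v 0 * (x ^ q / fact q)) \<le> \<theta> * ((1 + 2 * \<beta>) * w (v - q) x)"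
        using main(3)[OF x] \<theta> by (intro mult_left_mono; simp)+
      moreover have "f (v - q) x \<le> \<theta> * (w v 0 * (x ^ q / fact q))"
        using main(1)[OF x] by (simp add: \<theta>(1))
      moreover have "w (v - q) x - f (v - q) x \<le> (1 - \<theta>) * (w v 0 * (x ^ q / fact q))"
        using main(2)[OF x] by (simp add: \<theta>(1) algebra_simps diff_divide_distrib)
      ultimately show ?thesis by (simp add: algebra_simps)
    qed
    then show ?thesis unfolding osc_def \<beta>_def
      by (intro exI[of _ "1 - (1 - \<theta>) * (1 + 2 * (real m / Suc q))"]) simp
  qed
qed

lemma osc_affine:
  assumes "osc \<zeta> (\<lambda>x. (f x - c * w x) / \<eta>) w" "0 < \<eta>"
  shows "osc (\<zeta> * \<eta>) f w"
proof -
  from assms(1) obtain d where d: "\<And>x. x \<in> {0..1} \<Longrightarrow>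
      d * w x \<le> (f x - c * w x) / \<eta> \<and> (f x - c * w x) / \<eta> \<le> (d + \<zeta>) * w x"
    unfolding osc_def by blast
  have "(c + d * \<eta>) * w x \<le> f x \<and> f x \<le> (c + d * \<eta> + \<zeta> * \<eta>) * w x" if "x \<in> {0..1}" for x
    using d[OF that] assms(2) by (auto simp: field_simps)
  then show ?thesis unfolding osc_def by blast
qed

text \<open>Subtracting \<open>c * w\<close> and dividing by \<open>\<eta>\<close> normalises
  \<open>f\<close> to lie between 0 and \<open>w\<close>. The change is linear in the pair, so it
  respects chains, and it scales the oscillation by a known factor.\<close>

lemma valley_osc:
  assumes w: "full_chain s w L" and f: "chain s f j" and j: "j \<le> L"
    and v: "0 < v" "v < j" "s v" "\<not> s (v - 1)" and r: "run_after s L v m"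
    and osc: "osc \<eta> (f (Suc v)) (w (Suc v))" "0 < \<eta>"
  shows "osc (15 / 16 * \<eta>) (f (v - 1)) (w (v - 1))"
    and "\<And>q. q \<le> v \<Longrightarrow> (\<And>k. v - q \<le> k \<Longrightarrow> k < v \<Longrightarrow> \<not> s k) \<Longrightarrow> 2 * m \<le> Suc q \<Longrightarrow>
           osc (2 * real m / real (Suc q) * \<eta>) (f (v - q)) (w (v - q))"
proof -
  have wj: "chain s w j" using w j chain_le by (auto simp: full_chain_def)
  from osc obtain c where c: "\<And>x. x \<in> {0..1} \<Longrightarrow>
      c * w (Suc v) x \<le> f (Suc v) x \<and> f (Suc v) x \<le> (c + \<eta>) * w (Suc v) x"
    unfolding osc_def by blast
  define g where "g = (\<lambda>k x. (f k x - c * w k x) / \<eta>)"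
  have "g = (\<lambda>k x. (1 / \<eta>) * f k x + (- c / \<eta>) * w k x)"
    by (simp add: g_def fun_eq_iff diff_divide_distrib)
  then have g: "chain s g j" by (simp only: chain_lin[OF f wj])
  have "0 \<le> g (Suc v) x \<and> g (Suc v) x \<le> w (Suc v) x" if "x \<in> {0..1}" for x
    using c[OF that] osc(2) by (auto simp: g_def field_simps)
  note * = this
  have "osc (15 / 16) (g (v - 1)) (w (v - 1))"
    by (rule valley_contract(1)[OF w g j v r]) (use * in auto)
  from osc_affine[OF this[unfolded g_def] osc(2)]
  show "osc (15 / 16 * \<eta>) (f (v - 1)) (w (v - 1))" by simp
  fix q assume q: "q \<le> v" "\<And>k. v - q \<le> k \<Longrightarrow> k < v \<Longrightarrow> \<not> s k" "2 * m \<le> Suc q"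
  have "osc (2 * real m / real (Suc q)) (g (v - q)) (w (v - q))"
    by (rule valley_contract(2)[OF w g j v r]) (use * q in auto)
  from osc_affine[OF this[unfolded g_def] osc(2)]
  show "osc (2 * real m / real (Suc q) * \<eta>) (f (v - q)) (w (v - q))" .
qed

lemma turn_osc:
  assumes w: "full_chain s w L" and f: "chain s f j" and j: "j \<le> L"
    and v: "0 < v" "v < j" "s (v - 1) \<noteq> s v" and r: "run_after s L v m"
    and osc: "osc \<eta> (f (Suc v)) (w (Suc v))" "0 < \<eta>"
  shows "osc (15 / 16 * \<eta>) (f (v - 1)) (w (v - 1))"
    and "\<And>q. q \<le> v \<Longrightarrow> (\<And>k. v - q \<le> k \<Longrightarrow> k < v \<Longrightarrow> s k = s (v - 1)) \<Longrightarrow> 2 * m \<le> Suc q \<Longrightarrow>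
           osc (2 * real m / real (Suc q) * \<eta>) (f (v - q)) (w (v - q))"
proof -
  have "osc (15 / 16 * \<eta>) (f (v - 1)) (w (v - 1)) \<and>
    (\<forall>q. q \<le> v \<longrightarrow> (\<forall>k. v - q \<le> k \<longrightarrow> k < v \<longrightarrow> s k = s (v - 1)) \<longrightarrow> 2 * m \<le> Suc q \<longrightarrow>
           osc (2 * real m / real (Suc q) * \<eta>) (f (v - q)) (w (v - q)))"
  proof (cases "s v")
    case True
    then show ?thesis using valley_osc[OF w f j v(1,2) _ _ r osc] v(3) by auto
  next
    case False
    have fl: "\<not> s v" "\<not> \<not> s (v - 1)" "run_after (\<lambda>k. \<not> s k) L v m"
      using False v(3) r by (simp_all add: run_after_flip)
    have o: "osc \<eta> (\<lambda>x. f (Suc v) (1 - x)) (\<lambda>x. w (Suc v) (1 - x))"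
      by (rule osc_flip[OF osc(1)])
    note * = valley_osc[OF full_chain_flip[OF w] chain_flip[OF f] j v(1,2) fl o osc(2)]
    have 1: "osc (15 / 16 * \<eta>) (f (v - 1)) (w (v - 1))"
      using osc_flip[OF *(1)] by simp
    have 2: "osc (2 * real m / real (Suc q) * \<eta>) (f (v - q)) (w (v - q))"
      if "q \<le> v" "\<forall>k. v - q \<le> k \<longrightarrow> k < v \<longrightarrow> s k = s (v - 1)" "2 * m \<le> Suc q" for q
    proof -
      have "osc (2 * real m / real (Suc q) * \<eta>) (\<lambda>x. f (v - q) (1 - x)) (\<lambda>x. w (v - q) (1 - x))"
        by (rule *(2)[OF that(1) _ that(3)]) (use that(2) fl(2) in blast)
      from osc_flip[OF this] show ?thesis by simp
    qed
    from 1 2 show ?thesis by blast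
  qed
  then show "osc (15 / 16 * \<eta>) (f (v - 1)) (w (v - 1))"
    and "\<And>q. q \<le> v \<Longrightarrow> (\<And>k. v - q \<le> k \<Longrightarrow> k < v \<Longrightarrow> s k = s (v - 1)) \<Longrightarrow> 2 * m \<le> Suc q \<Longrightarrow>
           osc (2 * real m / real (Suc q) * \<eta>) (f (v - q)) (w (v - q))" by blast+
qed

section \<open>Iteration over successive runs\<close>

lemma run_before:
  fixes v :: nat
  assumes "0 < v"
  obtains q where "1 \<le> q" "q \<le> v" "\<forall>k. v - q \<le> k \<longrightarrow> k < v \<longrightarrow> s k = s (v - 1)"
    "q = v \<or> s (v - q - 1) \<noteq> s (v - 1)"
proof -
  define Q where "Q a \<longleftrightarrow> (\<forall>k. a \<le> k \<longrightarrow> k < v \<longrightarrow> s k = s (v - 1))" for a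
  have Q1: "Q (v - 1)"
  proof -
    have "k = v - 1" if "v - 1 \<le> k" "k < v" for k using that by simp
    then show ?thesis unfolding Q_def by blast
  qed
  define a where "a = (LEAST a. Q a)"
  have a: "Q a" "a \<le> v - 1" unfolding a_def using LeastI[of Q, OF Q1] Least_le[of Q, OF Q1] by auto
  have "a = 0 \<or> s (a - 1) \<noteq> s (v - 1)"
  proof (rule ccontr)
    assume *: "\<not> (a = 0 \<or> s (a - 1) \<noteq> s (v - 1))"
    have "s k = s (v - 1)" if "a - 1 \<le> k" "k < v" for k
    proof (cases "a \<le> k")
      case True then show ?thesis using a(1) that unfolding Q_def by blast
    next
      case False then have "k = a - 1" using that by simp
      then show ?thesis using * by simp
    qed
    then have "Q (a - 1)" unfolding Q_def by blast
    then have "a \<le> a - 1" unfolding a_def by (rule Least_le)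
    moreover have "0 < a" using * by simp
    ultimately show False by linarith
  qed
  moreover have "v - (v - a) = a" "1 \<le> v - a" "a = 0 \<Longrightarrow> v - a = v" "v - a \<le> v"
    using a(2) assms by simp_all
  moreover have "\<forall>k. a \<le> k \<longrightarrow> k < v \<longrightarrow> s k = s (v - 1)"
    using a(1) unfolding Q_def .
  ultimately show ?thesis by (intro that[of "v - a"]; metis)
qed

text \<open>The alternatives concern the run ending at \<open>v\<close>. With
  \<open>\<Lambda> * A\<close> steps or more, it is so much longer than the run after
  \<open>v\<close> that one contraction achieves \<open>2 / \<Lambda>\<close>. A shorter one starts
  at a further turning point \<open>v'\<close>, and its own length obeys the new bound
  \<open>\<Lambda> * A\<close>.\<close>

lemma turn_step:
  fixes \<Lambda> :: nat
  assumes w: "full_chain s w L" and f: "chain s f j" and j: "j \<le> L"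
    and v: "0 < v" "v < j" "s (v - 1) \<noteq> s v" and r: "run_after s L v m" and m: "m \<le> A"
    and osc: "osc \<eta> (f (Suc v)) (w (Suc v))" "0 < \<eta>" and \<Lambda>: "2 \<le> \<Lambda>" and iv: "i + \<Lambda> * A \<le> v"
  obtains (long) "osc (2 / \<Lambda> * \<eta>) (f i) (w i)"
  | (turn) v' q where "v' < v" "v \<le> v' + \<Lambda> * A" "0 < v'" "s (v' - 1) \<noteq> s v'"
      "run_after s L v' q" "q \<le> \<Lambda> * A"
proof -
  obtain q where q: "1 \<le> q" "q \<le> v" "\<forall>k. v - q \<le> k \<longrightarrow> k < v \<longrightarrow> s k = s (v - 1)"
    "q = v \<or> s (v - q - 1) \<noteq> s (v - 1)" using run_before[OF v(1), of s] by blast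
  show ?thesis
  proof (cases "\<Lambda> * A \<le> q")
    case True
    \<comment> \<open>Only \<open>\<Lambda> * A\<close> steps of the long run are used, which keeps
      \<open>v - Q\<close> from passing to the left of \<open>i\<close>.\<close>
    define Q where "Q = \<Lambda> * A"
    have mA: "2 * m \<le> Q" using m \<Lambda> mult_le_mono[of 2 \<Lambda> m A] by (simp add: Q_def)
    have "osc (2 * real m / real (Suc Q) * \<eta>) (f (v - Q)) (w (v - Q))"
    proof (rule turn_osc(2)[OF w f j v r osc])
      show "s k = s (v - 1)" if "v - Q \<le> k" "k < v" for k
        using q(3)[rule_format, of k] that True by (simp add: Q_def)
    qed (use iv mA in \<open>simp_all add: Q_def\<close>)
    then have "osc (2 * real m / real (Suc Q) * \<eta>) (f i) (w i)"
      using osc_chain[OF f chain_le[of s w L, OF _ j], of i "v - Q"] w iv v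
      by (auto simp: Q_def full_chain_def)
    moreover have "2 * real m / Suc Q \<le> 2 / \<Lambda>"
    proof -
      have "\<Lambda> * m \<le> Suc Q" using m by (simp add: Q_def le_SucI)
      then have "real \<Lambda> * real m \<le> real (Suc Q)" by (metis of_nat_le_iff of_nat_mult)
      then show ?thesis using \<Lambda> by (simp add: field_simps)
    qed
    then have "2 * real m / Suc Q * \<eta> \<le> 2 / \<Lambda> * \<eta>"
      by (rule mult_right_mono) (use osc(2) in simp)
    ultimately show ?thesis
      by (intro long, elim osc_mono) (use full_chain_nonneg[OF w, of i] iv v j in auto)
  next
    case False
    have qv: "q < v" using False iv by simp
    have "s (v - q) = s (v - 1)" using q(3)[rule_format, of "v - q"] q(1) qv by simp
    have run: "s k = s (v - q)" if "v - q \<le> k" "k < v - q + q" for k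
      using q(3)[rule_format, of k] that qv \<open>s (v - q) = s (v - 1)\<close> by simp
    have "v - q + q \<le> L" "s (v - q + q) \<noteq> s (v - q)"
      using qv v j \<open>s (v - q) = s (v - 1)\<close> by simp_all
    with run q(1) have "run_after s L (v - q) q"
      unfolding run_after_def by blast
    with qv q(1,4) False \<open>s (v - q) = s (v - 1)\<close> show ?thesis
      by (intro turn[of "v - q" q]) simp_all
  qed
qed

text \<open>The distance that \<open>t\<close> rounds may consume. One round crosses two runs, of at
  most \<open>\<Lambda> * A\<close> and \<open>\<Lambda> * (\<Lambda> * A)\<close> steps, and passes
  the latter bound on.\<close>

primrec gap :: "nat \<Rightarrow> nat \<Rightarrow> nat \<Rightarrow> nat" where
  "gap \<Lambda> 0 A = 0"
| "gap \<Lambda> (Suc t) A = \<Lambda> * A + \<Lambda> * (\<Lambda> * A) + gap \<Lambda> t (\<Lambda> * (\<Lambda> * A))"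

text \<open>Either some run is at least \<open>\<Lambda>\<close> times longer than its successor, or the run lengths grow at
  most geometrically, so that there are many turning points. Two of them are used at a time
  because neighbouring positions may both be turning points.\<close>

lemma turns_osc:
  fixes \<Lambda> :: nat
  assumes w: "full_chain s w L" and f: "chain s f j" and j: "j \<le> L" and \<Lambda>: "2 \<le> \<Lambda>"
    and v: "0 < v" "v < j" "s (v - 1) \<noteq> s v" and r: "run_after s L v m" "m \<le> A"
    and osc: "osc \<eta> (f (Suc v)) (w (Suc v))" "0 < \<eta>" and iv: "i + gap \<Lambda> t A \<le> v"
  shows "osc (max (2 / \<Lambda>) ((15 / 16) ^ t) * \<eta>) (f i) (w i)"
  using v r osc iv
proof (induction t arbitrary: v m A \<eta>)
  case 0
  have "osc \<eta> (f i) (w i)"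
    using 0 w j by (intro osc_chain[OF f chain_le[of s w L, OF _ j], of i "Suc v"]) (auto simp: full_chain_def)
  then show ?case using osc_mono[of \<eta> "f i" "w i"] full_chain_nonneg[OF w, of i] 0 j by simp
next
  case (Suc t)
  have wj: "chain s w j" using w j chain_le by (auto simp: full_chain_def)
  have wi: "nonneg (w i)" using full_chain_nonneg[OF w, of i] Suc.prems j by simp
  have long: "osc (max (2 / \<Lambda>) ((15 / 16) ^ Suc t) * \<eta>) (f i) (w i)" if "osc (2 / \<Lambda> * \<eta>) (f i) (w i)"
    by (rule osc_mono[OF that _ wi]) (use Suc.prems(7) in \<open>intro mult_right_mono; simp\<close>)
  from Suc.prems have "i + \<Lambda> * A \<le> v" by simp
  from w f j Suc.prems(1-7) \<Lambda> this show ?case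
  proof (cases rule: turn_step)
    case long then show ?thesis by (rule \<open>osc (2 / \<Lambda> * \<eta>) (f i) (w i) \<Longrightarrow> _\<close>)
  next
    case (turn v' q)
    have o1: "osc \<eta> (f (Suc v')) (w (Suc v'))"
      by (rule osc_chain[OF f wj _ _ Suc.prems(6)]) (use turn Suc.prems in auto)
    have v': "v' < j" "i + \<Lambda> * (\<Lambda> * A) \<le> v'" using turn Suc.prems by auto
    from w f j turn(3) v'(1) turn(4-6) o1 Suc.prems(7) \<Lambda> v'(2) show ?thesis
    proof (cases rule: turn_step)
      case long then show ?thesis by (rule \<open>osc (2 / \<Lambda> * \<eta>) (f i) (w i) \<Longrightarrow> _\<close>)
    next
      case t2: (turn v'' q')
      have "osc (15 / 16 * \<eta>) (f (v - 1)) (w (v - 1))"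
        by (rule turn_osc(1)[OF w f j Suc.prems(1-4,6,7)])
      \<comment> \<open>The gain at \<open>v\<close> is available from \<open>v - 1\<close> on, and
        the next use needs it at \<open>Suc v''\<close>. This is to the left of \<open>v\<close>,
        because \<open>v'' < v' < v\<close>.\<close>
      then have o2: "osc (15 / 16 * \<eta>) (f (Suc v'')) (w (Suc v''))"
        by (rule osc_chain[OF f wj, rotated 2]) (use t2 turn Suc.prems in auto)
      have "osc (max (2 / \<Lambda>) ((15 / 16) ^ t) * (15 / 16 * \<eta>)) (f i) (w i)"
        by (rule Suc.IH[OF t2(3) _ t2(4-6) o2]) (use Suc.prems turn t2 v' in auto)
      moreover have "max a b * (15 / 16) \<le> max a (15 / 16 * b)" if "0 \<le> a" for a b :: real
        using that by (auto simp: max_def)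
      then have "max (2 / real \<Lambda>) ((15 / 16) ^ t) * (15 / 16) \<le> max (2 / real \<Lambda>) ((15 / 16) ^ Suc t)"
        by simp
      then have "max (2 / real \<Lambda>) ((15 / 16) ^ t) * (15 / 16 * \<eta>) \<le> max (2 / real \<Lambda>) ((15 / 16) ^ Suc t) * \<eta>"
        using Suc.prems(7) mult_right_mono[of _ _ \<eta>] by (metis less_imp_le mult.assoc)
      ultimately show ?thesis using osc_mono wi by blast
    qed
  qed
qed

text \<open>The distance is fixed before the pattern is known: at most \<open>M\<close> steps lead
  from \<open>j\<close> to the left end \<open>a\<close> of its run, which is the first turning
  point, and \<open>gap \<Lambda> t M\<close> leaves room for \<open>t\<close> rounds. The start is
  oscillation 1, since \<open>f j\<close> lies between 0 and \<open>w j\<close>.\<close>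

lemma mixing:
  fixes \<kappa> :: real
  assumes "0 < \<kappa>"
  shows "\<exists>n. \<forall>s w f L i j a m. full_chain s w L \<longrightarrow> chain s f j \<longrightarrow> j \<le> L \<longrightarrow> i + n \<le> j \<longrightarrow>
     a < j \<longrightarrow> j \<le> a + m \<longrightarrow> m \<le> M \<longrightarrow> run_after s L a m \<longrightarrow> a = 0 \<or> s (a - 1) \<noteq> s a \<longrightarrow>
     (\<forall>x\<in>{0..1}. 0 \<le> f j x \<and> f j x \<le> w j x) \<longrightarrow> osc \<kappa> (f i) (w i)"
proof -
  obtain \<Lambda>0 :: nat where \<Lambda>0: "2 / \<kappa> < \<Lambda>0" using reals_Archimedean2 by blast
  define \<Lambda> where "\<Lambda> = max 2 \<Lambda>0"
  have "2 / \<kappa> < \<Lambda>" using \<Lambda>0 by (simp add: \<Lambda>_def)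
  then have \<Lambda>: "2 \<le> \<Lambda>" "2 / \<Lambda> \<le> \<kappa>" using assms by (auto simp: \<Lambda>_def field_simps)
  obtain t where t: "(15 / 16 :: real) ^ t < \<kappa>" using real_arch_pow_inv[OF assms, of "15 / 16"] by auto
  show ?thesis
  proof (rule exI[of _ "Suc (M + gap \<Lambda> t M)"], intro allI impI)
    fix s w f L i j a m
    assume w: "full_chain s w L" and f: "chain s f j" and j: "j \<le> L" and ij: "i + Suc (M + gap \<Lambda> t M) \<le> j"
      and a: "a < j" "j \<le> a + m" "m \<le> M" "run_after s L a m" "a = 0 \<or> s (a - 1) \<noteq> s a"
      and bd: "\<forall>x\<in>{0..1}. 0 \<le> f j x \<and> f j x \<le> w j x"
    have wj: "chain s w j" using w j chain_le by (auto simp: full_chain_def)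
    have "osc 1 (f j) (w j)" using bd by (auto simp: osc_def intro!: exI[of _ 0])
    then have o1: "osc 1 (f (Suc a)) (w (Suc a))"
      by (rule osc_chain[OF f wj, rotated 2]) (use a in auto)
    have "osc (max (2 / \<Lambda>) ((15 / 16) ^ t) * 1) (f i) (w i)"
      by (rule turns_osc[OF w f j \<Lambda>(1) _ a(1) _ a(4,3) o1]) (use a ij in auto)
    then show "osc \<kappa> (f i) (w i)"
      by (rule osc_mono) (use \<Lambda> t full_chain_nonneg[OF w, of i] ij j in auto)
  qed
qed

section \<open>Concentration inside long runs\<close>

text \<open>Integration by parts for \<open>dn A * up B\<close>, which vanishes at both ends. In
  other words \<open>up\<close> and \<open>dn\<close> are adjoint: both sides integrate over the
  same triangle.\<close>

lemma integral_mult_up: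
  assumes A: "cts A" and B: "cts B"
  shows "integral {0..1} (\<lambda>x. A x * up B x) = integral {0..1} (\<lambda>x. dn A x * B x)"
proof -
  have cA: "cts (dn A)" and cB: "cts (up B)"
    using cts_stp[OF A, of False] cts_stp[OF B, of True] by (simp_all add: stp_def)
  have "((\<lambda>x. dn A x * - B x + A x * up B x) has_integral (dn A 1 * up B 1 - dn A 0 * up B 0)) {0..1}"
  proof (rule fundamental_theorem_of_calculus)
    fix x :: real assume x: "x \<in> {0..1}"
    have "(dn A has_real_derivative A x) (at x within {0..1})"
      using integral_has_real_derivative[OF A x] by (simp add: dn_def[abs_def])
    moreover have "(up B has_real_derivative - B x) (at x within {0..1})"
      using integral_has_real_derivative'[OF B x] by (simp add: up_def[abs_def])
    ultimately show "((\<lambda>x. dn A x * up B x) has_vector_derivative dn A x * - B x + A x * up B x) (at x within {0..1})"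
      unfolding has_real_derivative_iff_has_vector_derivative[symmetric]
      by (rule derivative_eq_intros) simp
  qed simp
  moreover have "((\<lambda>x. A x * up B x) has_integral integral {0..1} (\<lambda>x. A x * up B x)) {0..1}"
    "((\<lambda>x. dn A x * B x) has_integral integral {0..1} (\<lambda>x. dn A x * B x)) {0..1}"
    by (intro integrable_integral cts_integrable continuous_on_mult A B cA cB; simp)+
  from has_integral_diff[OF this]
  have "((\<lambda>x. dn A x * - B x + A x * up B x) has_integral
      (integral {0..1} (\<lambda>x. A x * up B x) - integral {0..1} (\<lambda>x. dn A x * B x))) {0..1}"
    by (simp add: algebra_simps)
  ultimately have "dn A 1 * up B 1 - dn A 0 * up B 0
      = integral {0..1} (\<lambda>x. A x * up B x) - integral {0..1} (\<lambda>x. dn A x * B x)"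
    by (rule has_integral_unique)
  then show ?thesis by (simp add: up_def dn_def)
qed

lemma integral_mult_stp:
  assumes A: "cts A" and B: "cts B"
  shows "integral {0..1} (\<lambda>x. A x * stp b B x) = integral {0..1} (\<lambda>x. stp (\<not> b) A x * B x)"
  using integral_mult_up[OF A B] integral_mult_up[OF B A] by (cases b) (simp_all add: stp_def mult.commute)

text \<open>\<open>fw s k\<close> is the likelihood of the pattern to the left of position \<open>k\<close> given the value there.\<close>

primrec fw :: "(nat \<Rightarrow> bool) \<Rightarrow> nat \<Rightarrow> real \<Rightarrow> real" where
  "fw s 0 = (\<lambda>_. 1)"
| "fw s (Suc k) = stp (\<not> s k) (fw s k)"

lemma cts_fw: "cts (fw s k)"
  by (induction k) (auto simp: cts_stp)

lemma nonneg_fw: "nonneg (fw s k)"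
  by (induction k) (auto simp: cts_fw stp_nonneg, simp add: nonneg_def)

lemma fw_flip: "fw (\<lambda>k. \<not> s k) k = (\<lambda>x. fw s k (1 - x))"
proof (induction k)
  case (Suc k)
  show ?case using stp_flip[of "\<not> s k" "fw s k"] by (simp add: Suc fun_eq_iff del: not_not)
qed simp

text \<open>Adjointness moves the steps before \<open>k\<close> one by one from the chain to the
  constant weight 1, where they accumulate to \<open>fw s k\<close>. Consequently the density of the
  value at \<open>k\<close> is, up to normalisation, the product of its left and right
  likelihoods.\<close>

lemma integral_chain:
  assumes f: "chain s f j" and k: "k \<le> j"
  shows "integral {0..1} (f 0) = integral {0..1} (\<lambda>x. fw s k x * f k x)"
  using k
proof (induction k)
  case 0 then show ?case by simp
next
  case (Suc k)
  have "integral {0..1} (\<lambda>x. fw s k x * f k x) = integral {0..1} (\<lambda>x. fw s k x * stp (s k) (f (Suc k)) x)"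
    using Suc.prems chainD(2)[OF f, of k] by (intro integral_cong) auto
  also have "\<dots> = integral {0..1} (\<lambda>x. fw s (Suc k) x * f (Suc k) x)"
    using Suc.prems by (simp add: integral_mult_stp[OF cts_fw chainD(1)[OF f]])
  finally show ?case using Suc by simp
qed

text \<open>Read from right to left an ascent becomes a descent. This makes all results on full
  chains available on the left of a point too.\<close>

lemma full_chain_fw: "full_chain (\<lambda>k. \<not> s (n - Suc k)) (\<lambda>k. fw s (n - k)) n"
proof -
  have "fw s (n - k) = stp (\<not> s (n - Suc k)) (fw s (n - Suc k))" if "k < n" for k
    using fw.simps(2)[of s "n - Suc k"] Suc_diff_Suc[OF that] by simp
  then show ?thesis by (auto simp: full_chain_def chain_def cts_fw)
qed

text \<open>The function \<open>max 0 (c - x) - \<delta>\<close> changes sign once, and \<open>g / \<beta>\<close> is increasing.\<close>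

lemma deviation_compare:
  fixes c \<delta> :: real and p q :: nat and g :: "real \<Rightarrow> real"
  defines "\<beta> \<equiv> \<lambda>x. x ^ p * (1 - x) ^ q"
  assumes g: "cts g" "nonneg g"
    and ratio: "\<And>x y. 0 \<le> x \<Longrightarrow> x \<le> y \<Longrightarrow> y \<le> 1 \<Longrightarrow> g x * \<beta> y \<le> g y * \<beta> x"
    and c: "c \<le> 1" and \<delta>: "0 < \<delta>"
    and dev: "integral {0..1} (\<lambda>x. max 0 (c - x) * \<beta> x) \<le> \<delta> * integral {0..1} \<beta>"
  shows "integral {0..1} (\<lambda>x. max 0 (c - x) * g x) \<le> \<delta> * integral {0..1} g"
proof -
  have mx: "cts (\<lambda>x. max 0 (c - x))" by (intro continuous_intros)
  have \<beta>: "cts \<beta>" unfolding \<beta>_def by (intro continuous_intros)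
  have lin: "integral {0..1} (\<lambda>x. (max 0 (c - x) - \<delta>) * h x)
      = integral {0..1} (\<lambda>x. max 0 (c - x) * h x) - \<delta> * integral {0..1} h" if "cts h" for h
    unfolding left_diff_distrib
    by (subst Henstock_Kurzweil_Integration.integral_diff)
      (auto intro!: cts_integrable continuous_on_mult mx that continuous_on_const)
  have "integral {0..1} (\<lambda>x. (max 0 (c - x) - \<delta>) * g x) \<le> 0"
  proof (cases "c \<le> \<delta>")
    case True
    have "integral {0..1} (\<lambda>x. (max 0 (c - x) - \<delta>) * g x) \<le> integral {0..1} (\<lambda>x::real. 0::real)"
      using True \<delta> g by (intro integral_le cts_integrable)
       (auto intro!: continuous_intros mult_nonpos_nonneg simp: nonneg_def)
    then show ?thesis by simp
  next
    case False
    \<comment> \<open>The zero of \<open>max 0 (c - x) - \<delta>\<close>. Scaled to agree with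
      \<open>\<beta>\<close> at \<open>x0\<close>, \<open>g\<close> lies below
      \<open>\<beta>\<close> where this factor is positive and above it where the factor is
      negative.\<close>
    define x0 where "x0 = c - \<delta>"
    have x0: "0 < x0" "x0 < 1" using False c \<delta> by (auto simp: x0_def)
    have b0: "0 < \<beta> x0" using x0 by (simp add: \<beta>_def)
    have "(max 0 (c - x) - \<delta>) * (\<beta> x0 * g x) \<le> (max 0 (c - x) - \<delta>) * (g x0 * \<beta> x)" if "x \<in> {0..1}" for x
    proof (cases "x \<le> x0")
      case True
      then show ?thesis using ratio[of x x0] x0 that
        by (intro mult_left_mono) (auto simp: x0_def mult.commute)
    next
      case False
      then show ?thesis using ratio[of x0 x] x0 that \<delta>
        by (intro mult_left_mono_neg) (auto simp: x0_def mult.commute)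
    qed
    then have "integral {0..1} (\<lambda>x. (max 0 (c - x) - \<delta>) * (\<beta> x0 * g x))
        \<le> integral {0..1} (\<lambda>x. (max 0 (c - x) - \<delta>) * (g x0 * \<beta> x))"
      by (intro integral_le cts_integrable) (auto intro!: continuous_intros g(1) \<beta>)
    also have "(\<lambda>x. (max 0 (c - x) - \<delta>) * (\<beta> x0 * g x)) = (\<lambda>x. \<beta> x0 * ((max 0 (c - x) - \<delta>) * g x))"
      by (simp add: fun_eq_iff)
    also have "(\<lambda>x. (max 0 (c - x) - \<delta>) * (g x0 * \<beta> x)) = (\<lambda>x. g x0 * ((max 0 (c - x) - \<delta>) * \<beta> x))"
      by (simp add: fun_eq_iff)
    finally have "\<beta> x0 * integral {0..1} (\<lambda>x. (max 0 (c - x) - \<delta>) * g x)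
        \<le> g x0 * integral {0..1} (\<lambda>x. (max 0 (c - x) - \<delta>) * \<beta> x)" by simp
    also have "\<dots> \<le> 0" using dev lin[OF \<beta>] g x0 
      by (intro mult_nonneg_nonpos) (auto simp: nonneg_def)
    finally show ?thesis using b0 by (simp add: mult_le_0_iff)
  qed
  with lin[OF g(1)] show ?thesis by simp
qed

section \<open>Moments of Beta densities\<close>

definition bint :: "nat \<Rightarrow> nat \<Rightarrow> real" where
  "bint p q = integral {0..1} (\<lambda>x. x ^ p * (1 - x) ^ q)"

lemma bint_has_integral: "((\<lambda>x. x ^ p * (1 - x) ^ q) has_integral bint p q) {0..1}"
  unfolding bint_def by (intro integrable_integral cts_integrable continuous_intros) auto

lemma bint_nonneg: "0 \<le> bint p q"
  unfolding bint_def by (intro integral_nonneg cts_integrable continuous_intros) auto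

text \<open>The derivative of \<open>x ^ Suc p * (1 - x) ^ Suc q\<close> integrates to 0, which
  relates \<open>bint p (Suc q)\<close> to \<open>bint (Suc p) q\<close>; their sum is
  \<open>bint p q\<close>.\<close>

lemma bint_Suc: "(p + q + 2) * bint (Suc p) q = (p + 1) * bint p q"
proof -
  have "((\<lambda>x. real (p + 1) * (x ^ p * (1 - x) ^ Suc q) - real (q + 1) * (x ^ Suc p * (1 - x) ^ q)) has_integral
      (1 ^ Suc p * (1 - 1) ^ Suc q - 0 ^ Suc p * (1 - 0) ^ Suc q)) {0..1::real}"
  proof (rule fundamental_theorem_of_calculus)
    fix x :: real
    have "((\<lambda>x. x ^ Suc p) has_real_derivative (1 + real p) * (1 * x ^ p)) (at x within {0..1})"
      by (rule DERIV_power_Suc) (rule DERIV_ident)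
    moreover have "((\<lambda>x. (1 - x) ^ Suc q) has_real_derivative (1 + real q) * (-1 * (1 - x) ^ q)) (at x within {0..1})"
      by (rule DERIV_power_Suc) (auto intro!: derivative_eq_intros)
    ultimately have "((\<lambda>x. x ^ Suc p * (1 - x) ^ Suc q) has_real_derivative
        (1 + real p) * (1 * x ^ p) * (1 - x) ^ Suc q + (1 + real q) * (-1 * (1 - x) ^ q) * x ^ Suc p) (at x within {0..1})"
      by (rule DERIV_mult)
    then show "((\<lambda>x. x ^ Suc p * (1 - x) ^ Suc q) has_vector_derivative
        real (p + 1) * (x ^ p * (1 - x) ^ Suc q) - real (q + 1) * (x ^ Suc p * (1 - x) ^ q)) (at x within {0..1})"
      unfolding has_real_derivative_iff_has_vector_derivative[symmetric]
      by (simp add: mult_ac add.commute del: power_Suc)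
  qed simp
  moreover have "((\<lambda>x. real (p + 1) * (x ^ p * (1 - x) ^ Suc q) - real (q + 1) * (x ^ Suc p * (1 - x) ^ q)) has_integral
      (real (p + 1) * bint p (Suc q) - real (q + 1) * bint (Suc p) q)) {0..1}"
    by (intro has_integral_diff has_integral_mult_right bint_has_integral)
  ultimately have "1 ^ Suc p * (1 - 1) ^ Suc q - 0 ^ Suc p * (1 - 0) ^ Suc q =
      real (p + 1) * bint p (Suc q) - real (q + 1) * bint (Suc p) q"
    by (rule has_integral_unique)
  then have 1: "real (p + 1) * bint p (Suc q) - real (q + 1) * bint (Suc p) q = 0" by simp
  have "((\<lambda>x. x ^ p * (1 - x) ^ Suc q + x ^ Suc p * (1 - x) ^ q) has_integral (bint p (Suc q) + bint (Suc p) q)) {0..1}"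
    by (intro has_integral_add bint_has_integral)
  moreover have "(\<lambda>x::real. x ^ p * (1 - x) ^ Suc q + x ^ Suc p * (1 - x) ^ q) = (\<lambda>x. x ^ p * (1 - x) ^ q)"
    by (simp add: fun_eq_iff algebra_simps)
  ultimately have "bint p q = bint p (Suc q) + bint (Suc p) q"
    using has_integral_unique[OF bint_has_integral[of p q]] by simp
  with 1 show ?thesis by (simp add: algebra_simps)
qed

text \<open>The density is that of a Beta law with parameters \<open>l\<close> and
  \<open>m + 1\<close>. Deviations are taken from \<open>l / (l + m)\<close> instead of the mean
  \<open>l / (l + m + 1)\<close>, so that the mirrored estimate has the same centre. The second
  moment about it is at most the mass divided by \<open>l + m + 1\<close>, and
  \<open>u \<le> \<eta> / 2 + u * u / (2 * \<eta>)\<close> brings it down to a first moment.\<close>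

lemma beta_deviation:
  fixes l m :: nat and \<eta> :: real
  assumes l: "1 \<le> l" and \<eta>: "0 < \<eta>" "1 \<le> \<eta>\<^sup>2 * (l + m)"
  shows "integral {0..1} (\<lambda>x. max 0 (l / (l + m) - x) * (x ^ (l - 1) * (1 - x) ^ m))
    \<le> \<eta> * integral {0..1} (\<lambda>x. x ^ (l - 1) * (1 - x) ^ m)"
proof -
  define p where "p = l - 1"
  define c where "c = real l / (l + m)"
  define M where "M = real l + real m"
  have lp: "real l = real p + 1" using l by (simp add: p_def)
  have M: "1 \<le> M" using l by (simp add: M_def)
  have c: "0 \<le> c" "c \<le> 1" "real l = c * M" using l by (simp_all add: c_def M_def)
  define b0 b1 b2 where "b0 = bint p m" and "b1 = bint (Suc p) m" and "b2 = bint (Suc (Suc p)) m"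
  have b0: "0 \<le> b0" by (simp add: b0_def bint_nonneg)
  have e: "real p + real m + 2 = M + 1" "real (Suc p) + real m + 2 = M + 2" "real p + 1 = c * M"
    "real (Suc p) + 1 = c * M + 1"
    using lp c(3)[symmetric] by (simp_all add: M_def)
  have b1: "(M + 1) * b1 = c * M * b0"
    using bint_Suc[of p m] unfolding e b0_def b1_def .
  have b2: "(M + 2) * b2 = (c * M + 1) * b1"
    using bint_Suc[of "Suc p" m] unfolding e b2_def b1_def .
  have "b2 - 2 * c * b1 + c\<^sup>2 * b0 \<le> b0 / (M + 1)"
  proof -
    have "(b2 - 2 * c * b1 + c\<^sup>2 * b0) * ((M + 1) * (M + 2)) = b0 * (c\<^sup>2 * (2 - M) + c * M)"
      using b1 b2 by algebra
    then have "b2 - 2 * c * b1 + c\<^sup>2 * b0 = b0 * (c\<^sup>2 * (2 - M) + c * M) / ((M + 1) * (M + 2))"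
      using M by (simp add: eq_divide_eq)
    also have "\<dots> \<le> b0 * (M + 2) / ((M + 1) * (M + 2))"
    proof (intro divide_right_mono mult_left_mono b0)
      have "c\<^sup>2 \<le> 1" using c by (simp add: power_le_one)
      moreover have "0 \<le> c\<^sup>2 * M" "c * M \<le> M" using c M mult_left_le_one_le[of M c] by simp_all
      ultimately show "c\<^sup>2 * (2 - M) + c * M \<le> M + 2" by (simp add: algebra_simps)
    qed (use M in simp)
    also have "\<dots> = b0 / (M + 1)" using M by simp
    finally show ?thesis .
  qed
  also have "\<dots> \<le> \<eta>\<^sup>2 * b0"
  proof -
    have "1 \<le> \<eta>\<^sup>2 * M" using \<eta>(2) by (simp add: M_def)
    also have "\<dots> \<le> \<eta>\<^sup>2 * (M + 1)" by (intro mult_left_mono) auto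
    finally have "1 / (M + 1) \<le> \<eta>\<^sup>2" using M by (simp add: pos_divide_le_eq)
    from mult_right_mono[OF this b0] show ?thesis by (simp only: times_divide_eq_left mult_1)
  qed
  finally have V: "b2 - 2 * c * b1 + c\<^sup>2 * b0 \<le> \<eta>\<^sup>2 * b0" .
  have "integral {0..1} (\<lambda>x. max 0 (c - x) * (x ^ p * (1 - x) ^ m)) \<le>
     integral {0..1} (\<lambda>x. (\<eta> / 2 + (x - c)\<^sup>2 / (2 * \<eta>)) * (x ^ p * (1 - x) ^ m))"
  proof (intro integral_le cts_integrable mult_right_mono)
    fix x :: real
    have "0 \<le> (\<eta> - (c - x))\<^sup>2" by (rule zero_le_power2)
    also have "\<dots> = \<eta>\<^sup>2 + (x - c)\<^sup>2 - (c - x) * (2 * \<eta>)" by (simp add: power2_eq_square algebra_simps)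
    finally have "(c - x) * (2 * \<eta>) \<le> \<eta>\<^sup>2 + (x - c)\<^sup>2" by simp
    then have "c - x \<le> (\<eta>\<^sup>2 + (x - c)\<^sup>2) / (2 * \<eta>)" using \<eta> by (simp add: pos_le_divide_eq)
    also have "\<dots> = \<eta> / 2 + (x - c)\<^sup>2 / (2 * \<eta>)" using \<eta> by (simp add: add_divide_distrib power2_eq_square)
    finally show "max 0 (c - x) \<le> \<eta> / 2 + (x - c)\<^sup>2 / (2 * \<eta>)" using \<eta> by simp
  qed (use \<eta> in \<open>auto intro!: continuous_intros\<close>)
  also have "\<dots> = \<eta> / 2 * b0 + (b2 - 2 * c * b1 + c\<^sup>2 * b0) / (2 * \<eta>)"
  proof (rule integral_unique)
    have "((\<lambda>x. \<eta> / 2 * (x ^ p * (1 - x) ^ m) + (1 / (2 * \<eta>)) * ((x ^ Suc (Suc p) * (1 - x) ^ m)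
        - (2 * c) * (x ^ Suc p * (1 - x) ^ m) + c\<^sup>2 * (x ^ p * (1 - x) ^ m))) has_integral
        (\<eta> / 2 * b0 + (1 / (2 * \<eta>)) * (b2 - (2 * c) * b1 + c\<^sup>2 * b0))) {0..1}"
      unfolding b0_def b1_def b2_def
      by (intro has_integral_add has_integral_diff has_integral_mult_right bint_has_integral)
    moreover have id: "\<eta> / 2 * P + (1 / (2 * \<eta>)) * (x * (x * P) - (2 * c) * (x * P) + c\<^sup>2 * P) =
        (\<eta> / 2 + (x - c)\<^sup>2 / (2 * \<eta>)) * P" for x P :: real
      by (simp add: power2_eq_square algebra_simps add_divide_distrib diff_divide_distrib)
    have "(\<lambda>x. \<eta> / 2 * (x ^ p * (1 - x) ^ m) + (1 / (2 * \<eta>)) * ((x ^ Suc (Suc p) * (1 - x) ^ m)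
        - (2 * c) * (x ^ Suc p * (1 - x) ^ m) + c\<^sup>2 * (x ^ p * (1 - x) ^ m))) =
        (\<lambda>x. (\<eta> / 2 + (x - c)\<^sup>2 / (2 * \<eta>)) * (x ^ p * (1 - x) ^ m))"
      using id[where P = "_ ^ p * (1 - _) ^ m"] by (intro ext) (simp only: power_Suc mult.assoc)
    ultimately show "((\<lambda>x. (\<eta> / 2 + (x - c)\<^sup>2 / (2 * \<eta>)) * (x ^ p * (1 - x) ^ m)) has_integral
        (\<eta> / 2 * b0 + (b2 - 2 * c * b1 + c\<^sup>2 * b0) / (2 * \<eta>))) {0..1}"
      by simp
  qed
  also have "\<dots> \<le> \<eta> / 2 * b0 + \<eta>\<^sup>2 * b0 / (2 * \<eta>)"
    using V \<eta> by (intro add_left_mono divide_right_mono) auto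
  also have "\<dots> = \<eta> * b0" using \<eta> by (simp add: power2_eq_square)
  finally show ?thesis by (simp add: b0_def bint_def p_def c_def)
qed

text \<open>\<open>A\<close> and \<open>B\<close> are the likelihoods on the two sides of a point.
  As \<open>A x / x ^ (l - 1)\<close> and \<open>B x / (1 - x) ^ m\<close> are increasing, their
  product is shifted to the right of the Beta density with these exponents, so its deviation below
  the centre is controlled by that density. For \<open>l = 0\<close> the centre is 0 and nothing
  lies below it.\<close>

lemma product_deviation:
  fixes l m :: nat and \<eta> :: real
  assumes A: "cts A" "nonneg A" "1 \<le> l \<Longrightarrow> rel_dec (l - 1) (\<lambda>x. A (1 - x))"
    and B: "cts B" "nonneg B" "rel_inc m B"
    and \<eta>: "0 < \<eta>" "1 \<le> \<eta>\<^sup>2 * (l + m)"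
  shows "integral {0..1} (\<lambda>x. max 0 (l / (l + m) - x) * (A x * B x)) \<le> \<eta> * integral {0..1} (\<lambda>x. A x * B x)"
proof (cases "l = 0")
  case True
  have "integral {0..1} (\<lambda>x. max 0 (l / (l + m) - x) * (A x * B x)) = integral {0..1} (\<lambda>x::real. 0::real)"
    using True by (intro integral_cong) auto
  moreover have "0 \<le> integral {0..1} (\<lambda>x. A x * B x)"
    using A(2) B(2) by (intro integral_nonneg cts_integrable continuous_on_mult A B) (auto simp: nonneg_def)
  ultimately show ?thesis using \<eta> by simp
next
  case False
  then have l: "1 \<le> l" by simp
  show ?thesis
  proof (rule deviation_compare[OF _ _ _ _ \<eta>(1) beta_deviation[OF l \<eta>]])
    show "cts (\<lambda>x. A x * B x)" by (intro continuous_on_mult A B)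
    show "nonneg (\<lambda>x. A x * B x)" using A(2) B(2) by (auto simp: nonneg_def)
    show "real l / real (l + m) \<le> 1" using l by (simp add: divide_le_eq)
    fix x y :: real assume xy: "0 \<le> x" "x \<le> y" "y \<le> 1"
    have "y ^ (l - 1) * A x \<le> x ^ (l - 1) * A y"
      using rel_ratio(2)[OF _ _ _ A(3)[OF l], of "1 - y" "1 - x"] xy by simp
    moreover have "(1 - y) ^ m * B x \<le> (1 - x) ^ m * B y"
      using rel_ratio(1)[OF xy B(3)] .
    ultimately have "(y ^ (l - 1) * A x) * ((1 - y) ^ m * B x) \<le> (x ^ (l - 1) * A y) * ((1 - x) ^ m * B y)"
      by (rule mult_mono) (use xy A(2) B(2) in \<open>auto simp: nonneg_def\<close>)
    then show "A x * B x * (y ^ (l - 1) * (1 - y) ^ m) \<le> A y * B y * (x ^ (l - 1) * (1 - x) ^ m)"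
      by (simp add: mult_ac)
  qed
qed

text \<open>The two one-sided deviations are compared with different Beta laws. The upper one
  becomes a lower one under reflection, which exchanges the left with the right likelihood and
  \<open>l\<close> with \<open>m\<close>; each side costs one \<open>\<eta>\<close>.\<close>

lemma run_concentration:
  fixes \<eta> :: real
  assumes w: "full_chain s w L" and ab: "a \<le> j" "j \<le> b" "b \<le> L" "a < b"
    and up: "\<And>k. a \<le> k \<Longrightarrow> k < b \<Longrightarrow> s k"
    and a: "a = 0 \<or> \<not> s (a - 1)" and b: "b = L \<or> \<not> s b"
    and \<eta>: "0 < \<eta>" "1 \<le> \<eta>\<^sup>2 * (b - a)"
  shows "integral {0..1} (\<lambda>x. \<bar>x - real (j - a) / real (b - a)\<bar> * (fw s j x * w j x))
    \<le> 2 * \<eta> * integral {0..1} (\<lambda>x. fw s j x * w j x)"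
proof -
  define l m where "l = j - a" and "m = b - j"
  have lm: "b - a = l + m" "1 \<le> l + m" "j = a + l" "b = j + m" using ab by (auto simp: l_def m_def)
  have ch: "chain s w L" using w by (simp add: full_chain_def)
  \<comment> \<open>The left likelihoods, reversed and reflected. Reversal turns ascents into
    descents and reflection turns them back, so the same lemmas on ascending runs serve
    \<open>r\<close> and \<open>w\<close>.\<close>
  define r where "r k x = fw s (j - k) (1 - x)" for k x
  have r: "full_chain (\<lambda>k. s (j - Suc k)) r j"
    using full_chain_flip[OF full_chain_fw[of s j]] by (simp add: r_def[abs_def])
  have chr: "chain (\<lambda>k. s (j - Suc k)) r j" using r by (simp add: full_chain_def)
  have r0: "r 0 = (\<lambda>x. fw s j (1 - x))" by (simp add: r_def[abs_def])
  have wj: "cts (w j)" "nonneg (w j)" using chainD(1)[OF ch] full_chain_nonneg[OF w] ab by auto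
  have fj: "cts (fw s j)" "nonneg (fw s j)" by (auto simp: cts_fw nonneg_fw)
  have w_inc: "rel_inc (b - j) (w j)"
    by (rule chain_rel_inc[OF ch ab(3), of a]) (use ab up b in \<open>auto intro: full_chain_end_mono[OF w]\<close>)
  have w_dec: "rel_dec (m - 1) (w j)" if "1 \<le> m"
  proof -
    have "rel_dec (b - 1 - j) (w j)"
      by (rule chain_rel_dec[OF ch, of _ j])
        (use ab up that lm in \<open>auto intro!: chain_antimono[OF ch] full_chain_nonneg[OF w]\<close>)
    then show ?thesis by (simp add: m_def)
  qed
  have r_inc: "rel_inc (l - 0) (r 0)"
    by (rule chain_rel_inc[OF chr, of _ 0]) (use lm up a in \<open>auto intro!: full_chain_end_mono[OF r]\<close>)
  have r_dec: "rel_dec (l - 1 - 0) (r 0)" if "1 \<le> l"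
    by (rule chain_rel_dec[OF chr, of _ 0])
      (use lm up that in \<open>auto intro!: chain_antimono[OF chr] full_chain_nonneg[OF r]\<close>)
  have 1: "integral {0..1} (\<lambda>x. max 0 (l / (l + m) - x) * (fw s j x * w j x))
      \<le> \<eta> * integral {0..1} (\<lambda>x. fw s j x * w j x)"
  proof (rule product_deviation[OF fj _ wj])
    show "rel_dec (l - 1) (\<lambda>x. fw s j (1 - x))" if "1 \<le> l" using r_dec[OF that] by (simp add: r0)
    show "rel_inc m (w j)" using w_inc by (simp add: m_def)
    show "1 \<le> \<eta>\<^sup>2 * real (l + m)" using \<eta>(2) lm(1) by simp
  qed (rule \<eta>(1))
  have ml: "1 \<le> \<eta>\<^sup>2 * real (m + l)" using \<eta>(2) lm(1) by (simp add: add.commute)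
  have "integral {0..1} (\<lambda>x. max 0 (m / (m + l) - x) * (w j (1 - x) * fw s j (1 - x)))
      \<le> \<eta> * integral {0..1} (\<lambda>x. w j (1 - x) * fw s j (1 - x))"
  proof (rule product_deviation[OF cts_flip[OF wj(1)] nonneg_flip[OF wj(2)] _ cts_flip[OF fj(1)] nonneg_flip[OF fj(2)] _ \<eta>(1) ml])
    show "rel_dec (m - 1) (\<lambda>x. w j (1 - (1 - x)))" if "1 \<le> m" using w_dec[OF that] by simp
    show "rel_inc l (\<lambda>x. fw s j (1 - x))" using r_inc by (simp add: r0)
  qed
  also have "integral {0..1} (\<lambda>x. w j (1 - x) * fw s j (1 - x)) = integral {0..1} (\<lambda>x. fw s j x * w j x)"
    using integral_reflect01[of 0 1 "\<lambda>x. fw s j x * w j x"] by (simp add: mult.commute)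
  also have "(\<lambda>x. max 0 (m / (m + l) - x) * (w j (1 - x) * fw s j (1 - x)))
      = (\<lambda>x. (\<lambda>y. max 0 (y - l / (l + m)) * (fw s j y * w j y)) (1 - x))"
  proof (rule ext)
    fix x :: real
    have "real m / real (m + l) = 1 - real l / real (l + m)"
      unfolding add.commute[of m l] using lm(2) by (simp add: eq_diff_eq add_divide_distrib[symmetric])
    then have e: "real m / real (m + l) - x = 1 - x - real l / real (l + m)" by linarith
    show "max 0 (m / (m + l) - x) * (w j (1 - x) * fw s j (1 - x))
      = max 0 (1 - x - l / (l + m)) * (fw s j (1 - x) * w j (1 - x))"
      by (subst e, subst mult.commute[of "w j (1 - x)"]) (rule refl)
  qed
  also have "integral {0..1} \<dots> = integral {0..1} (\<lambda>y. max 0 (y - l / (l + m)) * (fw s j y * w j y))"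
    by (subst integral_reflect01) simp
  finally have 2: "integral {0..1} (\<lambda>y. max 0 (y - l / (l + m)) * (fw s j y * w j y))
      \<le> \<eta> * integral {0..1} (\<lambda>x. fw s j x * w j x)" .
  have eq: "(\<lambda>x. \<bar>x - real (j - a) / real (b - a)\<bar> * (fw s j x * w j x)) =
      (\<lambda>x. max 0 (l / (l + m) - x) * (fw s j x * w j x) + max 0 (x - l / (l + m)) * (fw s j x * w j x))"
  proof (rule ext)
    fix x :: real
    have "\<bar>x - t\<bar> * p = max 0 (t - x) * p + max 0 (x - t) * p" for t p :: real
      by (cases "t \<le> x") (simp_all add: left_diff_distrib)
    then show "\<bar>x - real (j - a) / real (b - a)\<bar> * (fw s j x * w j x) =
      max 0 (l / (l + m) - x) * (fw s j x * w j x) + max 0 (x - l / (l + m)) * (fw s j x * w j x)"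
      unfolding lm(1) l_def[symmetric] .
  qed
  have "integral {0..1} (\<lambda>x. \<bar>x - real (j - a) / real (b - a)\<bar> * (fw s j x * w j x)) =
      integral {0..1} (\<lambda>x. max 0 (l / (l + m) - x) * (fw s j x * w j x))
      + integral {0..1} (\<lambda>x. max 0 (x - l / (l + m)) * (fw s j x * w j x))"
    unfolding eq by (rule Henstock_Kurzweil_Integration.integral_add)
      (intro cts_integrable continuous_intros fj wj; simp)+
  also have "\<dots> \<le> \<eta> * integral {0..1} (\<lambda>x. fw s j x * w j x) + \<eta> * integral {0..1} (\<lambda>x. fw s j x * w j x)"
    by (rule add_mono[OF 1 2])
  finally show ?thesis by (simp only: mult_2 distrib_right)
qed

lemma run_concentrated:
  fixes \<eta> :: real
  assumes w: "full_chain s w L" and ab: "a \<le> j" "j \<le> b" "b \<le> L" "a < b"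
    and run: "\<And>k. a \<le> k \<Longrightarrow> k < b \<Longrightarrow> s k = s a"
    and a: "a = 0 \<or> s (a - 1) \<noteq> s a" and b: "b = L \<or> s b \<noteq> s a"
    and \<eta>: "0 < \<eta>" "1 \<le> \<eta>\<^sup>2 * (b - a)"
  obtains c where "c \<in> {0..1}" "integral {0..1} (\<lambda>x. \<bar>x - c\<bar> * (fw s j x * w j x))
    \<le> 2 * \<eta> * integral {0..1} (\<lambda>x. fw s j x * w j x)"
proof (cases "s a")
  case True
  then have up: "s k" if "a \<le> k" "k < b" for k using run that by blast
  show ?thesis
    by (rule that[OF _ run_concentration[OF w ab up _ _ \<eta>]]) (use True a b ab in auto)
next
  case False
  define c where "c = real (j - a) / real (b - a)"
  have dn: "\<not> s k" if "a \<le> k" "k < b" for k using run that False by blast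
  have "integral {0..1} (\<lambda>x. \<bar>x - c\<bar> * (fw s j (1 - x) * w j (1 - x)))
    \<le> 2 * \<eta> * integral {0..1} (\<lambda>x. fw s j (1 - x) * w j (1 - x))"
    using run_concentration[OF full_chain_flip[OF w] ab dn _ _ \<eta>] a b False
    by (simp add: fw_flip c_def)
  moreover have "integral {0..1} (\<lambda>x. fw s j (1 - x) * w j (1 - x)) = integral {0..1} (\<lambda>x. fw s j x * w j x)"
    using integral_reflect01[of 0 1 "\<lambda>x. fw s j x * w j x"] by simp
  moreover have "integral {0..1} (\<lambda>x. \<bar>x - c\<bar> * (fw s j (1 - x) * w j (1 - x)))
     = integral {0..1} (\<lambda>x. \<bar>x - (1 - c)\<bar> * (fw s j x * w j x))"
    using integral_reflect01[of 0 1 "\<lambda>x. \<bar>x - (1 - c)\<bar> * (fw s j x * w j x)"]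
    by (simp add: abs_minus_commute algebra_simps)
  moreover have "1 - c \<in> {0..1}" using ab by (auto simp: c_def field_simps)
  ultimately show ?thesis using that[of "1 - c"] by simp
qed

section \<open>Independence of two distant points\<close>

text \<open>The backward recursion with a weight at every position; \<open>d\<close> is the number
  of positions still to be integrated. For a pattern ending at \<open>L\<close>, position
  \<open>k\<close> carries \<open>bw s g (L - k) k\<close>.\<close>

primrec bw :: "(nat \<Rightarrow> bool) \<Rightarrow> (nat \<Rightarrow> real \<Rightarrow> real) \<Rightarrow> nat \<Rightarrow> nat \<Rightarrow> real \<Rightarrow> real" where
  "bw s g 0 k = g k"
| "bw s g (Suc d) k = (\<lambda>x. g k x * stp (s k) (bw s g d (Suc k)) x)"

text \<open>\<open>Z s g L\<close> is the integral of \<open>\<Prod>k\<le>L. g k (x k)\<close> over the points of the unit cube whose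
  coordinates \<open>0, \<dots>, L\<close> have the ascents prescribed by \<open>s\<close>.\<close>

definition Z :: "(nat \<Rightarrow> bool) \<Rightarrow> (nat \<Rightarrow> real \<Rightarrow> real) \<Rightarrow> nat \<Rightarrow> real" where
  "Z s g L = integral {0..1} (bw s g L 0)"

abbreviation one :: "nat \<Rightarrow> real \<Rightarrow> real" where
  "one \<equiv> \<lambda>_ _. 1"

lemma cts_bw: "(\<And>k. cts (g k)) \<Longrightarrow> cts (bw s g d k)"
  by (induction d arbitrary: k) (auto intro!: continuous_on_mult cts_stp)

lemma nonneg_bw: "(\<And>k. cts (g k)) \<Longrightarrow> (\<And>k. nonneg (g k)) \<Longrightarrow> nonneg (bw s g d k)"
proof (induction d arbitrary: k)
  case (Suc d)
  have "nonneg (stp (s k) (bw s g d (Suc k)))" by (intro stp_nonneg cts_bw Suc)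
  with Suc.prems(2)[of k] show ?case by (auto simp: nonneg_def)
qed simp

lemma bw_cong: "(\<And>i. k \<le> i \<Longrightarrow> i \<le> k + d \<Longrightarrow> g i = g' i) \<Longrightarrow> bw s g d k = bw s g' d k"
proof (induction d arbitrary: k)
  case (Suc d)
  have "bw s g d (Suc k) = bw s g' d (Suc k)" by (rule Suc.IH) (use Suc.prems in auto)
  with Suc.prems[of k] show ?case by simp
qed simp

lemma full_chain_bw: "full_chain s (\<lambda>k. bw s one (L - k) k) L"
proof -
  have "bw s one (L - k) k = stp (s k) (bw s one (L - Suc k) (Suc k))" if "k < L" for k
    using that by (simp add: Suc_diff_Suc[symmetric])
  then show ?thesis by (auto simp: full_chain_def chain_def cts_bw)
qed

lemma bw_upd:
  assumes "j \<le> L"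
  shows "bw s (g(j := h)) (L - j) j = (\<lambda>x. h x * (if j = L then 1 else stp (s j) (bw s g (L - Suc j) (Suc j)) x))"
proof (cases "j = L")
  case False
  have "bw s (g(j := h)) (L - Suc j) (Suc j) = bw s g (L - Suc j) (Suc j)" by (rule bw_cong) auto
  then show ?thesis using assms False by (simp add: Suc_diff_Suc[symmetric])
qed simp

lemma bw_one_upd:
  assumes "j \<le> L"
  shows "bw s (one(j := h)) (L - j) j = (\<lambda>x. h x * bw s one (L - j) j x)"
  using bw_upd[OF assms, of s one h] bw_upd[OF assms, of s one "\<lambda>_. 1"] by (simp add: fun_upd_idem)

text \<open>Before \<open>j\<close> all weights are 1, so the recursion is a pure chain there. This
  is the \<open>f\<close> to which \<open>mixing\<close> is applied, against the \<open>w\<close> of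
  \<open>full_chain_bw\<close>.\<close>

lemma chain_bw_upd:
  assumes "cts h" "j \<le> L"
  shows "chain s (\<lambda>k. bw s (one(j := h)) (L - k) k) j"
proof -
  have "bw s (one(j := h)) (L - k) k = stp (s k) (bw s (one(j := h)) (L - Suc k) (Suc k))" if "k < j" for k
    using that assms by (simp add: Suc_diff_Suc[symmetric])
  then show ?thesis using assms by (auto simp: chain_def intro!: cts_bw)
qed

lemma Z_one_upd:
  assumes "cts h" "j \<le> L"
  shows "Z s (one(j := h)) L = integral {0..1} (\<lambda>x. h x * (fw s j x * bw s one (L - j) j x))"
  using integral_chain[OF chain_bw_upd[OF assms], of j] bw_one_upd[OF assms(2)]
  by (simp add: Z_def mult_ac)

text \<open>A sign known at \<open>k0\<close> descends to the total integrals, because before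
  \<open>k0\<close> the three weightings apply the same positive operators. Three slots accommodate
  a difference and an error term; a coefficient 0 gives comparisons of two.\<close>

lemma bw_comb_nonneg:
  assumes cts: "\<And>k. cts (g1 k)" "\<And>k. cts (g2 k)" "\<And>k. cts (g3 k)"
    and nn: "\<And>k. k < k0 \<Longrightarrow> nonneg (g1 k)"
    and eq: "\<And>k. k < k0 \<Longrightarrow> g2 k = g1 k" "\<And>k. k < k0 \<Longrightarrow> g3 k = g1 k"
    and k0: "k0 \<le> L"
    and base: "nonneg (\<lambda>x. a * bw s g1 (L - k0) k0 x + b * bw s g2 (L - k0) k0 x + c * bw s g3 (L - k0) k0 x)"
  shows "0 \<le> a * Z s g1 L + b * Z s g2 L + c * Z s g3 L"
proof -
  define F where "F k = (\<lambda>x. a * bw s g1 (L - k) k x + b * bw s g2 (L - k) k x + c * bw s g3 (L - k) k x)" for k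
  have ctsF: "cts (F k)" for k unfolding F_def by (intro continuous_intros cts_bw cts)
  have "nonneg (F k)" if "k \<le> k0" for k
    using that
  proof (induction rule: inc_induct)
    case base then show ?case using assms(8) by (simp add: F_def)
  next
    case (step k)
    have k: "L - k = Suc (L - Suc k)" using step k0 by simp
    show ?case unfolding nonneg_def
    proof
      fix x :: real assume x: "x \<in> {0..1}"
      define B where "B g = bw s g (L - Suc k) (Suc k)" for g
      have cB: "cts (B g1)" "cts (B g2)" "cts (B g3)" unfolding B_def by (intro cts_bw cts)+
      have "F (Suc k) = (\<lambda>x. 1 * (a * B g1 x + b * B g2 x) + c * B g3 x)" by (simp add: F_def B_def)
      then have "stp (s k) (F (Suc k)) x = 1 * stp (s k) (\<lambda>x. a * B g1 x + b * B g2 x) x + c * stp (s k) (B g3) x"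
        using stp_lin[OF _ cB(3) x, of "\<lambda>x. a * B g1 x + b * B g2 x" "s k" 1 c] cB by (simp add: continuous_intros)
      also have "\<dots> = a * stp (s k) (B g1) x + b * stp (s k) (B g2) x + c * stp (s k) (B g3) x"
        using stp_lin[OF cB(1,2) x] by simp
      finally have "F k x = g1 k x * stp (s k) (F (Suc k)) x"
        unfolding F_def k bw.simps using eq[OF step.hyps(2)] by (simp add: B_def algebra_simps)
      then show "0 \<le> F k x"
        using nn[OF step.hyps(2)] stp_nonneg[OF ctsF step.IH, of "s k"] x by (simp add: nonneg_def)
    qed
  qed
  from this[of 0] have "0 \<le> integral {0..1} (F 0)"
    by (intro integral_nonneg cts_integrable ctsF) (auto simp: nonneg_def)
  also have "\<dots> = integral {0..1} (\<lambda>x. a * bw s g1 L 0 x + b * bw s g2 L 0 x) + integral {0..1} (\<lambda>x. c * bw s g3 L 0 x)"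
    unfolding F_def minus_nat.diff_0 
    by (rule Henstock_Kurzweil_Integration.integral_add) (intro cts_integrable continuous_intros cts_bw cts; simp)+
  also have "integral {0..1} (\<lambda>x. a * bw s g1 L 0 x + b * bw s g2 L 0 x) =
      integral {0..1} (\<lambda>x. a * bw s g1 L 0 x) + integral {0..1} (\<lambda>x. b * bw s g2 L 0 x)"
    by (rule Henstock_Kurzweil_Integration.integral_add) (intro cts_integrable continuous_intros cts_bw cts; simp)+
  finally show ?thesis by (simp add: Z_def)
qed

lemma Z_mono:
  assumes "\<And>k. cts (g k)" "\<And>k. cts (g' k)" "\<And>k. nonneg (g k)"
    "\<And>k x. x \<in> {0..1} \<Longrightarrow> g k x \<le> g' k x"
  shows "Z s g L \<le> Z s g' L"
proof -
  have "\<forall>x\<in>{0..1}. bw s g d k x \<le> bw s g' d k x" for d k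
  proof (induction d arbitrary: k)
    case (Suc d)
    show ?case
    proof
      fix x :: real assume x: "x \<in> {0..1}"
      have "stp (s k) (bw s g d (Suc k)) x \<le> stp (s k) (bw s g' d (Suc k)) x"
        by (rule stp_mono) (use Suc x in \<open>auto intro: cts_bw assms\<close>)
      moreover have "0 \<le> stp (s k) (bw s g d (Suc k)) x"
        using stp_nonneg[OF cts_bw nonneg_bw] assms x by (simp add: nonneg_def)
      moreover have "0 \<le> g k x" using assms(3)[of k] x by (simp add: nonneg_def)
      ultimately show "bw s g (Suc d) k x \<le> bw s g' (Suc d) k x"
        using assms(4)[OF x, of k] by (simp add: mult_mono)
    qed
  qed (use assms(4) in simp)
  then show ?thesis unfolding Z_def
    by (intro integral_le cts_integrable cts_bw assms) auto
qed

lemma Z_nonneg: "(\<And>k. cts (g k)) \<Longrightarrow> (\<And>k. nonneg (g k)) \<Longrightarrow> 0 \<le> Z s g L"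
  unfolding Z_def using nonneg_bw[of g s L 0]
  by (intro integral_nonneg cts_integrable cts_bw) (auto simp: nonneg_def)

lemma integral_pos:
  assumes "cts f" "0 \<le> a" "a < b" "b \<le> 1" "\<And>x. x \<in> {a..b} \<Longrightarrow> 0 \<le> f x" "\<And>x. 0 < x \<Longrightarrow> x < 1 \<Longrightarrow> 0 < f x"
  shows "0 < integral {a..b} f"
proof -
  have c: "continuous_on {a..b} f" by (rule continuous_on_subset[OF assms(1)]) (use assms in auto)
  have "0 \<le> integral {a..b} f" using assms by (intro integral_nonneg cts_integrable) auto
  moreover have "integral {a..b} f \<noteq> 0"
  proof
    assume "integral {a..b} f = 0"
    then have "f ((a + b) / 2) = 0"
      using integral_eq_0_iff[OF c assms(3,5)] assms(3) by auto
    then show False using assms(6)[of "(a + b) / 2"] assms(2-4) by simp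
  qed
  ultimately show ?thesis by simp
qed

text \<open>Tail likelihoods may vanish at 0 or 1 but are positive in between. Through the count of
  cells this will show that every descent set is realised by a permutation.\<close>

lemma Z_one_pos: "0 < Z s one L"
proof -
  have "0 < bw s one d k x" if "0 < x" "x < 1" for d k x
    using that
  proof (induction d arbitrary: k x)
    case (Suc d)
    have "0 \<le> bw s one d (Suc k) y" if "y \<in> {0..1}" for y
      using nonneg_bw[of one s d "Suc k"] that by (simp add: nonneg_def)
    then show ?case using Suc
      by (auto simp: stp_def up_def dn_def intro!: integral_pos cts_bw)
  qed simp
  moreover have "0 \<le> bw s one L 0 y" if "y \<in> {0..1}" for y
    using nonneg_bw[of one s L 0] that by (simp add: nonneg_def)
  ultimately show ?thesis unfolding Z_def by (intro integral_pos cts_bw) auto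
qed

text \<open>The weights up to \<open>i\<close> act as nonnegative factors and positive operators, so
  bounds on the conditional expectation of \<open>h\<close> given the value at \<open>i\<close> hold
  for every weighting \<open>g\<close> of the past, with constants independent of
  \<open>g\<close>.\<close>

lemma mixing_Z:
  assumes g: "\<And>k. cts (g k)" "\<And>k. nonneg (g k)" "\<And>k. i < k \<Longrightarrow> g k = (\<lambda>_. 1)"
    and h: "cts h" and ij: "i < j" "j \<le> L"
    and c: "\<And>x. x \<in> {0..1} \<Longrightarrow> c * bw s one (L - i) i x \<le> bw s (one(j := h)) (L - i) i x \<and>
        bw s (one(j := h)) (L - i) i x \<le> d * bw s one (L - i) i x"
  shows "c * Z s g L \<le> Z s (g(j := h)) L" "Z s (g(j := h)) L \<le> d * Z s g L"
proof -
  have Li: "L - i = Suc (L - Suc i)" using ij by simp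
  have 1: "bw s g (L - i) i = (\<lambda>x. g i x * bw s one (L - i) i x)"
    unfolding Li using bw_cong[of "Suc i" "L - Suc i" g one s] g(3) by auto
  have 2: "bw s (g(j := h)) (L - i) i = (\<lambda>x. g i x * bw s (one(j := h)) (L - i) i x)"
    unfolding Li using bw_cong[of "Suc i" "L - Suc i" "g(j := h)" "one(j := h)" s] g(3) ij by auto
  have gh: "cts ((g(j := h)) k)" for k using g h by simp
  have le: "g i x * (c * bw s one (L - i) i x) \<le> g i x * bw s (one(j := h)) (L - i) i x"
    "g i x * bw s (one(j := h)) (L - i) i x \<le> g i x * (d * bw s one (L - i) i x)" if "x \<in> {0..1}" for x
    using c[OF that] g(2)[of i] that by (intro mult_left_mono; simp add: nonneg_def)+
  have "0 \<le> - c * Z s g L + 1 * Z s (g(j := h)) L + 0 * Z s g L"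
    by (rule bw_comb_nonneg[where ?k0.0 = i]) (use g gh ij le in \<open>auto simp: 1 2 nonneg_def mult_ac\<close>)
  then show "c * Z s g L \<le> Z s (g(j := h)) L" by simp
  have "0 \<le> d * Z s g L + (-1) * Z s (g(j := h)) L + 0 * Z s g L"
    by (rule bw_comb_nonneg[where ?k0.0 = i]) (use g gh ij le in \<open>auto simp: 1 2 nonneg_def mult_ac\<close>)
  then show "Z s (g(j := h)) L \<le> d * Z s g L" by simp
qed

text \<open>Replacing \<open>h\<close> by the constant \<open>h c\<close> costs at most
  \<open>\<rho> * \<bar>x - c\<bar>\<close>. In this error the weights \<open>g\<close>, being at
  most 1, are replaced by 1, which leaves the mean deviation under the bare pattern.\<close>

lemma concentrated_Z:
  assumes g: "\<And>k. cts (g k)" "\<And>k x. x \<in> {0..1} \<Longrightarrow> 0 \<le> g k x \<and> g k x \<le> 1" "g j = (\<lambda>_. 1)" and j: "j \<le> L"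
    and h: "cts h" "\<And>x y. x \<in> {0..1} \<Longrightarrow> y \<in> {0..1} \<Longrightarrow> \<bar>h x - h y\<bar> \<le> \<rho> * \<bar>x - y\<bar>"
    and c: "c \<in> {0..1}" and \<rho>: "0 \<le> \<rho>"
  shows "\<bar>Z s (g(j := h)) L - h c * Z s g L\<bar> \<le>
    \<rho> * integral {0..1} (\<lambda>x. \<bar>x - c\<bar> * (fw s j x * bw s one (L - j) j x))"
proof -
  define \<phi> where "\<phi> = (\<lambda>x. \<rho> * \<bar>x - c\<bar>)"
  have \<phi>: "cts \<phi>" "nonneg \<phi>" using \<rho> by (auto simp: \<phi>_def nonneg_def intro!: continuous_intros)
  have gj: "g = g(j := (\<lambda>_. 1))" using g(3) by (metis fun_upd_triv)
  define R where "R = (\<lambda>x. if j = L then 1 else stp (s j) (bw s g (L - Suc j) (Suc j)) x)"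
  have gn: "nonneg (g k)" for k using g(2) by (simp add: nonneg_def)
  have R: "0 \<le> R x" if "x \<in> {0..1}" for x
    using stp_nonneg[OF cts_bw nonneg_bw, OF g(1) g(1) gn] that by (simp add: R_def nonneg_def)
  have cu: "cts ((g(j := p)) k)" if "cts p" for p k using g that by simp
  have up: "bw s (g(j := p)) (L - j) j = (\<lambda>x. p x * R x)" for p
    using bw_upd[OF j] by (simp add: R_def)
  have le: "\<bar>h x - h c\<bar> * R x \<le> \<phi> x * R x" if "x \<in> {0..1}" for x
    using h(2)[OF that c] R[OF that] by (intro mult_right_mono) (auto simp: \<phi>_def)
  have abs: "(h x - h c) * R x \<le> \<phi> x * R x \<and> - ((h x - h c) * R x) \<le> \<phi> x * R x" if "x \<in> {0..1}" for x
    using le[OF that] R[OF that] abs_ge_self[of "(h x - h c) * R x"] abs_ge_minus_self[of "(h x - h c) * R x"]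
    by (simp add: abs_mult)
  have "0 \<le> (-1) * Z s (g(j := h)) L + h c * Z s (g(j := (\<lambda>_. 1))) L + 1 * Z s (g(j := \<phi>)) L"
    by (rule bw_comb_nonneg[where ?k0.0 = j], (rule cu, (rule h \<phi> continuous_on_const)?)+)
      (use g gn j abs in \<open>auto simp: up nonneg_def algebra_simps\<close>)
  moreover have "0 \<le> 1 * Z s (g(j := h)) L + (- h c) * Z s (g(j := (\<lambda>_. 1))) L + 1 * Z s (g(j := \<phi>)) L"
    by (rule bw_comb_nonneg[where ?k0.0 = j], (rule cu, (rule h \<phi> continuous_on_const)?)+)
      (use g gn j abs in \<open>auto simp: up nonneg_def algebra_simps\<close>)
  moreover have "Z s (g(j := \<phi>)) L \<le> Z s (one(j := \<phi>)) L"
    by (rule Z_mono) (use g \<phi> gn in auto)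
  moreover have "Z s (one(j := \<phi>)) L = \<rho> * integral {0..1} (\<lambda>x. \<bar>x - c\<bar> * (fw s j x * bw s one (L - j) j x))"
    unfolding Z_one_upd[OF \<phi>(1) j] by (simp add: \<phi>_def mult.assoc)
  ultimately show ?thesis using gj by (simp add: abs_le_iff)
qed

lemma run_around:
  assumes "0 < j" "j \<le> L"
  obtains a b :: nat where "a < j" "j \<le> b" "b \<le> L" "\<forall>k. a \<le> k \<longrightarrow> k < b \<longrightarrow> s k = s a"
    "a = 0 \<or> s (a - 1) \<noteq> s a" "b = L \<or> s b \<noteq> s a"
proof -
  obtain q where q: "1 \<le> q" "q \<le> j" "\<forall>k. j - q \<le> k \<longrightarrow> k < j \<longrightarrow> s k = s (j - 1)"
    "q = j \<or> s (j - q - 1) \<noteq> s (j - 1)" using run_before[OF assms(1), of s] by blast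
  define P where "P b \<longleftrightarrow> j \<le> b \<and> (b = L \<or> s b \<noteq> s (j - 1))" for b
  have PL: "P L" using assms by (simp add: P_def)
  define b where "b = (LEAST b. P b)"
  have b: "P b" "b \<le> L" unfolding b_def using LeastI[of P, OF PL] Least_le[of P, OF PL] by auto
  have before: "\<not> P k" if "k < b" for k by (rule not_less_Least) (use that in \<open>simp add: b_def\<close>)
  define a where "a = j - q"
  have a: "a < j" using q(1,2) by (simp add: a_def)
  have sa: "s a = s (j - 1)" using q(3)[rule_format, of a] a by (simp add: a_def)
  have "s k = s a" if "a \<le> k" "k < b" for k
  proof (cases "k < j")
    case True then show ?thesis using q(3)[rule_format, of k] that sa by (simp add: a_def)
  next
    case False then show ?thesis using before[OF that(2)] that b(2) unfolding P_def sa by simp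
  qed
  then have run: "\<forall>k. a \<le> k \<longrightarrow> k < b \<longrightarrow> s k = s a" by blast
  have a0: "a = 0 \<or> s (a - 1) \<noteq> s a"
  proof (cases "q = j")
    case False
    then have "s (a - 1) \<noteq> s (j - 1)" using q(4) unfolding a_def by blast
    then show ?thesis unfolding sa by simp
  qed (simp add: a_def)
  have jb: "j \<le> b" "b = L \<or> s b \<noteq> s a" using b(1) unfolding P_def sa by blast+
  show ?thesis by (rule that[OF a jb(1) b(2) run a0 jb(2)])
qed

text \<open>A bound on the covariance of a weight of the whole past with a function of one later
  value, multiplied by the squared normalisation. Taking an arbitrary past, rather than one earlier
  point, is what allows points to be peeled off later.\<close>

lemma two_point_independence:
  fixes \<eta> \<rho> :: real
  assumes \<eta>: "0 < \<eta>" and \<rho>: "0 < \<rho>"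
  shows "\<exists>n. \<forall>s L i j g h. j \<le> L \<longrightarrow> i + n \<le> j \<longrightarrow> (\<forall>k. cts (g k)) \<longrightarrow>
    (\<forall>k. \<forall>x\<in>{0..1}. 0 \<le> g k x \<and> g k x \<le> 1) \<longrightarrow> (\<forall>k>i. g k = (\<lambda>_. 1)) \<longrightarrow>
    cts h \<longrightarrow> (\<forall>x\<in>{0..1}. 0 \<le> h x \<and> h x \<le> 1) \<longrightarrow>
    (\<forall>x\<in>{0..1}. \<forall>y\<in>{0..1}. \<bar>h x - h y\<bar> \<le> \<rho> * \<bar>x - y\<bar>) \<longrightarrow>
    \<bar>Z s (g(j := h)) L * Z s one L - Z s g L * Z s (one(j := h)) L\<bar> \<le> \<eta> * (Z s one L)\<^sup>2"
proof -
  \<comment> \<open>With this choice \<open>2 * \<rho> * \<zeta>\<close> is half of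
    \<open>\<eta>\<close>, and the concentrated case replaces \<open>h\<close> by a constant
    twice.\<close>
  define \<zeta> where "\<zeta> = \<eta> / (4 * \<rho>)"
  have \<zeta>: "0 < \<zeta>" using \<eta> \<rho> by (simp add: \<zeta>_def)
  obtain M :: nat where "1 / \<zeta>\<^sup>2 < M" using reals_Archimedean2 by blast
  then have M: "1 \<le> \<zeta>\<^sup>2 * M" using \<zeta> by (simp add: pos_divide_less_eq mult.commute)
  obtain n where n: "\<forall>s w f L i j a m. full_chain s w L \<longrightarrow> chain s f j \<longrightarrow> j \<le> L \<longrightarrow> i + n \<le> j \<longrightarrow>
     a < j \<longrightarrow> j \<le> a + m \<longrightarrow> m \<le> M \<longrightarrow> run_after s L a m \<longrightarrow> a = 0 \<or> s (a - 1) \<noteq> s a \<longrightarrow>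
     (\<forall>x\<in>{0..1}. 0 \<le> f j x \<and> f j x \<le> w j x) \<longrightarrow> osc \<eta> (f i) (w i)"
    using mixing[OF \<eta>, of M] by (rule exE)
  show ?thesis
  proof (rule exI[of _ "Suc n"], intro allI impI)
    fix s L i j and g :: "nat \<Rightarrow> real \<Rightarrow> real" and h :: "real \<Rightarrow> real"
    assume j: "j \<le> L" "i + Suc n \<le> j" and g0: "\<forall>k. cts (g k)"
      "\<forall>k. \<forall>x\<in>{0..1}. 0 \<le> g k x \<and> g k x \<le> 1" "\<forall>k>i. g k = (\<lambda>_. 1)"
      and h0: "cts h" "\<forall>x\<in>{0..1}. 0 \<le> h x \<and> h x \<le> 1"
        "\<forall>x\<in>{0..1}. \<forall>y\<in>{0..1}. \<bar>h x - h y\<bar> \<le> \<rho> * \<bar>x - y\<bar>"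
    note g = g0(1)[rule_format] g0(2)[rule_format] g0(3)[rule_format]
    note h = h0(1) h0(2)[rule_format] h0(3)[rule_format]
    define Z1 where "Z1 = Z s one L"
    define Zh where "Zh = Z s (one(j := h)) L"
    define Zg where "Zg = Z s g L"
    define Zgh where "Zgh = Z s (g(j := h)) L"
    have ij: "i < j" using j by simp
    have gn: "nonneg (g k)" for k using g(2) by (simp add: nonneg_def)
    have Z1: "0 < Z1" by (simp add: Z1_def Z_one_pos)
    have Zg0: "0 \<le> Zg" unfolding Zg_def by (rule Z_nonneg[OF g(1) gn])
    have "Zg \<le> Z1" unfolding Zg_def Z1_def
      by (rule Z_mono[OF g(1) _ gn]) (simp_all add: g(2))
    note Zg = Zg0 this
    have "0 < j" using ij by simp
    obtain a b where ab: "a < j" "j \<le> b" "b \<le> L" "\<forall>k. a \<le> k \<longrightarrow> k < b \<longrightarrow> s k = s a"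
      "a = 0 \<or> s (a - 1) \<noteq> s a" "b = L \<or> s b \<noteq> s a"
      using run_around[OF \<open>0 < j\<close> j(1), of s] by blast
    have "\<bar>Zgh * Z1 - Zg * Zh\<bar> \<le> \<eta> * Z1\<^sup>2"
    proof (cases "b - a \<le> M")
      case True
      have "osc \<eta> (bw s (one(j := h)) (L - i) i) (bw s one (L - i) i)"
      proof (rule n[rule_format, OF full_chain_bw chain_bw_upd[OF h(1) j(1)] j(1) _ ab(1) _ True _ ab(5)])
        have ba: "a + (b - a) = b" "1 \<le> b - a" using ab(1,2) by simp_all
        show "run_after s L a (b - a)" unfolding run_after_def ba(1) using ba(2) ab(3,4,6) by blast
        have bd: "0 \<le> h x * bw s one (L - j) j x \<and> h x * bw s one (L - j) j x \<le> bw s one (L - j) j x"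
          if x: "x \<in> {0..1}" for x
        proof -
          have "0 \<le> bw s one (L - j) j x"
            using nonneg_bw[of one s "L - j" j] x by (simp add: nonneg_def)
          then show ?thesis using h(2)[OF x] by (simp add: mult_left_le_one_le)
        qed
        show "0 \<le> bw s (one(j := h)) (L - j) j x \<and> bw s (one(j := h)) (L - j) j x \<le> bw s one (L - j) j x"
          if "x \<in> {0..1}" for x
          unfolding bw_one_upd[OF j(1)] using bd[OF that] .
        show "i + n \<le> j" "j \<le> a + (b - a)" using j ab(1,2) by simp_all
      qed
      then obtain c where c: "\<And>x. x \<in> {0..1} \<Longrightarrow> c * bw s one (L - i) i x \<le> bw s (one(j := h)) (L - i) i x \<and>
        bw s (one(j := h)) (L - i) i x \<le> (c + \<eta>) * bw s one (L - i) i x" unfolding osc_def by blast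
      have 1: "c * Zg \<le> Zgh" "Zgh \<le> (c + \<eta>) * Zg"
        unfolding Zg_def Zgh_def by (rule mixing_Z[OF g(1) gn g(3) h(1) ij j(1) c]; simp)+
      have 2: "c * Z1 \<le> Zh" "Zh \<le> (c + \<eta>) * Z1"
        unfolding Z1_def Zh_def by (rule mixing_Z[OF _ _ _ h(1) ij j(1) c]; simp add: nonneg_def)+
      \<comment> \<open>Informally \<open>Zgh / Zg\<close> and \<open>Zh / Z1\<close> lie in the
        same interval of length \<open>\<eta>\<close>. The products are used because
        \<open>Zg\<close> may be 0.\<close>
      have "c * Zg * Z1 \<le> Zgh * Z1" "Zgh * Z1 \<le> (c + \<eta>) * Zg * Z1"
        using 1 Z1 by (intro mult_right_mono; simp)+
      moreover have "Zg * (c * Z1) \<le> Zg * Zh" "Zg * Zh \<le> Zg * ((c + \<eta>) * Z1)"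
        using 2 Zg by (intro mult_left_mono; simp)+
      moreover have "\<eta> * (Zg * Z1) \<le> \<eta> * Z1\<^sup>2"
        unfolding power2_eq_square using \<eta> Zg Z1 by (intro mult_left_mono mult_right_mono) auto
      ultimately have "Zgh * Z1 - Zg * Zh \<le> \<eta> * Z1\<^sup>2" "Zg * Zh - Zgh * Z1 \<le> \<eta> * Z1\<^sup>2"
        by (simp_all add: algebra_simps)
      then show ?thesis by (simp only: abs_le_iff minus_diff_eq)
    next
      case False
      have "1 \<le> \<zeta>\<^sup>2 * real (b - a)"
      proof -
        have "real M \<le> real (b - a)" using False by (intro of_nat_mono) simp
        then have "\<zeta>\<^sup>2 * real M \<le> \<zeta>\<^sup>2 * real (b - a)" by (rule mult_left_mono) simp
        with M show ?thesis by linarith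
      qed
      then obtain c where c: "c \<in> {0..1}" and le: "integral {0..1} (\<lambda>x. \<bar>x - c\<bar> * (fw s j x * bw s one (L - j) j x))
          \<le> 2 * \<zeta> * integral {0..1} (\<lambda>x. fw s j x * bw s one (L - j) j x)"
        using run_concentrated[OF full_chain_bw less_imp_le[OF ab(1)] ab(2,3) less_le_trans[OF ab(1,2)]
            ab(4)[rule_format] ab(5,6) \<zeta>] by blast
      have Zi: "integral {0..1} (\<lambda>x. fw s j x * bw s one (L - j) j x) = Z1"
        using Z_one_upd[of "\<lambda>_. 1" j L s] j by (simp add: Z1_def fun_upd_idem)
      define D where "D = \<rho> * integral {0..1} (\<lambda>x. \<bar>x - c\<bar> * (fw s j x * bw s one (L - j) j x))"
      have "D \<le> \<rho> * (2 * \<zeta> * Z1)" unfolding D_def Zi[symmetric] using le \<rho> by (intro mult_left_mono) auto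
      then have D: "D \<le> \<eta> / 2 * Z1" using \<rho> by (simp add: \<zeta>_def)
      have 1: "\<bar>Zgh - h c * Zg\<bar> \<le> D" unfolding Zgh_def Zg_def D_def
        
        by (rule concentrated_Z[where g = g and h = h and \<rho> = \<rho>, OF g(1) g(2) g(3)[OF ij] j(1) h(1) h(3) c less_imp_le[OF \<rho>]])
      have 2: "\<bar>Zh - h c * Z1\<bar> \<le> D" unfolding Zh_def Z1_def D_def
        
        by (rule concentrated_Z[where g = one and h = h and \<rho> = \<rho>, OF _ _ _ j(1) h(1) h(3) c less_imp_le[OF \<rho>]]) simp_all
      have "\<bar>Zgh * Z1 - Zg * Zh\<bar> = \<bar>(Zgh - h c * Zg) * Z1 - Zg * (Zh - h c * Z1)\<bar>"
        by (simp add: algebra_simps)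
      also have "\<dots> \<le> \<bar>Zgh - h c * Zg\<bar> * Z1 + Zg * \<bar>Zh - h c * Z1\<bar>"
        using abs_triangle_ineq4[of "(Zgh - h c * Zg) * Z1" "Zg * (Zh - h c * Z1)"] Z1 Zg by (simp add: abs_mult)
      also have "\<dots> \<le> D * Z1 + Z1 * D"
        using 1 2 Z1 Zg abs_ge_zero[of "Zh - h c * Z1"] by (intro add_mono mult_mono) auto
      also have "\<dots> \<le> \<eta> / 2 * Z1 * Z1 + Z1 * (\<eta> / 2 * Z1)"
        using D Z1 by (intro add_mono mult_right_mono mult_left_mono) auto
      also have "\<dots> = \<eta> * Z1\<^sup>2" by (simp add: power2_eq_square)
      finally show ?thesis .
    qed
    then show "\<bar>Z s (g(j := h)) L * Z s one L - Z s g L * Z s (one(j := h)) L\<bar> \<le> \<eta> * (Z s one L)\<^sup>2"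
      by (simp add: Z1_def Zh_def Zg_def Zgh_def)
  qed
qed

section \<open>The cube and its order cells\<close>

definition unit_measure :: "real measure" where
  "unit_measure = restrict_space lborel {0..1}"

definition cube :: "nat \<Rightarrow> (nat \<Rightarrow> real) measure" where
  "cube L = (\<Pi>\<^sub>M k\<in>{..L}. unit_measure)"

definition pat :: "(nat \<Rightarrow> bool) \<Rightarrow> nat \<Rightarrow> (nat \<Rightarrow> real) \<Rightarrow> bool" where
  "pat s L x \<longleftrightarrow> (\<forall>k<L. if s k then x k < x (Suc k) else x (Suc k) < x k)"

lemma space_unit_measure [simp]: "space unit_measure = {0..1}"
  by (simp add: unit_measure_def space_restrict_space)

lemma sets_unit_measure [measurable_cong]: "sets unit_measure = sets (restrict_space borel {0..1})"
  by (simp add: unit_measure_def sets_restrict_space)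

interpretation unit_measure: prob_space unit_measure
  by (rule prob_spaceI) (simp add: unit_measure_def emeasure_restrict_space space_restrict_space)

interpretation units: product_prob_space "\<lambda>_. unit_measure" I for I :: "nat set"
  by unfold_locales

interpretation cube: prob_space "cube L" for L
  unfolding cube_def by (rule prob_space_PiM) unfold_locales

lemma borel_measurable_cts: "cts f \<Longrightarrow> f \<in> borel_measurable unit_measure"
  using borel_measurable_continuous_on_restrict[of "{0..1}" f]
  by (simp add: measurable_cong_sets[OF sets_unit_measure refl])

text \<open>The bridge from integrals over the probability space to the gauge integrals inside
  \<open>stp\<close>. The endpoints are exempt, since strict inequalities and closed intervals
  disagree there on a null set only.\<close>

lemma integral_unit_measure:
  assumes "cts f" and [measurable]: "Measurable.pred borel P"
    and "0 \<le> a" "b \<le> 1" "\<And>x. x \<in> {0..1} \<Longrightarrow> x \<noteq> a \<Longrightarrow> x \<noteq> b \<Longrightarrow> P x \<longleftrightarrow> a < x \<and> x < b"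
  shows "(\<integral>x. of_bool (P x) * f x \<partial>unit_measure) = integral {a..b} f"
proof -
  have si: "set_integrable lborel {a..b} f"
    by (rule borel_integrable_atLeastAtMost', rule continuous_on_subset[OF assms(1)]) (use assms in auto)
  have "set_integrable lborel {0..1} f" by (rule borel_integrable_atLeastAtMost'[OF assms(1)])
  then have m [measurable]: "(\<lambda>x. indicator {0..1} x * f x) \<in> borel_measurable borel"
    by (auto simp: set_integrable_def dest: borel_measurable_integrable)
  from si have m' [measurable]: "(\<lambda>x. indicator {a..b} x * f x) \<in> borel_measurable borel"
    by (auto simp: set_integrable_def dest: borel_measurable_integrable)
  have "(\<integral>x. of_bool (P x) * f x \<partial>unit_measure) = (\<integral>x. indicator {0..1} x *\<^sub>R (of_bool (P x) * f x) \<partial>lborel)"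
    unfolding unit_measure_def by (rule integral_restrict_space) simp
  also have "\<dots> = (\<integral>x. of_bool (P x) * (indicator {0..1} x * f x) \<partial>lborel)"
    by (rule Bochner_Integration.integral_cong) simp_all
  also have "\<dots> = (\<integral>x. indicator {a..b} x * f x \<partial>lborel)"
  proof (rule integral_cong_AE)
    show "AE x in lborel. of_bool (P x) * (indicator {0..1} x * f x) = indicator {a..b} x * f x"
      using AE_lborel_singleton[of a] AE_lborel_singleton[of b]
    proof eventually_elim
      case (elim x)
      then show ?case using assms(3,4) assms(5)[of x] by (auto simp: indicator_def)
    qed
  qed measurable
  also have "\<dots> = (LINT x:{a..b}|lborel. f x)"
    unfolding set_lebesgue_integral_def by simp
  also have "\<dots> = integral {a..b} f"
    by (rule set_borel_integral_eq_integral[OF si])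
  finally show ?thesis .
qed

lemma integral_unit_measure_stp:
  assumes f: "cts f" and x: "x \<in> {0..1}"
  shows "(\<integral>y. of_bool (if b then x < y else y < x) * f y \<partial>unit_measure) = stp b f x"
proof (cases b)
  case True
  have "(\<integral>y. of_bool (x < y) * f y \<partial>unit_measure) = integral {x..1} f"
    by (rule integral_unit_measure[OF f]) (use x in auto)
  then show ?thesis using True by (simp add: stp_def up_def)
next
  case False
  have "(\<integral>y. of_bool (y < x) * f y \<partial>unit_measure) = integral {0..x} f"
    by (rule integral_unit_measure[OF f]) (use x in auto)
  then show ?thesis using False by (simp add: stp_def dn_def)
qed

text \<open>\<open>bw\<close> unfolds at its first position, whereas product measures grow by their
  last coordinate. Absorbing the last step into the preceding weight reconciles the two
  orders.\<close>

lemma bw_snoc: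
  "bw s (g(k + d := \<lambda>x. g (k + d) x * stp (s (k + d)) (g (Suc (k + d))) x)) d k = bw s g (Suc d) k"
proof (induction d arbitrary: k)
  case (Suc d)
  show ?case using Suc.IH[of "Suc k"] by simp
qed simp

lemma space_cube: "x \<in> space (cube L) \<Longrightarrow> k \<le> L \<Longrightarrow> x k \<in> {0..1}"
  by (auto simp: cube_def space_PiM PiE_def Pi_def)

lemma measurable_coord [measurable]: "k \<le> L \<Longrightarrow> (\<lambda>x. x k) \<in> measurable (cube L) unit_measure"
  unfolding cube_def by (rule measurable_component_singleton) simp

lemma measurable_coord_cts: "cts f \<Longrightarrow> k \<le> L \<Longrightarrow> (\<lambda>x. f (x k)) \<in> borel_measurable (cube L)"
  by (rule measurable_compose[OF measurable_coord borel_measurable_cts])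

lemma measurable_pat [measurable]: "Measurable.pred (cube L) (pat s L)"
proof -
  have [measurable]: "(\<lambda>x. x k) \<in> borel_measurable (cube L)" if "k \<le> L" for k
    using measurable_coord_cts[of "\<lambda>x. x" k L] that by (simp add: continuous_on_id)
  have "Measurable.pred (cube L) (\<lambda>x. \<forall>k\<in>{..<L}. if s k then x k < x (Suc k) else x (Suc k) < x k)"
    by (intro pred_intros_finite(3)) (auto split: if_splits)
  then show ?thesis by (simp add: pat_def[abs_def] Ball_def)
qed

lemma cts_bounded: "cts f \<Longrightarrow> \<exists>C. \<forall>x\<in>{0..1}. \<bar>f x\<bar> \<le> C"
  using compact_imp_bounded[OF compact_continuous_image[OF _ compact_Icc], of 0 1 f]
  by (auto simp: bounded_iff)

lemma integrable_pat:
  assumes "\<And>k. cts (g k)"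
  shows "integrable (cube L) (\<lambda>x. of_bool (pat s L x) * (\<Prod>k\<le>L. g k (x k)))"
proof -
  obtain C where C: "\<And>k x. x \<in> {0..1} \<Longrightarrow> \<bar>g k x\<bar> \<le> C k"
    using cts_bounded[OF assms] by metis
  show ?thesis
  proof (rule cube.integrable_const_bound[where B = "\<Prod>k\<le>L. C k"])
    show "AE x in cube L. norm (of_bool (pat s L x) * (\<Prod>k\<le>L. g k (x k))) \<le> (\<Prod>k\<le>L. C k)"
    proof (rule AE_I2)
      fix x assume x: "x \<in> space (cube L)"
      have "\<bar>\<Prod>k\<le>L. g k (x k)\<bar> \<le> (\<Prod>k\<le>L. C k)"
        unfolding abs_prod by (rule prod_mono) (use C space_cube[OF x] in auto)
      then show "norm (of_bool (pat s L x) * (\<Prod>k\<le>L. g k (x k))) \<le> (\<Prod>k\<le>L. C k)"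
        by (cases "pat s L x") auto
    qed
    have [measurable]: "(\<lambda>x. g k (x k)) \<in> borel_measurable (cube L)" if "k \<in> {..L}" for k
      using measurable_coord_cts[OF assms] that by simp
    show "(\<lambda>x. of_bool (pat s L x) * (\<Prod>k\<le>L. g k (x k))) \<in> borel_measurable (cube L)"
      by measurable
  qed
qed

lemma integral_pat:
  assumes "\<And>k. cts (g k)"
  shows "(\<integral>x. of_bool (pat s L x) * (\<Prod>k\<le>L. g k (x k)) \<partial>cube L) = Z s g L"
  using assms
proof (induction L arbitrary: g)
  case 0
  have "(\<integral>x. g 0 (x 0) \<partial>cube 0) = (\<integral>x. g 0 x \<partial>unit_measure)"
    unfolding cube_def using units.product_integral_singleton[of "g 0" 0] borel_measurable_cts[OF 0] by simp
  also have "\<dots> = integral {0..1} (g 0)"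
    using integral_unit_measure[OF 0[of 0], of "\<lambda>_. True" 0 1] by simp
  finally show ?case by (simp add: pat_def Z_def)
next
  case (Suc L)
  define g' where "g' = g(L := \<lambda>x. g L x * stp (s L) (g (Suc L)) x)"
  have g': "cts (g' k)" for k using Suc.prems by (auto simp: g'_def intro!: continuous_on_mult cts_stp)
  have cube: "cube (Suc L) = PiM (insert (Suc L) {..L}) (\<lambda>_. unit_measure)"
    by (simp add: cube_def atMost_Suc)
  have "(\<integral>x. of_bool (pat s (Suc L) x) * (\<Prod>k\<le>Suc L. g k (x k)) \<partial>cube (Suc L)) =
    (\<integral>x. (\<integral>y. of_bool (pat s (Suc L) (x(Suc L := y))) * (\<Prod>k\<le>Suc L. g k ((x(Suc L := y)) k)) \<partial>unit_measure) \<partial>cube L)"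
    using integrable_pat[of g "Suc L" s, OF Suc.prems] unfolding cube
    by (subst units.product_integral_insert) (simp_all add: cube_def)
  also have "\<dots> = (\<integral>x. of_bool (pat s L x) * (\<Prod>k\<le>L. g' k (x k)) \<partial>cube L)"
  proof (rule Bochner_Integration.integral_cong[OF refl])
    fix x assume x: "x \<in> space (cube L)"
    have pat: "pat s (Suc L) (x(Suc L := y)) \<longleftrightarrow> pat s L x \<and> (if s L then x L < y else y < x L)" for y
      unfolding pat_def by (auto simp: less_Suc_eq)
    have prod: "(\<Prod>k\<le>Suc L. g k ((x(Suc L := y)) k)) = (\<Prod>k\<le>L. g k (x k)) * g (Suc L) y" for y
      by simp
    have "(\<integral>y. of_bool (pat s (Suc L) (x(Suc L := y))) * (\<Prod>k\<le>Suc L. g k ((x(Suc L := y)) k)) \<partial>unit_measure)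
      = (\<integral>y. (of_bool (pat s L x) * (\<Prod>k\<le>L. g k (x k))) * (of_bool (if s L then x L < y else y < x L) * g (Suc L) y) \<partial>unit_measure)"
      unfolding pat prod of_bool_conj by (rule Bochner_Integration.integral_cong) (simp_all only: mult_ac)
    also have "\<dots> = of_bool (pat s L x) * (\<Prod>k\<le>L. g k (x k)) * stp (s L) (g (Suc L)) (x L)"
      using integral_unit_measure_stp[OF Suc.prems space_cube[OF x order_refl], of "s L"] by simp
    also have "\<dots> = of_bool (pat s L x) * (\<Prod>k\<le>L. g' k (x k))"
      unfolding g'_def by (simp add: prod.remove[of "{..L}" L] mult_ac)
    finally show "(\<integral>y. of_bool (pat s (Suc L) (x(Suc L := y))) * (\<Prod>k\<le>Suc L. g k ((x(Suc L := y)) k)) \<partial>unit_measure)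
      = of_bool (pat s L x) * (\<Prod>k\<le>L. g' k (x k))" .
  qed
  also have "\<dots> = Z s g' L" by (rule Suc.IH[OF g'])
  also have "\<dots> = Z s g (Suc L)" using bw_snoc[of s g 0 L] by (simp add: Z_def g'_def)
  finally show ?case .
qed

section \<open>Order cells and ranks\<close>

definition cell :: "nat \<Rightarrow> (nat \<Rightarrow> nat) \<Rightarrow> (nat \<Rightarrow> real) \<Rightarrow> bool" where
  "cell L \<sigma> x \<longleftrightarrow> (\<forall>a\<le>L. \<forall>b\<le>L. x a < x b \<longleftrightarrow> \<sigma> (Suc a) < \<sigma> (Suc b))"

lemma permutes_coord:
  assumes "\<sigma> permutes {1..Suc L}"
  shows "a \<le> L \<Longrightarrow> \<sigma> (Suc a) - 1 \<le> L" "a \<le> L \<Longrightarrow> Suc (\<sigma> (Suc a) - 1) = \<sigma> (Suc a)"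
proof -
  assume "a \<le> L"
  then have "\<sigma> (Suc a) \<in> {1..Suc L}" using permutes_in_image[OF assms, of "Suc a"] by simp
  then show "\<sigma> (Suc a) - 1 \<le> L" "Suc (\<sigma> (Suc a) - 1) = \<sigma> (Suc a)" by auto
qed

lemma pat_True: "pat (\<lambda>_. True) L y \<longleftrightarrow> (\<forall>a\<le>L. \<forall>b\<le>L. y a < y b \<longleftrightarrow> a < b)"
proof
  assume "pat (\<lambda>_. True) L y"
  then have step: "y k < y (Suc k)" if "k < L" for k using that by (simp add: pat_def)
  have less: "y a < y b" if "a < b" "b \<le> L" for a b
    using that
  proof (induction b)
    case (Suc b)
    then show ?case using step[of b] by (cases "a = b") (auto intro: less_trans)
  qed simp
  show "\<forall>a\<le>L. \<forall>b\<le>L. y a < y b \<longleftrightarrow> a < b"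
  proof (intro allI impI)
    fix a b assume "a \<le> L" "b \<le> L"
    then show "y a < y b \<longleftrightarrow> a < b"
      using less[of a b] less[of b a] by (cases a b rule: linorder_cases) auto
  qed
qed (simp add: pat_def)

text \<open>The index of the coordinate of rank \<open>c\<close>, both counted from 0; the shifts
  are due to permutations acting on \<open>{1..Suc L}\<close>.\<close>

definition rank_coord :: "(nat \<Rightarrow> nat) \<Rightarrow> nat \<Rightarrow> nat" where
  "rank_coord \<sigma> c = inv \<sigma> (Suc c) - 1"

lemma rank_coord:
  assumes "\<sigma> permutes {1..Suc L}" "c \<le> L"
  shows "rank_coord \<sigma> c \<le> L" "\<sigma> (Suc (rank_coord \<sigma> c)) = Suc c"
  using permutes_coord[OF permutes_inv[OF assms(1)] assms(2)] permutes_inverses(1)[OF assms(1)]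
  by (simp_all add: rank_coord_def)

lemma rank_coord_inverse:
  assumes "\<sigma> permutes {1..Suc L}" "a \<le> L"
  shows "rank_coord \<sigma> (\<sigma> (Suc a) - 1) = a"
  using permutes_coord(2)[OF assms] permutes_inverses(2)[OF assms(1)]
  by (simp add: rank_coord_def)

text \<open>Listing coordinates by rank maps every cell onto the increasing one. As relabelling
  preserves \<open>cube\<close>, all cells are copies of a single simplex.\<close>

lemma cell_iff_pat:
  assumes \<sigma>: "\<sigma> permutes {1..Suc L}"
  shows "cell L \<sigma> x \<longleftrightarrow> pat (\<lambda>_. True) L (\<lambda>c\<in>{..L}. x (rank_coord \<sigma> c))"
proof
  assume "cell L \<sigma> x"
  then show "pat (\<lambda>_. True) L (\<lambda>c\<in>{..L}. x (rank_coord \<sigma> c))"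
    unfolding pat_True cell_def using rank_coord[OF \<sigma>] by simp
next
  assume p: "pat (\<lambda>_. True) L (\<lambda>c\<in>{..L}. x (rank_coord \<sigma> c))"
  have p': "x (rank_coord \<sigma> a) < x (rank_coord \<sigma> b) \<longleftrightarrow> a < b" if "a \<le> L" "b \<le> L" for a b
    using p that unfolding pat_True by simp
  show "cell L \<sigma> x" unfolding cell_def
  proof (intro allI impI)
    fix a b assume ab: "a \<le> L" "b \<le> L"
    have "x a < x b \<longleftrightarrow> \<sigma> (Suc a) - 1 < \<sigma> (Suc b) - 1"
      using p'[OF permutes_coord(1)[OF \<sigma> ab(1)] permutes_coord(1)[OF \<sigma> ab(2)]]
      by (simp only: rank_coord_inverse[OF \<sigma> ab(1)] rank_coord_inverse[OF \<sigma> ab(2)])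
    also have "\<dots> \<longleftrightarrow> \<sigma> (Suc a) < \<sigma> (Suc b)"
      using permutes_coord(2)[OF \<sigma> ab(1)] permutes_coord(2)[OF \<sigma> ab(2)] by linarith
    finally show "x a < x b \<longleftrightarrow> \<sigma> (Suc a) < \<sigma> (Suc b)" .
  qed
qed

lemma distr_rank_coord:
  assumes \<sigma>: "\<sigma> permutes {1..Suc L}"
  shows "distr (cube L) (cube L) (\<lambda>x. \<lambda>c\<in>{..L}. x (rank_coord \<sigma> c)) = cube L"
  unfolding cube_def
proof (rule distr_PiM_reindex)
  show "prob_space unit_measure" by (rule unit_measure.prob_space_axioms)
  show "inj_on (rank_coord \<sigma>) {..L}"
    using rank_coord(2)[OF \<sigma>] by (intro inj_onI) (metis atMost_iff nat.inject)
  show "rank_coord \<sigma> \<in> {..L} \<rightarrow> {..L}" using rank_coord(1)[OF \<sigma>] by auto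
qed

lemma measurable_rank_coord:
  assumes \<sigma>: "\<sigma> permutes {1..Suc L}"
  shows "(\<lambda>x. \<lambda>c\<in>{..L}. x (rank_coord \<sigma> c)) \<in> measurable (cube L) (cube L)"
  unfolding cube_def
  by (rule measurable_restrict, rule measurable_component_singleton) (use rank_coord(1)[OF \<sigma>] in auto)

lemma measurable_cell [measurable]:
  assumes \<sigma>: "\<sigma> permutes {1..Suc L}"
  shows "Measurable.pred (cube L) (cell L \<sigma>)"
  using measurable_compose[OF measurable_rank_coord[OF \<sigma>] measurable_pat[where L = L and s = "\<lambda>_. True"]]
  by (simp add: cell_iff_pat[OF \<sigma>, abs_def])

lemma prod_upd_one:
  assumes "p \<le> (L::nat)"
  shows "(\<Prod>k\<le>L. (one(p := h)) k (y k)) = h (y p)"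
  using assms by (simp add: prod.remove[of "{..L}" p])

text \<open>On the cell of \<open>\<sigma>\<close> the coordinate \<open>a\<close> is the order
  statistic of rank \<open>\<sigma> (Suc a)\<close>, so after sorting \<open>h\<close> is attached
  to that place of the increasing pattern.\<close>

lemma integral_cell:
  assumes \<sigma>: "\<sigma> permutes {1..Suc L}" and h: "cts h" and a: "a \<le> L"
  shows "(\<integral>x. of_bool (cell L \<sigma> x) * h (x a) \<partial>cube L) = Z (\<lambda>_. True) (one(\<sigma> (Suc a) - 1 := h)) L"
proof -
  define p where "p = \<sigma> (Suc a) - 1"
  have p: "p \<le> L" "rank_coord \<sigma> p = a"
    using permutes_coord[OF \<sigma> a] rank_coord_inverse[OF \<sigma> a] by (simp_all add: p_def)
  let ?T = "\<lambda>x. \<lambda>c\<in>{..L}. x (rank_coord \<sigma> c)"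
  have [measurable]: "(\<lambda>x. h (x p)) \<in> borel_measurable (cube L)" by (rule measurable_coord_cts[OF h p(1)])
  have "(\<integral>x. of_bool (cell L \<sigma> x) * h (x a) \<partial>cube L) =
      (\<integral>x. (\<lambda>y. of_bool (pat (\<lambda>_. True) L y) * h (y p)) (?T x) \<partial>cube L)"
    using p by (simp add: cell_iff_pat[OF \<sigma>])
  also have "\<dots> = (\<integral>y. of_bool (pat (\<lambda>_. True) L y) * h (y p) \<partial>distr (cube L) (cube L) ?T)"
    by (rule integral_distr[symmetric, OF measurable_rank_coord[OF \<sigma>]]) measurable
  also have "\<dots> = (\<integral>y. of_bool (pat (\<lambda>_. True) L y) * (\<Prod>k\<le>L. (one(p := h)) k (y k)) \<partial>cube L)"
    unfolding distr_rank_coord[OF \<sigma>] prod_upd_one[OF p(1)] ..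
  also have "\<dots> = Z (\<lambda>_. True) (one(p := h)) L"
    by (rule integral_pat) (use h in simp)
  finally show ?thesis by (simp add: p_def)
qed

lemma stp_True_power:
  assumes "x \<in> {0..1}"
  shows "stp True (\<lambda>x. (1 - x) ^ d / fact d) x = (1 - x) ^ Suc d / fact (Suc d)"
proof -
  have "stp True (\<lambda>x. (1 - x) ^ d / fact d) x = dn (\<lambda>x. x ^ d / fact d) (1 - x)"
    using stp_flip[of False "\<lambda>x. x ^ d / fact d" x] by (simp add: stp_def)
  also have "\<dots> = (1 - x) ^ Suc d / fact (Suc d)" using assms by (intro dn_power) simp
  finally show ?thesis .
qed

lemma bw_True: "x \<in> {0..1} \<Longrightarrow> bw (\<lambda>_. True) one d k x = (1 - x) ^ d / fact d"
proof (induction d arbitrary: k x)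
  case (Suc d)
  have "bw (\<lambda>_. True) one (Suc d) k x = stp True (bw (\<lambda>_. True) one d (Suc k)) x" by simp
  also have "\<dots> = stp True (\<lambda>x. (1 - x) ^ d / fact d) x"
    by (rule stp_cong) (use Suc in auto)
  finally show ?case by (simp only: stp_True_power[OF Suc.prems])
qed simp

lemma Z_True: "Z (\<lambda>_. True) one L = 1 / fact (Suc L)"
proof -
  have "Z (\<lambda>_. True) one L = stp True (bw (\<lambda>_. True) one L 0) 0"
    by (simp add: Z_def stp_def up_def)
  also have "\<dots> = stp True (\<lambda>x. (1 - x) ^ L / fact L) 0"
    by (rule stp_cong) (simp_all add: bw_True)
  finally show ?thesis using stp_True_power[of 0 L] by (simp del: fact_Suc)
qed

lemma measure_cell:
  assumes "\<sigma> permutes {1..Suc L}"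
  shows "(\<integral>x. (of_bool (cell L \<sigma> x) :: real) \<partial>cube L) = 1 / fact (Suc L)"
  using integral_cell[OF assms, of "\<lambda>_. 1" 0] Z_True[of L] by (simp add: fun_upd_idem)

text \<open>\<open>\<sigma> (Suc a)\<close> exceeds by one the number of coordinates smaller than
  \<open>x a\<close>, so \<open>x\<close> determines it.\<close>

lemma cell_unique:
  assumes "\<sigma> permutes {1..Suc L}" "\<tau> permutes {1..Suc L}" "cell L \<sigma> x" "cell L \<tau> x"
  shows "\<sigma> = \<tau>"
proof
  fix i
  show "\<sigma> i = \<tau> i"
  proof (cases "i \<in> {1..Suc L}")
    case False
    then show ?thesis using assms(1,2) by (simp add: permutes_def)
  next
    case True
    then obtain a where a: "i = Suc a" "a \<le> L" by (cases i) auto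
    have card: "\<rho> (Suc a) = Suc (card {b. b \<le> L \<and> x b < x a})" if \<rho>: "\<rho> permutes {1..Suc L}" "cell L \<rho> x" for \<rho>
    proof -
      have "bij_betw (\<lambda>b. \<rho> (Suc b)) {b. b \<le> L \<and> x b < x a} {1..<\<rho> (Suc a)}"
      proof (rule bij_betwI')
        show "\<rho> (Suc b) = \<rho> (Suc c) \<longleftrightarrow> b = c" for b c
          using permutes_inj[OF \<rho>(1)] by (auto simp: inj_eq)
        show "\<rho> (Suc b) \<in> {1..<\<rho> (Suc a)}" if "b \<in> {b. b \<le> L \<and> x b < x a}" for b
        proof -
          have "\<rho> (Suc b) < \<rho> (Suc a)" using that \<rho>(2) a unfolding cell_def by blast
          moreover have "1 \<le> \<rho> (Suc b)" using permutes_coord(2)[OF \<rho>(1), of b] that by simp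
          ultimately show ?thesis by simp
        qed
        show "\<exists>b\<in>{b. b \<le> L \<and> x b < x a}. y = \<rho> (Suc b)" if y: "y \<in> {1..<\<rho> (Suc a)}" for y
        proof -
          have "\<rho> (Suc a) \<le> Suc L" using permutes_coord[OF \<rho>(1) a(2)] by simp
          then have "y - 1 \<le> L" "Suc (y - 1) = y" using y by auto
          then have b: "rank_coord \<rho> (y - 1) \<le> L" "\<rho> (Suc (rank_coord \<rho> (y - 1))) = y"
            using rank_coord[OF \<rho>(1), of "y - 1"] by auto
          then have "x (rank_coord \<rho> (y - 1)) < x a"
            using \<rho>(2) a(2) y unfolding cell_def by simp
          with b show ?thesis by (intro bexI[of _ "rank_coord \<rho> (y - 1)"]) simp_all
        qed
      qed
      then have "card {b. b \<le> L \<and> x b < x a} = card {1..<\<rho> (Suc a)}" by (rule bij_betw_same_card)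
      then show ?thesis using permutes_coord(2)[OF \<rho>(1) a(2)] by simp
    qed
    show ?thesis unfolding a(1) using card[OF assms(1,3)] card[OF assms(2,4)] by simp
  qed
qed

abbreviation perms :: "nat \<Rightarrow> (nat \<Rightarrow> nat) set" where
  "perms L \<equiv> {\<sigma>. \<sigma> permutes {1..Suc L}}"

lemma finite_perms: "finite (perms L)"
  by (rule finite_permutations) simp

lemma card_perms: "card (perms L) = fact (Suc L)"
  using card_permutations[of "{1..Suc L}" "Suc L"] by simp

text \<open>The cells are disjoint and each has measure \<open>1 / (L + 1)!\<close>, so that together they cover
  almost all of the cube.\<close>

lemma AE_cells: "AE x in cube L. (\<Sum>\<sigma>\<in>perms L. of_bool (cell L \<sigma> x)) = (1::real)"
proof -
  define S where "S x = (\<Sum>\<sigma>\<in>perms L. of_bool (cell L \<sigma> x) :: real)" for x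
  have int: "integrable (cube L) (\<lambda>x. of_bool (cell L \<sigma> x) :: real)" if "\<sigma> \<in> perms L" for \<sigma>
    using that by (intro cube.integrable_const_bound[where B = 1]) auto
  have intS: "integrable (cube L) S" unfolding S_def[abs_def]
    by (rule Bochner_Integration.integrable_sum) (rule int)
  have "(\<integral>x. S x \<partial>cube L) = (\<Sum>\<sigma>\<in>perms L. \<integral>x. of_bool (cell L \<sigma> x) \<partial>cube L)"
    unfolding S_def by (rule Bochner_Integration.integral_sum) (rule int)
  also have "\<dots> = (\<Sum>\<sigma>\<in>perms L. 1 / fact (Suc L))"
    by (rule sum.cong) (simp_all only: measure_cell mem_Collect_eq)
  also have "\<dots> = 1" by (simp only: sum_constant card_perms) (simp del: fact_Suc)
  finally have "(\<integral>x. 1 - S x \<partial>cube L) = 0" using intS by (simp add: cube.prob_space)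
  \<comment> \<open>Disjointness gives \<open>S x \<le> 1\<close> everywhere; together with the
    integral just found, \<open>1 - S\<close> must vanish almost everywhere.\<close>
  moreover have "0 \<le> 1 - S x" for x
  proof (cases "\<exists>\<sigma>\<in>perms L. cell L \<sigma> x")
    case True
    then obtain \<sigma> where \<sigma>: "\<sigma> \<in> perms L" "cell L \<sigma> x" by blast
    have "S x = (\<Sum>\<tau>\<in>perms L. if \<tau> = \<sigma> then 1 else 0)"
      unfolding S_def by (rule sum.cong) (use \<sigma> cell_unique in auto)
    also have "\<dots> = 1" using \<sigma>(1) finite_perms by (simp add: sum.delta)
    finally show ?thesis by simp
  next
    case False
    then have "S x = (\<Sum>\<tau>\<in>perms L. 0)" unfolding S_def by (intro sum.cong) auto
    then show ?thesis by simp
  qed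
  ultimately have "AE x in cube L. 1 - S x = 0"
    using integral_nonneg_eq_0_iff_AE[of "cube L" "\<lambda>x. 1 - S x"] intS by simp
  then show ?thesis by (auto simp: S_def)
qed

definition pat_perms :: "(nat \<Rightarrow> bool) \<Rightarrow> nat \<Rightarrow> (nat \<Rightarrow> nat) set" where
  "pat_perms s L = {\<sigma> \<in> perms L. \<forall>k<L. if s k then \<sigma> (Suc k) < \<sigma> (Suc (Suc k)) else \<sigma> (Suc (Suc k)) < \<sigma> (Suc k)}"

lemma finite_pat_perms: "finite (pat_perms s L)"
  unfolding pat_perms_def using finite_perms by simp

lemma cell_pat:
  assumes "cell L \<sigma> x" "\<sigma> \<in> perms L"
  shows "pat s L x \<longleftrightarrow> \<sigma> \<in> pat_perms s L"
proof -
  have "x k < x (Suc k) \<longleftrightarrow> \<sigma> (Suc k) < \<sigma> (Suc (Suc k))" "x (Suc k) < x k \<longleftrightarrow> \<sigma> (Suc (Suc k)) < \<sigma> (Suc k)"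
    if "k < L" for k using assms(1) that by (simp_all add: cell_def)
  then show ?thesis using assms(2) by (simp add: pat_def pat_perms_def)
qed

text \<open>Inside a cell the pattern depends on \<open>\<sigma>\<close> alone. Since the cells have
  equal volume, conditioning the cube on the pattern makes \<open>\<sigma>\<close> uniform on
  \<open>pat_perms s L\<close>, which is the link with \<open>sigma_lambda\<close>.\<close>

lemma integral_pat_cells:
  fixes H :: "(nat \<Rightarrow> real) \<Rightarrow> real"
  assumes [measurable]: "H \<in> borel_measurable (cube L)" and B: "\<And>x. x \<in> space (cube L) \<Longrightarrow> \<bar>H x\<bar> \<le> B"
  shows "(\<integral>x. of_bool (pat s L x) * H x \<partial>cube L) = (\<Sum>\<sigma>\<in>pat_perms s L. \<integral>x. of_bool (cell L \<sigma> x) * H x \<partial>cube L)"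
    and "\<sigma> \<in> perms L \<Longrightarrow> integrable (cube L) (\<lambda>x. of_bool (cell L \<sigma> x) * H x)"
proof -
  show int: "integrable (cube L) (\<lambda>x. of_bool (cell L \<sigma> x) * H x)" if "\<sigma> \<in> perms L" for \<sigma>
  proof (rule cube.integrable_const_bound[where B = B])
    show "AE x in cube L. norm (of_bool (cell L \<sigma> x) * H x) \<le> B"
    proof (rule AE_I2)
      fix x assume "x \<in> space (cube L)"
      from B[OF this] show "norm (of_bool (cell L \<sigma> x) * H x) \<le> B" by (cases "cell L \<sigma> x") auto
    qed
    have [measurable]: "Measurable.pred (cube L) (cell L \<sigma>)" using that by (intro measurable_cell) simp
    show "(\<lambda>x. of_bool (cell L \<sigma> x) * H x) \<in> borel_measurable (cube L)" by measurable
  qed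
  have [measurable]: "(\<lambda>x. \<Sum>\<sigma>\<in>pat_perms s L. of_bool (cell L \<sigma> x) * H x) \<in> borel_measurable (cube L)"
    by (intro borel_measurable_sum borel_measurable_integrable int) (simp add: pat_perms_def)
  have "(\<integral>x. of_bool (pat s L x) * H x \<partial>cube L) = (\<integral>x. (\<Sum>\<sigma>\<in>pat_perms s L. of_bool (cell L \<sigma> x) * H x) \<partial>cube L)"
  proof (rule integral_cong_AE)
    show "AE x in cube L. of_bool (pat s L x) * H x = (\<Sum>\<sigma>\<in>pat_perms s L. of_bool (cell L \<sigma> x) * H x)"
      using AE_cells[of L]
    proof eventually_elim
      case (elim x)
      have "of_bool (pat s L x) * H x = (\<Sum>\<sigma>\<in>perms L. of_bool (cell L \<sigma> x) * (of_bool (pat s L x) * H x))"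
        unfolding sum_distrib_right[symmetric] elim by simp
      also have "\<dots> = (\<Sum>\<sigma>\<in>perms L. if \<sigma> \<in> pat_perms s L then of_bool (cell L \<sigma> x) * H x else 0)"
        by (rule sum.cong) (use cell_pat in \<open>auto simp: of_bool_def\<close>)
      also have "\<dots> = (\<Sum>\<sigma>\<in>pat_perms s L. of_bool (cell L \<sigma> x) * H x)"
      proof (rule sum.mono_neutral_cong_right)
        show "pat_perms s L \<subseteq> perms L" unfolding pat_perms_def by blast
      qed (use finite_perms in simp_all)
      finally show ?case .
    qed
  qed measurable
  also have "\<dots> = (\<Sum>\<sigma>\<in>pat_perms s L. \<integral>x. of_bool (cell L \<sigma> x) * H x \<partial>cube L)"
    by (rule Bochner_Integration.integral_sum) (rule int, simp add: pat_perms_def)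
  finally show "(\<integral>x. of_bool (pat s L x) * H x \<partial>cube L) = (\<Sum>\<sigma>\<in>pat_perms s L. \<integral>x. of_bool (cell L \<sigma> x) * H x \<partial>cube L)" .
qed

lemma Z_one_card: "Z s one L = card (pat_perms s L) / fact (Suc L)"
proof -
  have "Z s one L = (\<integral>x. of_bool (pat s L x) * 1 \<partial>cube L)"
    using integral_pat[where g = one and s = s and L = L] by simp
  also have "\<dots> = (\<Sum>\<sigma>\<in>pat_perms s L. \<integral>x. of_bool (cell L \<sigma> x) * 1 \<partial>cube L)"
    by (rule integral_pat_cells(1)[where B = 1]) auto
  also have "\<dots> = (\<Sum>\<sigma>\<in>pat_perms s L. 1 / fact (Suc L))"
    using measure_cell by (intro sum.cong) (auto simp: pat_perms_def simp del: fact_Suc)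
  finally show ?thesis by (simp del: fact_Suc)
qed

lemma card_pat_perms_pos: "0 < card (pat_perms s L)"
  using Z_one_pos[of s L] unfolding Z_one_card by (simp add: zero_less_divide_iff del: fact_Suc)

section \<open>Factorisation for several points\<close>

text \<open>Successive updates make the addition of the last point a single update, the form in
  which \<open>two_point_independence\<close> is stated.\<close>

primrec pt :: "(nat \<Rightarrow> real \<Rightarrow> real) \<Rightarrow> (nat \<Rightarrow> nat) \<Rightarrow> nat \<Rightarrow> nat \<Rightarrow> real \<Rightarrow> real" where
  "pt h p 0 = one"
| "pt h p (Suc r) = (pt h p r)(p r := h r)"

lemma pt_one: "(\<And>j. j < r \<Longrightarrow> p j \<noteq> k) \<Longrightarrow> pt h p r k = (\<lambda>_. 1)"
  by (induction r) auto

lemma pt_cases: "pt h p r k = (\<lambda>_. 1) \<or> (\<exists>j<r. pt h p r k = h j)"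
  by (induction r) (auto simp: less_Suc_eq)

lemma prod_pt:
  assumes "inj_on p {..<r}" "\<And>j. j < r \<Longrightarrow> p j \<le> L"
  shows "(\<Prod>k\<le>L. pt h p r k (x k)) = (\<Prod>j<r. h j (x (p j)))"
  using assms
proof (induction r)
  case (Suc r)
  have one: "pt h p r (p r) = (\<lambda>_. 1)"
    by (rule pt_one) (use Suc.prems(1) in \<open>auto simp: inj_on_def\<close>)
  have "(\<Prod>k\<le>L. pt h p (Suc r) k (x k)) = h r (x (p r)) * (\<Prod>k\<in>{..L} - {p r}. pt h p (Suc r) k (x k))"
    using Suc.prems(2)[of r] by (subst prod.remove[of "{..L}" "p r"]) auto
  also have "(\<Prod>k\<in>{..L} - {p r}. pt h p (Suc r) k (x k)) = (\<Prod>k\<in>{..L} - {p r}. pt h p r k (x k))"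
    by (rule prod.cong) auto
  also have "\<dots> = (\<Prod>k\<le>L. pt h p r k (x k))"
    using Suc.prems(2)[of r] one by (subst prod.remove[of "{..L}" "p r"]) auto
  also have "\<dots> = (\<Prod>j<r. h j (x (p j)))"
    by (rule Suc.IH) (use Suc.prems in \<open>auto simp: inj_on_def\<close>)
  finally show ?case by (simp add: mult.commute)
qed simp

lemma abs_prod_diff_le:
  fixes a b :: "nat \<Rightarrow> real"
  assumes "\<And>j. j < r \<Longrightarrow> 0 \<le> a j \<and> a j \<le> 1" "\<And>j. j < r \<Longrightarrow> 0 \<le> b j \<and> b j \<le> 1"
  shows "\<bar>(\<Prod>j<r. a j) - (\<Prod>j<r. b j)\<bar> \<le> (\<Sum>j<r. \<bar>a j - b j\<bar>)"
  using assms
proof (induction r)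
  case (Suc r)
  define A where "A = (\<Prod>j<r. a j)"
  define B where "B = (\<Prod>j<r. b j)"
  have B: "0 \<le> B" "B \<le> 1" unfolding B_def using Suc.prems(2) by (auto intro!: prod_nonneg prod_le_1)
  have IH: "\<bar>A - B\<bar> \<le> (\<Sum>j<r. \<bar>a j - b j\<bar>)" unfolding A_def B_def by (rule Suc.IH) (use Suc.prems in auto)
  have "\<bar>A * a r - B * b r\<bar> = \<bar>(A - B) * a r + B * (a r - b r)\<bar>" by (simp add: algebra_simps)
  also have "\<dots> \<le> \<bar>A - B\<bar> * a r + B * \<bar>a r - b r\<bar>"
    using abs_triangle_ineq[of "(A - B) * a r" "B * (a r - b r)"] Suc.prems(1)[of r] B by (simp add: abs_mult)
  also have "\<dots> \<le> \<bar>A - B\<bar> * 1 + 1 * \<bar>a r - b r\<bar>"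
    using Suc.prems(1)[of r] B by (intro add_mono mult_left_mono mult_right_mono) auto
  finally show ?case using IH by (simp add: A_def B_def)
qed simp

definition lip :: "real \<Rightarrow> (real \<Rightarrow> real) \<Rightarrow> bool" where
  "lip \<rho> h \<longleftrightarrow> (\<forall>x\<in>{0..1}. 0 \<le> h x \<and> h x \<le> 1) \<and> (\<forall>x\<in>{0..1}. \<forall>y\<in>{0..1}. \<bar>h x - h y\<bar> \<le> \<rho> * \<bar>x - y\<bar>)"

lemma lip_cts:
  assumes "lip \<rho> h" shows "cts h"
proof -
  have "(max \<rho> 0)-lipschitz_on {0..1} h"
  proof (rule lipschitz_onI)
    fix x y :: real assume "x \<in> {0..1}" "y \<in> {0..1}"
    then have "\<bar>h x - h y\<bar> \<le> \<rho> * \<bar>x - y\<bar>" using assms by (simp add: lip_def)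
    also have "\<dots> \<le> max \<rho> 0 * \<bar>x - y\<bar>" by (intro mult_right_mono) auto
    finally show "dist (h x) (h y) \<le> max \<rho> 0 * dist x y" by (simp add: dist_real_def)
  qed simp
  then show ?thesis by (rule lipschitz_on_continuous_on)
qed

lemma pt_cts: "(\<And>j. j < r \<Longrightarrow> lip \<rho> (h j)) \<Longrightarrow> cts (pt h p r k)"
  using pt_cases[of h p r k] lip_cts[of \<rho>] by (auto simp: continuous_on_const)

lemma pt_range: "(\<And>j. j < r \<Longrightarrow> lip \<rho> (h j)) \<Longrightarrow> x \<in> {0..1} \<Longrightarrow> 0 \<le> pt h p r k x \<and> pt h p r k x \<le> 1"
  using pt_cases[of h p r k] by (auto simp: lip_def)

text \<open>In the increasing pattern all positions form one run, so the value at \<open>p\<close>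
  concentrates near \<open>p / L\<close> at a cost \<open>2 * \<eta>\<close>. Moving the centre to
  the normalised rank \<open>Suc p / Suc L\<close> costs at most \<open>1 / L\<close>, which is
  below the third \<open>\<eta>\<close>.\<close>

lemma coord_deviation:
  fixes \<eta> :: real
  assumes \<eta>: "0 < \<eta>" "\<eta> \<le> 1" "1 \<le> \<eta>\<^sup>2 * L" and p: "p \<le> L"
  shows "Z (\<lambda>_. True) (one(p := \<lambda>x. \<bar>x - real (Suc p) / real (Suc L)\<bar>)) L \<le> 3 * \<eta> / fact (Suc L)"
proof -
  define \<pi> where "\<pi> = (\<lambda>x. fw (\<lambda>_. True) p x * bw (\<lambda>_. True) one (L - p) p x)"
  have \<pi>: "cts \<pi>" "nonneg \<pi>"
    using nonneg_fw[of "\<lambda>_. True" p] nonneg_bw[of one "\<lambda>_. True" "L - p" p]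
    by (auto simp: \<pi>_def nonneg_def intro!: continuous_on_mult cts_fw cts_bw)
  have L: "0 < L" using \<eta>(3) by (cases "L = 0") auto
  have "1 / real L \<le> \<eta>\<^sup>2" using \<eta>(3) L by (simp add: pos_divide_le_eq)
  also have "\<dots> \<le> \<eta>" using \<eta> by (simp add: power2_eq_square mult_left_le)
  finally have L\<eta>: "1 / real L \<le> \<eta>" .
  have close: "\<bar>real p / real L - real (Suc p) / real (Suc L)\<bar> \<le> 1 / real L"
  proof -
    have "real p / real L - real (Suc p) / real (Suc L) = - (real L - real p) / (real L * real (Suc L))"
      using L by (simp add: divide_simps) (simp add: algebra_simps)
    then have "\<bar>real p / real L - real (Suc p) / real (Suc L)\<bar> = (real L - real p) / (real L * real (Suc L))"
      using p by (simp add: abs_div abs_mult)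
    also have "\<dots> \<le> real (Suc L) / (real L * real (Suc L))" by (intro divide_right_mono) auto
    also have "\<dots> = 1 / real L" by (simp del: of_nat_Suc)
    finally show ?thesis .
  qed
  have conc: "integral {0..1} (\<lambda>x. \<bar>x - real p / real L\<bar> * \<pi> x) \<le> 2 * \<eta> * integral {0..1} \<pi>"
    using run_concentration[OF full_chain_bw[of "\<lambda>_. True" L], of 0 p L \<eta>] p L \<eta> by (simp add: \<pi>_def)
  have Zi: "integral {0..1} \<pi> = 1 / fact (Suc L)"
    using Z_one_upd[of "\<lambda>_. 1" p L "\<lambda>_. True"] p Z_True[of L] by (simp add: \<pi>_def fun_upd_idem)
  have "Z (\<lambda>_. True) (one(p := \<lambda>x. \<bar>x - real (Suc p) / real (Suc L)\<bar>)) L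
      = integral {0..1} (\<lambda>x. \<bar>x - real (Suc p) / real (Suc L)\<bar> * \<pi> x)"
    unfolding \<pi>_def by (rule Z_one_upd[OF _ p]) (intro continuous_intros)
  also have "\<dots> \<le> integral {0..1} (\<lambda>x. \<bar>x - real p / real L\<bar> * \<pi> x + \<eta> * \<pi> x)"
  proof (intro integral_le cts_integrable)
    fix x :: real assume x: "x \<in> {0..1}"
    have "\<bar>x - real (Suc p) / real (Suc L)\<bar> \<le> \<bar>x - real p / real L\<bar> + \<eta>" using close L\<eta> by linarith
    from mult_right_mono[OF this, of "\<pi> x"]
    show "\<bar>x - real (Suc p) / real (Suc L)\<bar> * \<pi> x \<le> \<bar>x - real p / real L\<bar> * \<pi> x + \<eta> * \<pi> x"
      using \<pi>(2) x by (simp add: nonneg_def distrib_right)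
  qed (auto intro!: continuous_intros \<pi>(1))
  also have "\<dots> = integral {0..1} (\<lambda>x. \<bar>x - real p / real L\<bar> * \<pi> x) + integral {0..1} (\<lambda>x. \<eta> * \<pi> x)"
    by (rule Henstock_Kurzweil_Integration.integral_add) (intro cts_integrable continuous_intros \<pi>(1); simp)+
  also have "\<dots> \<le> 2 * \<eta> * integral {0..1} \<pi> + \<eta> * integral {0..1} \<pi>" using conc by simp
  also have "\<dots> = 3 * \<eta> / fact (Suc L)" unfolding Zi by (simp add: field_simps del: fact_Suc)
  finally show ?thesis .
qed

definition avg :: "(nat \<Rightarrow> bool) \<Rightarrow> nat \<Rightarrow> ((nat \<Rightarrow> nat) \<Rightarrow> real) \<Rightarrow> real" where
  "avg s L F = (\<Sum>\<sigma>\<in>pat_perms s L. F \<sigma>) / card (pat_perms s L)"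

lemma perm_value_range:
  assumes "\<sigma> \<in> pat_perms s L" "q \<le> L"
  shows "real (\<sigma> (Suc q)) / real (Suc L) \<in> {0..1}"
proof -
  have "\<sigma> permutes {1..Suc L}" using assms(1) by (simp add: pat_perms_def)
  from permutes_coord[OF this assms(2)] have "\<sigma> (Suc q) \<le> Suc L" by simp
  then show ?thesis by (auto simp: divide_le_eq)
qed

text \<open>The comparison is made cell by cell: each has volume \<open>1 / K\<close>, and within it
  every marked coordinate is on average within \<open>3 * \<eta>\<close> of its normalised rank. The
  bound does not depend on \<open>\<sigma>\<close>, so it passes to the average over any
  pattern.\<close>

lemma avg_pt:
  fixes \<eta> \<rho> :: real
  assumes \<eta>: "0 < \<eta>" "\<eta> \<le> 1" "1 \<le> \<eta>\<^sup>2 * L" and \<rho>: "0 \<le> \<rho>"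
    and h: "\<And>j. j < r \<Longrightarrow> lip \<rho> (h j)" and p: "inj_on p {..<r}" "\<And>j. j < r \<Longrightarrow> p j \<le> L"
  shows "\<bar>avg s L (\<lambda>\<sigma>. \<Prod>j<r. h j (real (\<sigma> (Suc (p j))) / real (Suc L))) - Z s (pt h p r) L / Z s one L\<bar>
    \<le> r * (\<rho> * (3 * \<eta>))"
proof -
  define K where "K = (fact (Suc L) :: real)"
  have K: "0 < K" by (simp add: K_def del: fact_Suc)
  define S where "S = pat_perms s L"
  have S: "\<sigma> permutes {1..Suc L}" "\<sigma> \<in> perms L" if "\<sigma> \<in> S" for \<sigma> using that by (auto simp: S_def pat_perms_def)
  define y where "y \<sigma> j = real (\<sigma> (Suc (p j))) / real (Suc L)" for \<sigma> :: "nat \<Rightarrow> nat" and j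
  define H where "H x = (\<Prod>j<r. h j (x (p j)))" for x :: "nat \<Rightarrow> real"
  define C where "C \<sigma> = (\<Prod>j<r. h j (y \<sigma> j))" for \<sigma>
  have y: "y \<sigma> j \<in> {0..1}" if "\<sigma> \<in> S" "j < r" for \<sigma> j
    using perm_value_range[of \<sigma> s L "p j"] that p(2) by (simp only: S_def y_def)
  have mH [measurable]: "H \<in> borel_measurable (cube L)" unfolding H_def[abs_def]
    by (intro borel_measurable_prod measurable_coord_cts) (use h lip_cts p in auto)
  have H1: "\<bar>H x\<bar> \<le> 1" if "x \<in> space (cube L)" for x
  proof -
    have "0 \<le> h j (x (p j)) \<and> h j (x (p j)) \<le> 1" if "j < r" for j
      using h[OF that] space_cube[OF \<open>x \<in> space (cube L)\<close> p(2)[OF that]] by (simp add: lip_def)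
    then show ?thesis unfolding H_def abs_prod by (intro prod_le_1) auto
  qed
  have "Z s (pt h p r) L = (\<integral>x. of_bool (pat s L x) * (\<Prod>k\<le>L. pt h p r k (x k)) \<partial>cube L)"
    by (rule integral_pat[symmetric]) (rule pt_cts[OF h])
  also have "\<dots> = (\<integral>x. of_bool (pat s L x) * H x \<partial>cube L)"
    by (simp only: H_def prod_pt[where x = "_ :: nat \<Rightarrow> real", OF p])
  also have "\<dots> = (\<Sum>\<sigma>\<in>S. \<integral>x. of_bool (cell L \<sigma> x) * H x \<partial>cube L)"
    unfolding S_def by (rule integral_pat_cells(1)[OF mH H1])
  finally have Z: "Z s (pt h p r) L = (\<Sum>\<sigma>\<in>S. \<integral>x. of_bool (cell L \<sigma> x) * H x \<partial>cube L)" .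
  have each: "\<bar>(\<integral>x. of_bool (cell L \<sigma> x) * H x \<partial>cube L) - C \<sigma> / K\<bar> \<le> r * (\<rho> * (3 * \<eta>)) / K" if \<sigma>: "\<sigma> \<in> S" for \<sigma>
  proof -
    have iH: "integrable (cube L) (\<lambda>x. of_bool (cell L \<sigma> x) * H x)"
      by (rule integral_pat_cells(2)[OF mH H1 S(2)[OF \<sigma>]])
    have i1: "integrable (cube L) (\<lambda>x. of_bool (cell L \<sigma> x) * (1::real))"
      by (rule integral_pat_cells(2)[where B = 1, OF _ _ S(2)[OF \<sigma>]]) auto
    have ij: "integrable (cube L) (\<lambda>x. of_bool (cell L \<sigma> x) * \<bar>x (p j) - y \<sigma> j\<bar>)" if j: "j < r" for j
    proof (rule integral_pat_cells(2)[where B = 1, OF _ _ S(2)[OF \<sigma>]])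
      show "(\<lambda>x. \<bar>x (p j) - y \<sigma> j\<bar>) \<in> borel_measurable (cube L)"
        by (rule measurable_coord_cts[of "\<lambda>x. \<bar>x - y \<sigma> j\<bar>", OF _ p(2)[OF j]]) (intro continuous_intros)
      show "\<bar>\<bar>x (p j) - y \<sigma> j\<bar>\<bar> \<le> 1" if "x \<in> space (cube L)" for x
        using space_cube[OF that p(2)[OF j]] y[OF \<sigma> j] by auto
    qed
    have meas: "(\<integral>x. of_bool (cell L \<sigma> x) * (1::real) \<partial>cube L) = 1 / K"
      using measure_cell[OF S(1)[OF \<sigma>]] by (simp add: K_def del: fact_Suc)
    have "(\<integral>x. of_bool (cell L \<sigma> x) * H x \<partial>cube L) - C \<sigma> / K =
        (\<integral>x. of_bool (cell L \<sigma> x) * H x - C \<sigma> * (of_bool (cell L \<sigma> x) * 1) \<partial>cube L)"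
      using iH i1 meas by simp
    also have "\<bar>\<dots>\<bar> \<le> (\<integral>x. \<bar>of_bool (cell L \<sigma> x) * H x - C \<sigma> * (of_bool (cell L \<sigma> x) * 1)\<bar> \<partial>cube L)"
      using integral_norm_bound[of "cube L" "\<lambda>x. of_bool (cell L \<sigma> x) * H x - C \<sigma> * (of_bool (cell L \<sigma> x) * 1)"] by simp
    also have "\<dots> \<le> (\<integral>x. (\<Sum>j<r. \<rho> * (of_bool (cell L \<sigma> x) * \<bar>x (p j) - y \<sigma> j\<bar>)) \<partial>cube L)"
    proof (rule integral_mono)
      show "integrable (cube L) (\<lambda>x. \<bar>of_bool (cell L \<sigma> x) * H x - C \<sigma> * (of_bool (cell L \<sigma> x) * 1)\<bar>)"
        using iH i1 by (intro integrable_abs Bochner_Integration.integrable_diff integrable_mult_right) auto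
      show "integrable (cube L) (\<lambda>x. \<Sum>j<r. \<rho> * (of_bool (cell L \<sigma> x) * \<bar>x (p j) - y \<sigma> j\<bar>))"
        using ij by (intro Bochner_Integration.integrable_sum integrable_mult_right) auto
      fix x assume x: "x \<in> space (cube L)"
      have "\<bar>H x - C \<sigma>\<bar> \<le> (\<Sum>j<r. \<bar>h j (x (p j)) - h j (y \<sigma> j)\<bar>)"
        unfolding H_def C_def
        by (rule abs_prod_diff_le) (use h space_cube[OF x p(2)] y[OF \<sigma>] in \<open>auto simp: lip_def\<close>)
      also have "\<dots> \<le> (\<Sum>j<r. \<rho> * \<bar>x (p j) - y \<sigma> j\<bar>)"
        by (rule sum_mono) (use h space_cube[OF x p(2)] y[OF \<sigma>] in \<open>auto simp: lip_def\<close>)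
      finally show "\<bar>of_bool (cell L \<sigma> x) * H x - C \<sigma> * (of_bool (cell L \<sigma> x) * 1)\<bar>
          \<le> (\<Sum>j<r. \<rho> * (of_bool (cell L \<sigma> x) * \<bar>x (p j) - y \<sigma> j\<bar>))"
        by (cases "cell L \<sigma> x") auto
    qed
    also have "\<dots> = (\<Sum>j<r. \<rho> * (\<integral>x. of_bool (cell L \<sigma> x) * \<bar>x (p j) - y \<sigma> j\<bar> \<partial>cube L))"
      using ij by (subst Bochner_Integration.integral_sum) auto
    also have "\<dots> \<le> (\<Sum>j<r. \<rho> * (3 * \<eta> / K))"
    proof (intro sum_mono mult_left_mono \<rho>)
      fix j assume "j \<in> {..<r}"
      then have j: "j < r" by simp
      have "(\<integral>x. of_bool (cell L \<sigma> x) * \<bar>x (p j) - y \<sigma> j\<bar> \<partial>cube L)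
          = Z (\<lambda>_. True) (one(\<sigma> (Suc (p j)) - 1 := \<lambda>x. \<bar>x - y \<sigma> j\<bar>)) L"
        by (rule integral_cell[OF S(1)[OF \<sigma>] _ p(2)[OF j]]) (intro continuous_intros)
      also have "\<dots> \<le> 3 * \<eta> / K"
      proof -
        have y: "y \<sigma> j = real (Suc (\<sigma> (Suc (p j)) - 1)) / real (Suc L)"
          unfolding permutes_coord(2)[OF S(1)[OF \<sigma>] p(2)[OF j]] y_def ..
        show ?thesis unfolding y K_def
          by (rule coord_deviation[OF \<eta> permutes_coord(1)[OF S(1)[OF \<sigma>] p(2)[OF j]]])
      qed
      finally show "(\<integral>x. of_bool (cell L \<sigma> x) * \<bar>x (p j) - y \<sigma> j\<bar> \<partial>cube L) \<le> 3 * \<eta> / K" .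
    qed
    also have "\<dots> = r * (\<rho> * (3 * \<eta>)) / K" by simp
    finally show ?thesis .
  qed
  have cS: "0 < real (card S)" using card_pat_perms_pos[of s L] by (simp add: S_def)
  have "\<bar>Z s (pt h p r) L - (\<Sum>\<sigma>\<in>S. C \<sigma>) / K\<bar> = \<bar>\<Sum>\<sigma>\<in>S. (\<integral>x. of_bool (cell L \<sigma> x) * H x \<partial>cube L) - C \<sigma> / K\<bar>"
    unfolding Z sum_subtractf sum_divide_distrib ..
  also have "\<dots> \<le> (\<Sum>\<sigma>\<in>S. \<bar>(\<integral>x. of_bool (cell L \<sigma> x) * H x \<partial>cube L) - C \<sigma> / K\<bar>)" by (rule sum_abs)
  also have "\<dots> \<le> (\<Sum>\<sigma>\<in>S. r * (\<rho> * (3 * \<eta>)) / K)" by (rule sum_mono) (rule each)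
  finally have main: "\<bar>Z s (pt h p r) L - (\<Sum>\<sigma>\<in>S. C \<sigma>) / K\<bar> \<le> card S * (r * (\<rho> * (3 * \<eta>)) / K)" by simp
  have "avg s L C - Z s (pt h p r) L / Z s one L = ((\<Sum>\<sigma>\<in>S. C \<sigma>) / K - Z s (pt h p r) L) / (card S / K)"
    unfolding avg_def Z_one_card S_def[symmetric] K_def[symmetric] using cS K by (simp add: field_simps)
  also have "\<bar>\<dots>\<bar> = \<bar>Z s (pt h p r) L - (\<Sum>\<sigma>\<in>S. C \<sigma>) / K\<bar> / (card S / K)"
    unfolding abs_divide using cS K by (subst abs_minus_commute) simp
  also have "\<dots> \<le> card S * (r * (\<rho> * (3 * \<eta>)) / K) / (card S / K)"
    using main cS K by (intro divide_right_mono) auto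
  also have "\<dots> = r * (\<rho> * (3 * \<eta>))" using cS K by simp
  finally show ?thesis by (simp add: C_def[abs_def] y_def)
qed

lemma gaps_less:
  fixes p :: "nat \<Rightarrow> nat"
  assumes "\<And>j. Suc j < r \<Longrightarrow> p j < p (Suc j)"
  shows "a < b \<Longrightarrow> b < r \<Longrightarrow> p a < p b"
proof (induction b)
  case (Suc b)
  then show ?case using assms[of b] by (cases "a = b") (auto intro: less_trans)
qed simp

lemma perm_independence:
  fixes \<eta> \<rho> :: real
  assumes \<eta>: "0 < \<eta>" and \<rho>: "0 < \<rho>"
  shows "\<exists>n. \<forall>s L h p. (\<forall>j<r. lip \<rho> (h j)) \<longrightarrow> (\<forall>j<r. p j \<le> L) \<longrightarrow>
    (\<forall>j. Suc j < r \<longrightarrow> p j < p (Suc j) \<and> p j + n \<le> p (Suc j)) \<longrightarrow>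
    \<bar>avg s L (\<lambda>\<sigma>. \<Prod>j<r. h j (real (\<sigma> (Suc (p j))) / real (Suc L)))
      - (\<Prod>j<r. avg s L (\<lambda>\<sigma>. h j (real (\<sigma> (Suc (p j))) / real (Suc L))))\<bar> \<le> \<eta>"
proof (cases "r \<le> 1")
  \<comment> \<open>One point gives equality at once. It is treated apart because it puts no lower
    bound on \<open>L\<close>, whereas the spacing of two points forces \<open>L\<close> to be large
    enough for ranks to approximate the uniform variables.\<close>
  case True
  have "r = 0 \<or> r = 1" using True by auto
  moreover have "avg s L (\<lambda>\<sigma>. 1) = 1" for s L
    using card_pat_perms_pos[of s L] by (simp add: avg_def)
  ultimately show ?thesis using \<eta> by (auto simp: lessThan_Suc)
next
  case False
  \<comment> \<open>The budget: \<open>\<eta> / 4\<close> for the ranks in the joint average,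
    \<open>\<eta> / 4\<close> for those in all the single averages together, and \<open>r\<close>
    peeling steps of \<open>\<theta>\<close>, that is \<open>\<eta> / 2\<close>.\<close>
  define \<zeta> where "\<zeta> = min 1 (\<eta> / (12 * r * \<rho>))"
  define \<theta> where "\<theta> = \<eta> / (2 * r)"
  have pos: "0 < \<zeta>" "\<zeta> \<le> 1" "0 < \<theta>" using \<eta> \<rho> False by (auto simp: \<zeta>_def \<theta>_def)
  have "\<zeta> \<le> \<eta> / (12 * r * \<rho>)" by (simp add: \<zeta>_def)
  then have \<zeta>2: "r * (\<rho> * (3 * \<zeta>)) \<le> \<eta> / 4" using \<rho> False by (simp add: pos_le_divide_eq mult_ac)
  obtain m :: nat where m: "1 / \<zeta>\<^sup>2 < m" using reals_Archimedean2 by blast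
  then have m: "1 \<le> \<zeta>\<^sup>2 * m" using pos by (simp add: pos_divide_less_eq mult.commute)
  obtain n where n: "\<forall>s L i j g h. j \<le> L \<longrightarrow> i + n \<le> j \<longrightarrow> (\<forall>k. cts (g k)) \<longrightarrow>
    (\<forall>k. \<forall>x\<in>{0..1}. 0 \<le> g k x \<and> g k x \<le> 1) \<longrightarrow> (\<forall>k>i. g k = (\<lambda>_. 1)) \<longrightarrow>
    cts h \<longrightarrow> (\<forall>x\<in>{0..1}. 0 \<le> h x \<and> h x \<le> 1) \<longrightarrow>
    (\<forall>x\<in>{0..1}. \<forall>y\<in>{0..1}. \<bar>h x - h y\<bar> \<le> \<rho> * \<bar>x - y\<bar>) \<longrightarrow>
    \<bar>Z s (g(j := h)) L * Z s one L - Z s g L * Z s (one(j := h)) L\<bar> \<le> \<theta> * (Z s one L)\<^sup>2"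
    using two_point_independence[OF pos(3) \<rho>] by (rule exE)
  show ?thesis
  proof (rule exI[of _ "max m n"], intro allI impI)
    fix s L h p
    assume h0: "\<forall>j<r. lip \<rho> (h j)" and p0: "\<forall>j<r. p j \<le> L"
      and gap: "\<forall>j. Suc j < r \<longrightarrow> p j < p (Suc j) \<and> p j + max m n \<le> p (Suc j)"
    have h: "lip \<rho> (h j)" if "j < r" for j using h0 that by blast
    have p: "p j \<le> L" if "j < r" for j using p0 that by blast
    have less: "p a < p b" if "a < b" "b < r" for a b
      using gaps_less[of r p a b] gap that by blast
    have inj: "inj_on p {..<r'}" if "r' \<le> r" for r'
    proof (rule inj_onI)
      fix a b assume "a \<in> {..<r'}" "b \<in> {..<r'}" "p a = p b"
      then show "a = b" using less[of a b] less[of b a] that by (cases a b rule: linorder_cases) auto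
    qed
    have "p 0 + max m n \<le> p 1" "p 1 \<le> L" using gap[rule_format, of 0] p[of 1] False by simp_all
    then have "m \<le> L" using max.cobounded1[of m n] by linarith
    then have "\<zeta>\<^sup>2 * real m \<le> \<zeta>\<^sup>2 * real L" by (intro mult_left_mono) auto
    then have L: "1 \<le> \<zeta>\<^sup>2 * L" using m by linarith
    define Z1 where "Z1 = Z s one L"
    have Z1: "0 < Z1" by (simp add: Z1_def Z_one_pos)
    define q where "q j = Z s (one(p j := h j)) L / Z1" for j
    have q: "0 \<le> q j" "q j \<le> 1" if j: "j < r" for j
    proof -
      have c: "cts ((one(p j := h j)) k)" "nonneg ((one(p j := h j)) k)" for k
        using lip_cts[OF h[OF j]] h[OF j] by (auto simp: lip_def nonneg_def)
      have "Z s (one(p j := h j)) L \<le> Z1" unfolding Z1_def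
        by (rule Z_mono[OF c(1) _ c(2)]) (use h[OF j] in \<open>auto simp: lip_def\<close>)
      then show "0 \<le> q j" "q j \<le> 1" using Z_nonneg[of "one(p j := h j)" s L, OF c] Z1
        by (simp_all add: q_def)
    qed
    \<comment> \<open>Each new point is tested against the product of all previous ones, a weight
      that is 1 beyond \<open>p (r' - 1)\<close>; every step adds \<open>\<theta>\<close> because
      the factors \<open>q j\<close> are at most 1.\<close>
    have D: "\<bar>Z s (pt h p r') L / Z1 - (\<Prod>j<r'. q j)\<bar> \<le> r' * \<theta>" if "r' \<le> r" for r'
      using that
    proof (induction r')
      case 0 then show ?case using Z1 by (simp add: Z1_def)
    next
      case (Suc r')
      show ?case
      proof (cases "r' = 0")
        case True
        have "pt h p (Suc 0) = one(p 0 := h 0)" by (simp only: pt.simps)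
        then have "Z s (pt h p (Suc 0)) L / Z1 = q 0" by (simp only: q_def)
        then show ?thesis unfolding True using pos by (simp del: pt.simps)
      next
        case r': False
        define g where "g = pt h p r'"
        have j: "r' < r" "p (r' - 1) + n \<le> p r'" "p r' \<le> L"
          using Suc.prems gap[rule_format, of "r' - 1"] r' p[of r'] by auto
        have g1: "\<forall>k. cts (g k)" unfolding g_def using pt_cts[of r' \<rho> h] h Suc.prems by auto
        have g2: "\<forall>k. \<forall>x\<in>{0..1}. 0 \<le> g k x \<and> g k x \<le> 1"
          unfolding g_def using pt_range[of r' \<rho> h] h Suc.prems by auto
        have g3: "\<forall>k>p (r' - 1). g k = (\<lambda>_. 1)"
        proof (intro allI impI)
          fix k assume k: "p (r' - 1) < k"
          have "p a \<noteq> k" if "a < r'" for a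
          proof (cases "a = r' - 1")
            case False
            then have "a < r' - 1" "r' - 1 < r" using that j(1) by linarith+
            from less[OF this] k show ?thesis by simp
          qed (use k in simp)
          then show "g k = (\<lambda>_. 1)" unfolding g_def by (rule pt_one)
        qed
        have hr: "\<forall>x\<in>{0..1}. 0 \<le> h r' x \<and> h r' x \<le> 1"
          "\<forall>x\<in>{0..1}. \<forall>y\<in>{0..1}. \<bar>h r' x - h r' y\<bar> \<le> \<rho> * \<bar>x - y\<bar>"
          using h[OF j(1)] unfolding lip_def by blast+
        have "\<bar>Z s (g(p r' := h r')) L * Z1 - Z s g L * Z s (one(p r' := h r')) L\<bar> \<le> \<theta> * Z1\<^sup>2"
          unfolding Z1_def
          using n[THEN spec, THEN spec, THEN spec, THEN spec, THEN spec, THEN spec, THEN mp, OF j(3), THEN mp, OF j(2), THEN mp, OF g1,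
              THEN mp, OF g2, THEN mp, OF g3, THEN mp, OF lip_cts[OF h[OF j(1)]], THEN mp, OF hr(1), THEN mp, OF hr(2)] .
        then have "\<bar>Z s (g(p r' := h r')) L * Z1 - Z s g L * Z s (one(p r' := h r')) L\<bar> / Z1\<^sup>2 \<le> \<theta>"
          using Z1 by (simp add: pos_divide_le_eq)
        also have "\<bar>Z s (g(p r' := h r')) L * Z1 - Z s g L * Z s (one(p r' := h r')) L\<bar> / Z1\<^sup>2 =
          \<bar>(Z s (g(p r' := h r')) L * Z1 - Z s g L * Z s (one(p r' := h r')) L) / Z1\<^sup>2\<bar>" by simp
        also have "(Z s (g(p r' := h r')) L * Z1 - Z s g L * Z s (one(p r' := h r')) L) / Z1\<^sup>2 =
          Z s (g(p r' := h r')) L / Z1 - Z s g L / Z1 * q r'"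
          using Z1 by (simp add: q_def power2_eq_square diff_divide_distrib)
        finally have 1: "\<bar>Z s (pt h p (Suc r')) L / Z1 - Z s g L / Z1 * q r'\<bar> \<le> \<theta>" by (simp add: g_def)
        have IH: "\<bar>Z s g L / Z1 - (\<Prod>j<r'. q j)\<bar> \<le> r' * \<theta>" unfolding g_def using Suc by simp
        have "Z s g L / Z1 * q r' - (\<Prod>j<Suc r'. q j) = (Z s g L / Z1 - (\<Prod>j<r'. q j)) * q r'"
          by (simp add: left_diff_distrib)
        then have "\<bar>Z s g L / Z1 * q r' - (\<Prod>j<Suc r'. q j)\<bar> = \<bar>Z s g L / Z1 - (\<Prod>j<r'. q j)\<bar> * q r'"
          using q(1)[OF j(1)] by (simp only: abs_mult abs_of_nonneg)
        also have "\<dots> \<le> \<bar>Z s g L / Z1 - (\<Prod>j<r'. q j)\<bar>"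
          using q[OF j(1)] by (intro mult_left_le) auto
        finally have "\<bar>Z s (pt h p (Suc r')) L / Z1 - (\<Prod>j<Suc r'. q j)\<bar> \<le> \<theta> + r' * \<theta>"
          using 1 IH by linarith
        also have "\<theta> + r' * \<theta> = Suc r' * \<theta>" by (simp add: algebra_simps)
        finally show ?thesis .
      qed
    qed
    define A where "A j = avg s L (\<lambda>\<sigma>. h j (real (\<sigma> (Suc (p j))) / real (Suc L)))" for j
    have A: "0 \<le> A j \<and> A j \<le> 1" if j: "j < r" for j
    proof -
      have v: "0 \<le> h j (real (\<sigma> (Suc (p j))) / real (Suc L)) \<and> h j (real (\<sigma> (Suc (p j))) / real (Suc L)) \<le> 1"
        if "\<sigma> \<in> pat_perms s L" for \<sigma>
        using h[OF j] perm_value_range[OF that p[OF j]] unfolding lip_def by blast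
      have "(\<Sum>\<sigma>\<in>pat_perms s L. h j (real (\<sigma> (Suc (p j))) / real (Suc L))) \<le> (\<Sum>\<sigma>\<in>pat_perms s L. 1)"
        by (rule sum_mono) (use v in blast)
      moreover have "0 \<le> (\<Sum>\<sigma>\<in>pat_perms s L. h j (real (\<sigma> (Suc (p j))) / real (Suc L)))"
        by (rule sum_nonneg) (use v in blast)
      ultimately show ?thesis using card_pat_perms_pos[of s L] by (simp add: A_def avg_def divide_le_eq)
    qed
    have Aq: "\<bar>A j - q j\<bar> \<le> \<rho> * (3 * \<zeta>)" if j: "j < r" for j
      using avg_pt[OF pos(1,2) L less_imp_le[OF \<rho>], where r = 1 and h = "\<lambda>_. h j" and p = "\<lambda>_. p j" and s = s] h[OF j] p[OF j]
      by (simp add: A_def q_def Z1_def lessThan_Suc)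
    have "\<bar>(\<Prod>j<r. A j) - (\<Prod>j<r. q j)\<bar> \<le> (\<Sum>j<r. \<bar>A j - q j\<bar>)"
      by (rule abs_prod_diff_le) (use A q in auto)
    also have "\<dots> \<le> (\<Sum>j<r. \<rho> * (3 * \<zeta>))" by (rule sum_mono) (use Aq in simp)
    finally have 1: "\<bar>(\<Prod>j<r. A j) - (\<Prod>j<r. q j)\<bar> \<le> \<eta> / 4" using \<zeta>2 by simp
    have 2: "\<bar>avg s L (\<lambda>\<sigma>. \<Prod>j<r. h j (real (\<sigma> (Suc (p j))) / real (Suc L))) - Z s (pt h p r) L / Z1\<bar> \<le> \<eta> / 4"
      using avg_pt[where r = r and h = h and p = p and s = s, OF pos(1,2) L less_imp_le[OF \<rho>] h inj[OF order_refl] p] \<zeta>2 by (simp add: Z1_def)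
    have 3: "\<bar>Z s (pt h p r) L / Z1 - (\<Prod>j<r. q j)\<bar> \<le> \<eta> / 2"
      using D[OF order_refl] False by (simp add: \<theta>_def)
    from 1 2 3 show "\<bar>avg s L (\<lambda>\<sigma>. \<Prod>j<r. h j (real (\<sigma> (Suc (p j))) / real (Suc L)))
      - (\<Prod>j<r. avg s L (\<lambda>\<sigma>. h j (real (\<sigma> (Suc (p j))) / real (Suc L))))\<bar> \<le> \<eta>"
      unfolding A_def[symmetric] by linarith
  qed
qed

section \<open>The Levy-Prokhorov distance\<close>

lemma levy_prokhorov_le:
  assumes "0 < e" "\<And>A. measure_pmf.prob p A \<le> measure_pmf.prob q (eps_nbhd d e A) + e"
    "\<And>A. measure_pmf.prob q A \<le> measure_pmf.prob p (eps_nbhd d e A) + e"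
  shows "levy_prokhorov d p q \<le> e"
  unfolding levy_prokhorov_def
  by (rule cInf_lower) (use assms in \<open>auto intro!: bdd_belowI[of _ 0]\<close>)

section \<open>A partition of unity on the cube\<close>

definition tent :: "nat \<Rightarrow> nat \<Rightarrow> real \<Rightarrow> real" where
  "tent m c x = max 0 (1 - \<bar>m * x - c\<bar>)"

lemma tent_nonneg: "0 \<le> tent m c x"
  by (simp add: tent_def)

lemma lip_tent: "lip m (tent m c)"
proof -
  have "\<bar>tent m c x - tent m c y\<bar> \<le> m * \<bar>x - y\<bar>" for x y :: real
  proof -
    have "\<bar>tent m c x - tent m c y\<bar> \<le> \<bar>m * x - m * y\<bar>" by (simp add: tent_def)
    also have "\<dots> = m * \<bar>x - y\<bar>" by (simp add: right_diff_distrib[symmetric] abs_mult)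
    finally show ?thesis .
  qed
  then show ?thesis by (auto simp: lip_def tent_def)
qed

text \<open>A tent is the difference of two consecutive shifts of a ramp, so the sum telescopes; on
  the unit interval the first ramp is 1 and the last one 0.\<close>

lemma sum_tent:
  assumes "x \<in> {0..1}"
  shows "(\<Sum>c\<le>m. tent m c x) = 1"
proof -
  define ramp where "ramp t = max 0 (min 1 t)" for t :: real
  have "tent m c x = ramp (m * x + 1 - c) - ramp (m * x + 1 - Suc c)" for c
    by (auto simp: tent_def ramp_def max_def min_def abs_if)
  then have "(\<Sum>c\<le>m. tent m c x) = ramp (m * x + 1 - real 0) - ramp (m * x + 1 - Suc m)"
    using sum_telescope[of "\<lambda>c. ramp (m * x + 1 - real c)" m] by simp
  also have "\<dots> = 1"
    using assms mult_left_le[of x "real m"] by (auto simp: ramp_def)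
  finally show ?thesis .
qed

lemma eucl_list_dist_le:
  assumes "length xs = r" "length ys = r" "\<And>j. j < r \<Longrightarrow> \<bar>xs ! j - ys ! j\<bar> \<le> b" "0 \<le> b"
  shows "eucl_list_dist xs ys \<le> sqrt r * b"
proof -
  have "(\<Sum>(x, y)\<leftarrow>zip xs ys. (x - y)\<^sup>2) = (\<Sum>j<r. (xs ! j - ys ! j)\<^sup>2)"
    using assms(1,2) by (simp add: sum_list_sum_nth case_prod_beta atLeast0LessThan)
  also have "\<dots> \<le> (\<Sum>j<r. b\<^sup>2)"
  proof (rule sum_mono)
    fix j assume "j \<in> {..<r}"
    then have "\<bar>xs ! j - ys ! j\<bar> ^ 2 \<le> b ^ 2" using assms(3) by (intro power_mono) auto
    then show "(xs ! j - ys ! j)\<^sup>2 \<le> b\<^sup>2" by simp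
  qed
  also have "\<dots> = r * b\<^sup>2" by simp
  finally have "eucl_list_dist xs ys \<le> sqrt (r * b\<^sup>2)"
    unfolding eucl_list_dist_def by (rule real_sqrt_le_mono)
  then show ?thesis using assms(4) by (simp add: real_sqrt_mult)
qed

text \<open>The products of tent functions form a partition of unity of the cube, subordinate to a cover
  by small cubes.\<close>

lemma prob_le_nbhd:
  fixes P Q :: "real list pmf"
  assumes fin: "finite (set_pmf P)" "finite (set_pmf Q)"
    and supp: "\<And>x. x \<in> set_pmf P \<union> set_pmf Q \<Longrightarrow> length x = r \<and> (\<forall>j<r. x ! j \<in> {0..1})"
    and m: "0 < m" "sqrt r * (2 / m) < e"
    and close: "\<And>g. g \<in> PiE {..<r} (\<lambda>_. {..m}) \<Longrightarrow>
      measure_pmf.expectation P (\<lambda>x. \<Prod>j<r. tent m (g j) (x ! j))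
        \<le> measure_pmf.expectation Q (\<lambda>x. \<Prod>j<r. tent m (g j) (x ! j)) + \<eta>"
    and \<eta>: "0 \<le> \<eta>" "real (Suc m ^ r) * \<eta> \<le> e"
  shows "measure_pmf.prob P A \<le> measure_pmf.prob Q (eps_nbhd eucl_list_dist e A) + e"
proof -
  define G where "G = PiE {..<r} (\<lambda>_. {..m})"
  define \<Phi> where "\<Phi> g x = (\<Prod>j<r. tent m (g j) (x ! j))" for g and x :: "real list"
  \<comment> \<open>The bumps that are positive somewhere on \<open>A\<close> within the support of
    \<open>P\<close>. Their sum dominates the indicator of \<open>A\<close> on that support and
    vanishes away from \<open>A\<close>.\<close>
  define C where "C = {g \<in> G. \<exists>y\<in>A \<inter> set_pmf P. 0 < \<Phi> g y}"
  define \<Psi> where "\<Psi> x = (\<Sum>g\<in>C. \<Phi> g x)" for x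
  have finG: "finite G" unfolding G_def by (intro finite_PiE) auto
  have cardG: "card G = Suc m ^ r" unfolding G_def by (simp add: card_PiE)
  have C: "C \<subseteq> G" "finite C" using finG by (auto simp: C_def intro: finite_subset)
  have \<Phi>0: "0 \<le> \<Phi> g x" for g x unfolding \<Phi>_def by (intro prod_nonneg) (simp add: tent_nonneg)
  have total: "(\<Sum>g\<in>G. \<Phi> g x) = 1" if "x \<in> set_pmf P \<union> set_pmf Q" for x
  proof -
    have "(\<Sum>g\<in>G. \<Phi> g x) = (\<Prod>j<r. \<Sum>c\<le>m. tent m c (x ! j))"
      unfolding G_def \<Phi>_def by (rule prod_sum_PiE[symmetric]) auto
    also have "\<dots> = (\<Prod>j<r. 1)" by (rule prod.cong) (use supp[OF that] sum_tent in auto)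
    finally show ?thesis by simp
  qed
  have intP: "integrable P f" and intQ: "integrable Q f" for f :: "real list \<Rightarrow> real"
    by (rule integrable_measure_pmf_finite fin)+
  have 1: "indicator A x \<le> \<Psi> x" if x: "x \<in> set_pmf P" for x
  proof (cases "x \<in> A")
    case True
    have "\<Psi> x = (\<Sum>g\<in>G. \<Phi> g x)" unfolding \<Psi>_def
    proof (rule sum.mono_neutral_left[OF finG C(1)], rule ballI)
      fix g assume "g \<in> G - C"
      then have "\<not> 0 < \<Phi> g x" using True x by (auto simp: C_def)
      then show "\<Phi> g x = 0" using \<Phi>0[of g x] by simp
    qed
    then show ?thesis using total[of x] x True by simp
  next
    case False
    then show ?thesis using \<Phi>0 by (simp add: \<Psi>_def sum_nonneg)
  qed
  have 2: "\<Psi> x \<le> indicator (eps_nbhd eucl_list_dist e A) x" if x: "x \<in> set_pmf Q" for x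
  proof (cases "\<exists>g\<in>C. 0 < \<Phi> g x")
    case True
    then obtain g y where gy: "g \<in> C" "0 < \<Phi> g x" "y \<in> A" "y \<in> set_pmf P" "0 < \<Phi> g y"
      by (auto simp: C_def)
    have near: "\<bar>m * (z ! j) - g j\<bar> < 1" if "0 < \<Phi> g z" "j < r" for z :: "real list" and j
    proof -
      have "\<Phi> g z = 0" if "tent m (g j) (z ! j) = 0"
        unfolding \<Phi>_def using that \<open>j < r\<close> by (intro prod_zero) auto
      with that have "tent m (g j) (z ! j) \<noteq> 0" by auto
      then show ?thesis by (auto simp: tent_def max_def split: if_splits)
    qed
    \<comment> \<open>One bump is positive at both \<open>x\<close> and \<open>y\<close>, so each
      coordinate of \<open>m * x\<close> and of \<open>m * y\<close> is within 1 of the same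
      integer.\<close>
    have "eucl_list_dist x y \<le> sqrt r * (2 / m)"
    proof (rule eucl_list_dist_le)
      fix j assume j: "j < r"
      have "\<bar>m * (x ! j) - m * (y ! j)\<bar> \<le> 2" using near[OF gy(2) j] near[OF gy(5) j] by linarith
      then have "m * \<bar>x ! j - y ! j\<bar> \<le> 2" by (simp add: right_diff_distrib[symmetric] abs_mult)
      then show "\<bar>x ! j - y ! j\<bar> \<le> 2 / m" using m(1) by (simp add: pos_le_divide_eq mult.commute)
    qed (use supp x gy in auto)
    then have "eucl_list_dist x y < e" using m(2) by linarith
    then have "x \<in> eps_nbhd eucl_list_dist e A" using gy(3) by (auto simp: eps_nbhd_def)
    moreover have "\<Psi> x \<le> (\<Sum>g\<in>G. \<Phi> g x)" unfolding \<Psi>_def by (rule sum_mono2[OF finG C(1)]) (rule \<Phi>0)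
    ultimately show ?thesis using total[of x] x by simp
  next
    case False
    then have "\<Psi> x \<le> (\<Sum>g\<in>C. 0)" unfolding \<Psi>_def by (intro sum_mono) (auto simp: not_less)
    then show ?thesis by (simp add: indicator_def)
  qed
  have "measure_pmf.prob P A = measure_pmf.expectation P (indicator A)" by simp
  also have "\<dots> \<le> measure_pmf.expectation P \<Psi>"
    by (rule integral_mono_AE[OF intP intP]) (use 1 in \<open>simp add: AE_measure_pmf_iff\<close>)
  also have "\<dots> = (\<Sum>g\<in>C. measure_pmf.expectation P (\<Phi> g))"
    unfolding \<Psi>_def by (rule Bochner_Integration.integral_sum) (rule intP)
  also have "\<dots> \<le> (\<Sum>g\<in>C. measure_pmf.expectation Q (\<Phi> g) + \<eta>)"
    by (rule sum_mono) (use close C(1) in \<open>auto simp: G_def \<Phi>_def[abs_def]\<close>)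
  also have "\<dots> = (\<Sum>g\<in>C. measure_pmf.expectation Q (\<Phi> g)) + card C * \<eta>" by (simp add: sum.distrib)
  also have "(\<Sum>g\<in>C. measure_pmf.expectation Q (\<Phi> g)) = measure_pmf.expectation Q \<Psi>"
    unfolding \<Psi>_def by (rule Bochner_Integration.integral_sum[symmetric]) (rule intQ)
  also have "\<dots> \<le> measure_pmf.expectation Q (indicator (eps_nbhd eucl_list_dist e A))"
    by (rule integral_mono_AE[OF intQ intQ]) (use 2 in \<open>simp add: AE_measure_pmf_iff\<close>)
  also have "\<dots> = measure_pmf.prob Q (eps_nbhd eucl_list_dist e A)" by simp
  also have "card C * \<eta> \<le> e"
  proof -
    have "card C \<le> Suc m ^ r" using card_mono[OF finG C(1)] cardG by simp
    then have "real (card C) * \<eta> \<le> real (Suc m ^ r) * \<eta>" by (intro mult_right_mono of_nat_mono \<eta>)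
    with \<eta>(2) show ?thesis by linarith
  qed
  finally show ?thesis by simp
qed

section \<open>Finite product laws\<close>

lemma set_prod_pmf_list:
  "set_pmf (prod_pmf_list ps) = {xs. length xs = length ps \<and> (\<forall>j<length ps. xs ! j \<in> set_pmf (ps ! j))}"
proof (induction ps)
  case (Cons p ps)
  show ?case
  proof (rule set_eqI)
    fix xs
    show "xs \<in> set_pmf (prod_pmf_list (p # ps)) \<longleftrightarrow>
      xs \<in> {xs. length xs = length (p # ps) \<and> (\<forall>j<length (p # ps). xs ! j \<in> set_pmf ((p # ps) ! j))}"
      by (cases xs) (auto simp: Cons.IH All_less_Suc2)
  qed
qed simp

lemma finite_set_prod_pmf_list:
  "(\<And>p. p \<in> set ps \<Longrightarrow> finite (set_pmf p)) \<Longrightarrow> finite (set_pmf (prod_pmf_list ps))"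
  by (induction ps) auto

lemma expectation_prod_pmf_list:
  fixes f :: "nat \<Rightarrow> 'a \<Rightarrow> real"
  assumes "\<And>p. p \<in> set ps \<Longrightarrow> finite (set_pmf p)"
  shows "measure_pmf.expectation (prod_pmf_list ps) (\<lambda>xs. \<Prod>j<length ps. f j (xs ! j))
    = (\<Prod>j<length ps. measure_pmf.expectation (ps ! j) (f j))"
  using assms
proof (induction ps arbitrary: f)
  case (Cons p ps)
  have fp: "finite (set_pmf p)" and fps: "finite (set_pmf (prod_pmf_list ps))"
    using Cons.prems finite_set_prod_pmf_list[of ps] by auto
  have inner: "measure_pmf.expectation (prod_pmf_list ps \<bind> (\<lambda>xs. return_pmf (x # xs)))
      (\<lambda>xs. \<Prod>j<length (p # ps). f j (xs ! j)) =
      f 0 x * (\<Prod>j<length ps. measure_pmf.expectation (ps ! j) (f (Suc j)))" for x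
  proof -
    have "measure_pmf.expectation (prod_pmf_list ps \<bind> (\<lambda>xs. return_pmf (x # xs)))
      (\<lambda>xs. \<Prod>j<length (p # ps). f j (xs ! j)) =
      measure_pmf.expectation (prod_pmf_list ps) (\<lambda>xs. f 0 x * (\<Prod>j<length ps. f (Suc j) (xs ! j)))"
      by (simp add: map_pmf_def[symmetric] prod.lessThan_Suc_shift del: prod.lessThan_Suc)
    also have "\<dots> = f 0 x * measure_pmf.expectation (prod_pmf_list ps) (\<lambda>xs. \<Prod>j<length ps. f (Suc j) (xs ! j))"
      by simp
    also have "\<dots> = f 0 x * (\<Prod>j<length ps. measure_pmf.expectation (ps ! j) (f (Suc j)))"
      using Cons.prems by (subst Cons.IH) auto
    finally show ?thesis .
  qed
  have "measure_pmf.expectation (prod_pmf_list (p # ps)) (\<lambda>xs. \<Prod>j<length (p # ps). f j (xs ! j)) =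
     (\<Sum>x\<in>set_pmf p. pmf p x * (f 0 x * (\<Prod>j<length ps. measure_pmf.expectation (ps ! j) (f (Suc j)))))"
    unfolding prod_pmf_list.simps using fp fps
    by (subst pmf_expectation_bind[of "set_pmf p"]) (simp_all add: inner[simplified])
  also have "\<dots> = (\<Sum>x\<in>set_pmf p. pmf p x * f 0 x) * (\<Prod>j<length ps. measure_pmf.expectation (ps ! j) (f (Suc j)))"
    by (simp add: sum_distrib_right mult.assoc)
  also have "(\<Sum>x\<in>set_pmf p. pmf p x * f 0 x) = measure_pmf.expectation p (f 0)"
    using integral_measure_pmf[OF fp, of p "f 0"] by simp
  finally show ?case
    by (simp add: prod.lessThan_Suc_shift del: prod.lessThan_Suc prod_pmf_list.simps)
qed simp

section \<open>From compositions to ascent patterns\<close>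

lemma comp_descents_subset:
  assumes "is_composition N lam"
  shows "comp_descents lam \<subseteq> {1..<N}"
proof
  fix d assume "d \<in> comp_descents lam"
  then obtain k where k: "1 \<le> k" "k < length lam" "d = sum_list (take k lam)"
    by (auto simp: comp_descents_def)
  have pos: "\<forall>x\<in>set lam. 0 < x" and sum: "sum_list lam = N"
    using assms by (auto simp: is_composition_def)
  have N: "N = sum_list (take k lam) + sum_list (drop k lam)"
    using sum by (metis append_take_drop_id sum_list_append)
  have "0 < sum_list xs" if "xs \<noteq> []" "set xs \<subseteq> set lam" for xs
    using that pos by (cases xs) auto
  note pos = this
  have "take k lam \<noteq> []" "drop k lam \<noteq> []" using k by auto
  then have "0 < sum_list (take k lam)" "0 < sum_list (drop k lam)"
    using pos set_take_subset[of k lam] set_drop_subset[of k lam] by blast+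
  then show "d \<in> {1..<N}" using N k(3) by simp
qed

text \<open>Step \<open>k\<close> of a pattern joins the places \<open>Suc k\<close> and
  \<open>Suc (Suc k)\<close>, so a descent there is recorded as \<open>Suc k\<close>. The range of
  \<open>D\<close> matches the \<open>L\<close> steps, and injectivity excludes equal neighbours, so
  that each step is exactly one of ascent and descent.\<close>

lemma perms_eq_pat_perms:
  assumes D: "D \<subseteq> {1..<Suc L}"
  shows "{\<sigma>. \<sigma> permutes {1..Suc L} \<and> perm_descents (Suc L) \<sigma> = D} = pat_perms (\<lambda>k. Suc k \<notin> D) L"
proof (rule set_eqI)
  fix \<sigma>
  have "perm_descents (Suc L) \<sigma> = D \<longleftrightarrow>
      (\<forall>k<L. if Suc k \<notin> D then \<sigma> (Suc k) < \<sigma> (Suc (Suc k)) else \<sigma> (Suc (Suc k)) < \<sigma> (Suc k))"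
    if \<sigma>: "\<sigma> permutes {1..Suc L}"
  proof -
    have ne: "\<sigma> (Suc k) \<noteq> \<sigma> (Suc (Suc k))" for k
      using permutes_inj[OF \<sigma>] by (simp add: inj_eq)
    have "perm_descents (Suc L) \<sigma> = D \<longleftrightarrow> (\<forall>k<L. Suc k \<in> perm_descents (Suc L) \<sigma> \<longleftrightarrow> Suc k \<in> D)"
    proof
      assume *: "\<forall>k<L. Suc k \<in> perm_descents (Suc L) \<sigma> \<longleftrightarrow> Suc k \<in> D"
      show "perm_descents (Suc L) \<sigma> = D"
      proof (rule set_eqI)
        fix i
        show "i \<in> perm_descents (Suc L) \<sigma> \<longleftrightarrow> i \<in> D"
        proof (cases "i \<in> {1..<Suc L}")
          case True
          then obtain k where "i = Suc k" "k < L" by (cases i) auto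
          then show ?thesis using * by blast
        qed (use D in \<open>auto simp: perm_descents_def\<close>)
      qed
    qed simp
    also have "\<dots> \<longleftrightarrow> (\<forall>k<L. \<sigma> (Suc (Suc k)) < \<sigma> (Suc k) \<longleftrightarrow> Suc k \<in> D)"
      by (simp add: perm_descents_def)
    also have "\<dots> \<longleftrightarrow> (\<forall>k<L. if Suc k \<notin> D then \<sigma> (Suc k) < \<sigma> (Suc (Suc k)) else \<sigma> (Suc (Suc k)) < \<sigma> (Suc k))"
      by (intro all_cong) (use ne in \<open>auto simp: linorder_not_less order_le_less\<close>)
    finally show ?thesis .
  qed
  then show "\<sigma> \<in> {\<sigma>. \<sigma> permutes {1..Suc L} \<and> perm_descents (Suc L) \<sigma> = D} \<longleftrightarrow>
      \<sigma> \<in> pat_perms (\<lambda>k. Suc k \<notin> D) L"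
    unfolding pat_perms_def by blast
qed

theorem mainTheorem1:
  fixes \<epsilon> :: real and r :: nat
  assumes "\<epsilon> > 0" and "r \<ge> 1"
  shows "\<exists>n::nat. \<forall>(N::nat) (lam::nat list) (i::nat \<Rightarrow> nat).
     is_composition N lam \<longrightarrow>
     (\<forall>j<r. 1 \<le> i j \<and> i j \<le> N) \<longrightarrow>
     (\<forall>j. Suc j < r \<longrightarrow> i j < i (Suc j) \<and> n \<le> i (Suc j) - i j) \<longrightarrow>
     levy_prokhorov eucl_list_dist
       (map_pmf (\<lambda>\<sigma>. map (\<lambda>j. real (\<sigma> (i j)) / real N) [0..<r]) (sigma_lambda N lam))
       (prod_pmf_list (map (\<lambda>j. map_pmf (\<lambda>\<sigma>. real (\<sigma> (i j)) / real N) (sigma_lambda N lam)) [0..<r]))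
     \<le> \<epsilon>"
proof -
  \<comment> \<open>Points under a common bump differ by at most \<open>2 / m\<close> in each
    coordinate, hence by \<open>sqrt r * (2 / m)\<close> in the Euclidean distance; this has to be
    below \<epsilon>.\<close>
  obtain m0 :: nat where m0: "sqrt r * 2 / \<epsilon> < m0" using reals_Archimedean2 by blast
  define m where "m = Suc m0"
  have m: "0 < m" "sqrt r * 2 / \<epsilon> < m" using m0 by (auto simp: m_def)
  then have m2: "sqrt r * (2 / m) < \<epsilon>" using assms(1) by (simp add: field_simps)
  \<comment> \<open>There are \<open>Suc m ^ r\<close> bumps, and their errors add up.\<close>
  define \<eta> where "\<eta> = \<epsilon> / real (Suc m ^ r)"
  have \<eta>: "0 < \<eta>" "real (Suc m ^ r) * \<eta> \<le> \<epsilon>" using assms(1) by (simp_all add: \<eta>_def del: of_nat_power of_nat_Suc)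
  obtain n where n: "\<forall>s L h p. (\<forall>j<r. lip m (h j)) \<longrightarrow> (\<forall>j<r. p j \<le> L) \<longrightarrow>
    (\<forall>j. Suc j < r \<longrightarrow> p j < p (Suc j) \<and> p j + n \<le> p (Suc j)) \<longrightarrow>
    \<bar>avg s L (\<lambda>\<sigma>. \<Prod>j<r. h j (real (\<sigma> (Suc (p j))) / real (Suc L)))
      - (\<Prod>j<r. avg s L (\<lambda>\<sigma>. h j (real (\<sigma> (Suc (p j))) / real (Suc L))))\<bar> \<le> \<eta>"
    using perm_independence[OF \<eta>(1), of m r] m(1) by auto
  show ?thesis
  proof (rule exI[of _ n], intro allI impI)
    fix N lam and i :: "nat \<Rightarrow> nat"
    assume lam: "is_composition N lam" and i: "\<forall>j<r. 1 \<le> i j \<and> i j \<le> N"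
      and gap: "\<forall>j. Suc j < r \<longrightarrow> i j < i (Suc j) \<and> n \<le> i (Suc j) - i j"
    define L where "L = N - 1"
    \<comment> \<open>As \<open>r\<close> is at least 1, the index \<open>i 0\<close> lies between 1
      and \<open>N\<close>, so \<open>N\<close> is positive.\<close>
    have N: "N = Suc L" using i[rule_format, of 0] assms(2) by (simp add: L_def)
    define p where "p j = i j - 1" for j
    have ip: "i j = Suc (p j)" "p j \<le> L" if "j < r" for j
      using i[rule_format, OF that] by (auto simp: p_def N)
    define s where "s k \<longleftrightarrow> Suc k \<notin> comp_descents lam" for k
    define S where "S = pat_perms s L"
    have fS: "finite S" "S \<noteq> {}" using finite_pat_perms card_pat_perms_pos[of s L] by (auto simp: S_def)
    have sp: "set_pmf (pmf_of_set S) = S" by (rule set_pmf_of_set[OF fS(2,1)])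
    have sig: "sigma_lambda N lam = pmf_of_set S"
      unfolding sigma_lambda_def S_def N s_def
      using perms_eq_pat_perms[OF comp_descents_subset[OF lam, unfolded N]] by simp
    define y where "y \<sigma> j = real (\<sigma> (i j)) / real N" for \<sigma> :: "nat \<Rightarrow> nat" and j
    have y: "y \<sigma> j \<in> {0..1}" if "\<sigma> \<in> S" "j < r" for \<sigma> j
      unfolding y_def N ip(1)[OF that(2)]
      by (rule perm_value_range[OF that(1)[unfolded S_def] ip(2)[OF that(2)]])
    define P where "P = map_pmf (\<lambda>\<sigma>. map (y \<sigma>) [0..<r]) (pmf_of_set S)"
    define ps where "ps = map (\<lambda>j. map_pmf (\<lambda>\<sigma>. y \<sigma> j) (pmf_of_set S)) [0..<r]"
    define Q where "Q = prod_pmf_list ps"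
    have fP: "finite (set_pmf P)" using fS(1) by (simp add: P_def sp)
    have fps: "finite (set_pmf q)" if "q \<in> set ps" for q using that fS(1) by (auto simp: ps_def sp)
    have fQ: "finite (set_pmf Q)" unfolding Q_def by (rule finite_set_prod_pmf_list[OF fps])
    have supp: "length x = r \<and> (\<forall>j<r. x ! j \<in> {0..1})" if x: "x \<in> set_pmf P \<union> set_pmf Q" for x
    proof -
      have "x \<in> set_pmf P \<or> x \<in> set_pmf Q" using x by blast
      then show ?thesis
      proof
        assume "x \<in> set_pmf P"
        then obtain \<sigma> where "\<sigma> \<in> S" "x = map (y \<sigma>) [0..<r]" by (auto simp: P_def sp)
        then show ?thesis using y by simp
      next
        assume "x \<in> set_pmf Q"
        then have x: "length x = r" "\<forall>j<r. x ! j \<in> (\<lambda>\<sigma>. y \<sigma> j) ` S"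
          by (auto simp: Q_def set_prod_pmf_list ps_def sp)
        have "x ! j \<in> {0..1}" if j: "j < r" for j
        proof -
          obtain \<sigma> where "\<sigma> \<in> S" "x ! j = y \<sigma> j" using x(2) j by blast
          then show ?thesis using y[of \<sigma> j] j by simp
        qed
        with x(1) show ?thesis by blast
      qed
    qed
    \<comment> \<open>Under \<open>P\<close> the expectation of a bump is a joint average over the
      permutations, under \<open>Q\<close> the product of the single averages. The two-sided
      estimate serves both inequalities of the distance.\<close>
    have close: "\<bar>measure_pmf.expectation P (\<lambda>x. \<Prod>j<r. tent m (g j) (x ! j))
        - measure_pmf.expectation Q (\<lambda>x. \<Prod>j<r. tent m (g j) (x ! j))\<bar> \<le> \<eta>" for g
    proof -
      have "measure_pmf.expectation P (\<lambda>x. \<Prod>j<r. tent m (g j) (x ! j))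
          = avg s L (\<lambda>\<sigma>. \<Prod>j<r. tent m (g j) (y \<sigma> j))"
        using fS by (simp add: P_def integral_pmf_of_set avg_def S_def)
      also have "\<dots> = avg s L (\<lambda>\<sigma>. \<Prod>j<r. tent m (g j) (real (\<sigma> (Suc (p j))) / real (Suc L)))"
        by (intro arg_cong[of _ _ "avg s L"] ext prod.cong) (simp_all add: y_def N ip(1))
      finally have EP: "measure_pmf.expectation P (\<lambda>x. \<Prod>j<r. tent m (g j) (x ! j))
          = avg s L (\<lambda>\<sigma>. \<Prod>j<r. tent m (g j) (real (\<sigma> (Suc (p j))) / real (Suc L)))" .
      have "measure_pmf.expectation Q (\<lambda>x. \<Prod>j<r. tent m (g j) (x ! j))
          = (\<Prod>j<r. measure_pmf.expectation (ps ! j) (tent m (g j)))"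
        using expectation_prod_pmf_list[where ps = ps and f = "\<lambda>j. tent m (g j)", OF fps] by (simp add: Q_def ps_def)
      also have "\<dots> = (\<Prod>j<r. avg s L (\<lambda>\<sigma>. tent m (g j) (real (\<sigma> (Suc (p j))) / real (Suc L))))"
        using fS by (intro prod.cong) (simp_all add: ps_def integral_pmf_of_set avg_def S_def y_def N ip(1))
      finally have EQ: "measure_pmf.expectation Q (\<lambda>x. \<Prod>j<r. tent m (g j) (x ! j))
          = (\<Prod>j<r. avg s L (\<lambda>\<sigma>. tent m (g j) (real (\<sigma> (Suc (p j))) / real (Suc L))))" .
      have gap': "\<forall>j. Suc j < r \<longrightarrow> p j < p (Suc j) \<and> p j + n \<le> p (Suc j)"
      proof (intro allI impI)
        fix j assume "Suc j < r"
        then show "p j < p (Suc j) \<and> p j + n \<le> p (Suc j)"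
          using gap[rule_format, of j] ip(1)[of j] ip(1)[of "Suc j"] by auto
      qed
      show ?thesis unfolding EP EQ
        using n[THEN spec[of _ s], THEN spec[of _ L], THEN spec[of _ "\<lambda>j. tent m (g j)"], THEN spec[of _ p]]
          lip_tent ip(2) gap' by blast
    qed
    have "levy_prokhorov eucl_list_dist P Q \<le> \<epsilon>"
    proof (rule levy_prokhorov_le[OF assms(1)])
      fix A
      show "measure_pmf.prob P A \<le> measure_pmf.prob Q (eps_nbhd eucl_list_dist \<epsilon> A) + \<epsilon>"
      proof (rule prob_le_nbhd[OF fP fQ supp m(1) m2 _ less_imp_le[OF \<eta>(1)] \<eta>(2)])
        show "measure_pmf.expectation P (\<lambda>x. \<Prod>j<r. tent m (g j) (x ! j))
          \<le> measure_pmf.expectation Q (\<lambda>x. \<Prod>j<r. tent m (g j) (x ! j)) + \<eta>" for g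
          using close[of g] by linarith
      qed
      show "measure_pmf.prob Q A \<le> measure_pmf.prob P (eps_nbhd eucl_list_dist \<epsilon> A) + \<epsilon>"
      proof (rule prob_le_nbhd[OF fQ fP _ m(1) m2 _ less_imp_le[OF \<eta>(1)] \<eta>(2)])
        show "length x = r \<and> (\<forall>j<r. x ! j \<in> {0..1})" if "x \<in> set_pmf Q \<union> set_pmf P" for x
          using supp[of x] that by blast
        show "measure_pmf.expectation Q (\<lambda>x. \<Prod>j<r. tent m (g j) (x ! j))
          \<le> measure_pmf.expectation P (\<lambda>x. \<Prod>j<r. tent m (g j) (x ! j)) + \<eta>" for g
          using close[of g] by linarith
      qed
    qed
    then show "levy_prokhorov eucl_list_dist
       (map_pmf (\<lambda>\<sigma>. map (\<lambda>j. real (\<sigma> (i j)) / real N) [0..<r]) (sigma_lambda N lam))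
       (prod_pmf_list (map (\<lambda>j. map_pmf (\<lambda>\<sigma>. real (\<sigma> (i j)) / real N) (sigma_lambda N lam)) [0..<r]))
     \<le> \<epsilon>"
      by (simp only: P_def Q_def ps_def y_def[abs_def] sig)
  qed
qed

end
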